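(* Let $q\in[0,1]$, let $R_q>0$ and $\omega>0$ be positive numbers such that $\Theta^*\in\mathbb{B}_q(R_q)\cap\mathcal{S}$, and let $\lambda>0$. Let $\hat\Theta$ be a global solution of $\min_{\Theta\in\mathcal{S}}\Psi(\Theta)$, $\Psi=\mathcal{L}_N+\mathcal{P}_\lambda$. Suppose that the regularizer $\mathcal{P}_\lambda$ is built from a univariate function $p_\lambda$ satisfying conditions (i)–(v) of the context (with constant $\mu\ge0$), and that there are $\alpha_2,\tau_2,\alpha_3,\tau_3>0$ with $\alpha_2>\mu/2$ such that for all $\Theta,\Theta'\in\mathbb{R}^{d_1\times d_2}$ $$\mathcal{T}(\Theta,\Theta')\ge\alpha_2\|\Theta-\Theta'\|_F^2-\tau_2\|\Theta-\Theta'\|_*^2,\qquad \mathcal{T}(\Theta,\Theta')\le\alpha_3\|\Theta-\Theta'\|_F^2+\tau_3\|\Theta-\Theta'\|_*^2.$$ Set $\tau=\max\{\tau_2,\tau_3\}$. Assume that $(\lambda,\omega)$ are chosen to satisfy $$\lambda\ge\max\left\{4\|\nabla\mathcal{L}_N(\Theta^* )\|_{op},\ 8\omega\tau,\ \left(\frac{256\,\tau R_q}{2\alpha_2-\mu}\right)^{1/q}\right\}.$$ Let $\{\Theta^t\}_{t=0}^\infty$ be a sequence of iterates generated from an initial point $\Theta^0$ by $$\Theta^{t+1}\in\arg\min_{\Theta\in\mathcal{S}}\left\{\frac12\left\|\Theta-\left(\Theta^t-\frac{\nabla\bar{\mathcal{L}}_N(\Theta^t)}{v}\right)\right\|_F^2+\frac{\lambda}{v}\|\Theta\|_*\right\}$$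 with $v\ge\max\{\frac{2\alpha_2-\mu}{4},2\alpha_3\}$. Define $$\bar\epsilon_{stat}=8\lambda^{-q/2}R_q^{1/2}\left(\sqrt2\,\|\hat\Theta-\Theta^*\|_F+\lambda^{1-q/2}R_q^{1/2}\right),$$ $$\kappa=\left\{1-\frac{2\alpha_2-\mu}{8v}+\frac{512\tau\lambda^{-q}R_q}{2\alpha_2-\mu}\right\}\left\{1-\frac{512\tau\lambda^{-q}R_q}{2\alpha_2-\mu}\right\}^{-1},$$ $$\xi=2\tau\left\{\frac{2\alpha_2-\mu}{8v}+\frac{1024\tau\lambda^{-q}R_q}{2\alpha_2-\mu}+5\right\}\left\{1-\frac{512\tau\lambda^{-q}R_q}{2\alpha_2-\mu}\right\}^{-1}.$$ Then for any tolerance $\delta^*\ge\frac{8\xi}{1-\kappa}\bar\epsilon_{stat}^2$ and any iteration $t\ge T(\delta^* )$, $$\|\Theta^t-\hat\Theta\|_F^2\le\frac{4}{2\alpha_2-\mu}\left(\delta^*+\frac{{\delta^*}^2}{8\tau\omega^2}+4\tau\bar\epsilon_{stat}^2\right),$$ where $$T(\delta^* )=\log_2\log_2\left(\frac{\omega\lambda}{\delta^*}\right)\left(1+\frac{\log2}{\log(1/\kappa)}\right)+\frac{\log((\Psi(\Theta^0)-\Psi(\hat\Theta))/\delta^* )}{\log(1/\kappa)}.$$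
   Context: Let $d_1,d_2\ge1$ and $d=\min\{d_1,d_2\}$. For $\Theta\in\mathbb{R}^{d_1\times d_2}$ let $\sigma_1(\Theta)\ge\dots\ge\sigma_d(\Theta)\ge0$ be its singular values, $\|\Theta\|_*=\sum_j\sigma_j(\Theta)$, $\|\Theta\|_{op}=\sigma_1(\Theta)$, $\|\Theta\|_F=(\sum_j\sigma_j(\Theta)^2)^{1/2}$, and $\langle A,B\rangle=\mathrm{trace}(A^\top B)$. For $q\in[0,1]$ and $R_q>0$, $\mathbb{B}_q(R_q)=\{\Theta\in\mathbb{R}^{d_1\times d_2}:\sum_{i=1}^d|\sigma_i(\Theta)|^q\le R_q\}$, where for $q=0$ the sum is the number of nonzero singular values (the rank). The feasible region is $\mathcal{S}=\{\Theta\in\mathbb{R}^{d_1\times d_2}:\|\Theta\|_*\le\omega\}$. The matrix $\Theta^*\in\mathbb{R}^{d_1\times d_2}$ is the fixed (true) parameter. The loss $\mathcal{L}_N:\mathbb{R}^{d_1\times d_2}\to\mathbb{R}_+$ is a differentiable, not necessarily convex, function, and $\mathcal{T}(\Theta,\Theta')=\mathcal{L}_N(\Theta)-\mathcal{L}_N(\Theta')-\langle\nabla\mathcal{L}_N(\Theta'),\Theta-\Theta'\rangle$. Regularizer: $\mathcal{P}_\lambda(\Theta)=\sum_{j=1}^d p_\lambda(\sigma_j(\Theta))$ with $p_\lambda:\mathbb{R}\to\mathbb{R}$, possibly nonconvex. Write $p_\lambda(t)=q_\lambda(t)+\lambda|t|$ with $q_\lambda$ concave, and $\mathcal{Q}_\lambda(\Theta)=\sum_{j=1}^d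 q_\lambda(\sigma_j(\Theta))$, so $\mathcal{P}_\lambda=\mathcal{Q}_\lambda+\lambda\|\cdot\|_*$; $\mathcal{Q}_\lambda$ is the differentiable part, and $\bar{\mathcal{L}}_N=\mathcal{L}_N+\mathcal{Q}_\lambda$. Conditions on $p_\lambda$: (i) $p_\lambda(0)=0$ and $p_\lambda(t)=p_\lambda(-t)$ for all $t\in\mathbb{R}$; (ii) for $t>0$, $t\mapsto p_\lambda(t)/t$ is nonincreasing; (iii) $p_\lambda$ is differentiable for all $t\ne0$ and subdifferentiable at $t=0$, with $\lim_{t\to0^+}p_\lambda'(t)=\lambda$; (iv) on $[0,\infty)$, $p_\lambda$ is nondecreasing and concave; (v) there is a constant $\mu\ge0$ such that $q_\lambda'(t)-q_\lambda'(t')\ge-\mu(t-t')$ for all $t>t'$.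
   Formalization: Assumes 0<κ<1 (not implied by the bound on λ) and Θ^0∈S; log2 log2(ωλ/δ* ) is read as 0 when ωλ/δ*<2; for q=0 the third bound on λ is read as 256τR_q/(2α_2-μ)≤1; T=-∞ if Ψ(Θ^0)=Ψ(Θ̂). Without these the claim is false or undefined. *)

theory Defs
  imports "HOL-Analysis.Analysis" "HOL-Computational_Algebra.Polynomial"
begin

text \<open>
  A real matrix with \<open>d\<^sub>1\<close> rows and \<open>d\<^sub>2\<close> columns has type \<open>real^'n^'m\<close>, where
  \<open>d\<^sub>1 = CARD('m)\<close> and \<open>d\<^sub>2 = CARD('n)\<close>.
\<close>

section \<open>Singular values and the norms they define\<close>

definition charpoly :: "real^'n^'n \<Rightarrow> real poly" where
  "charpoly A = det (\<chi> i j. (if i = j then [:0, 1:] else 0) - [:A $ i $ j:])"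

definition min_dim :: "real^'n^'m \<Rightarrow> nat" where
  "min_dim (X :: real^'n^'m) = min (CARD('m)) (CARD('n))"

text \<open>
  The square roots of the eigenvalues of \<open>X\<^sup>T X\<close>, with multiplicity and in nonincreasing order.
  If there are more columns than rows, the entries beyond the first \<open>min_dim X\<close> are
  zeros; they are not singular values and are never accessed below.
\<close>

definition sqrt_eigenvalues :: "real^'n^'m \<Rightarrow> real list" where
  "sqrt_eigenvalues X =
     rev (sorted_list_of_multiset (image_mset sqrt (proots (charpoly (transpose X ** X)))))"

definition sing_val :: "nat \<Rightarrow> real^'n^'m \<Rightarrow> real" where
  "sing_val j X = sqrt_eigenvalues X ! (j - 1)"  \<comment> \<open>meaningful for \<open>1 \<le> j \<le> min_dim X\<close>\<close>

definition nuc_norm :: "real^'n^'m \<Rightarrow> real" where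
  "nuc_norm X = (\<Sum>j = 1..min_dim X. sing_val j X)"

definition op_norm :: "real^'n^'m \<Rightarrow> real" where
  "op_norm X = sing_val 1 X"

definition frob_norm :: "real^'n^'m \<Rightarrow> real" where
  "frob_norm X = sqrt (\<Sum>j = 1..min_dim X. (sing_val j X)\<^sup>2)"

definition mat_inner :: "real^'n^'m \<Rightarrow> real^'n^'m \<Rightarrow> real" where
  "mat_inner A B = trace (transpose A ** B)"

lemma mat_inner_eq_inner: "mat_inner A B = A \<bullet> B"
proof -
  have "mat_inner A B = (\<Sum>i\<in>UNIV. \<Sum>k\<in>UNIV. A $ k $ i * B $ k $ i)"
    by (simp add: mat_inner_def trace_def transpose_def matrix_matrix_mult_def)
  also have "\<dots> = (\<Sum>k\<in>UNIV. \<Sum>i\<in>UNIV. A $ k $ i * B $ k $ i)"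
    by (rule sum.swap)
  finally show ?thesis
    by (simp add: inner_vec_def)
qed

text \<open>
  For \<open>q = 0\<close> the sum is the number of nonzero singular values, because
  \<open>0 powr 0 = 0\<close> and \<open>x powr 0 = 1\<close> for \<open>x \<noteq> 0\<close>.
\<close>

definition schatten_ball :: "real \<Rightarrow> real \<Rightarrow> (real^'n^'m) set" where
  "schatten_ball q R = {X. (\<Sum>j = 1..min_dim X. \<bar>sing_val j X\<bar> powr q) \<le> R}"

definition feasible :: "real \<Rightarrow> (real^'n^'m) set" where
  "feasible \<omega> = {X. nuc_norm X \<le> \<omega>}"


section \<open>Gradients and the first-order Taylor error\<close>

definition grad :: "(real^'n^'m \<Rightarrow> real) \<Rightarrow> real^'n^'m \<Rightarrow> real^'n^'m" where
  "grad f X = (THE G. (f has_derivative (\<lambda>H. mat_inner G H)) (at X))"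

definition taylor_error :: "(real^'n^'m \<Rightarrow> real) \<Rightarrow> real^'n^'m \<Rightarrow> real^'n^'m \<Rightarrow> real" where
  "taylor_error f X Y = f X - f Y - mat_inner (grad f Y) (X - Y)"


section \<open>The regularizer\<close>

definition concave_part :: "real \<Rightarrow> (real \<Rightarrow> real) \<Rightarrow> real \<Rightarrow> real" where
  "concave_part lam p t = p t - lam * \<bar>t\<bar>"

definition spectral_sum :: "(real \<Rightarrow> real) \<Rightarrow> real^'n^'m \<Rightarrow> real" where
  "spectral_sum f X = (\<Sum>j = 1..min_dim X. f (sing_val j X))"

text \<open>
  The conjunct with \<open>g\<close> is subdifferentiability at \<open>0\<close>.  The conditions make the concave
  part differentiable everywhere, with derivative \<open>0\<close> at \<open>0\<close>, so the last conjunct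
  compares genuine derivatives.
\<close>

definition admissible_regularizer :: "real \<Rightarrow> real \<Rightarrow> (real \<Rightarrow> real) \<Rightarrow> bool" where
  "admissible_regularizer lam \<mu> p \<longleftrightarrow>
     concave_on UNIV (concave_part lam p) \<and>
     p 0 = 0 \<and> (\<forall>t. p t = p (- t)) \<and>
     antimono_on {0<..} (\<lambda>t. p t / t) \<and>
     (\<forall>t. t \<noteq> 0 \<longrightarrow> p differentiable (at t)) \<and>
     (\<exists>g. \<forall>t. p t \<ge> p 0 + g * (t - 0)) \<and>
     ((\<lambda>t. deriv p t) \<longlongrightarrow> lam) (at_right 0) \<and>
     mono_on {0..} p \<and> concave_on {0..} p \<and>
     (\<forall>t t'. t > t' \<longrightarrow>
        deriv (concave_part lam p) t - deriv (concave_part lam p) t' \<ge> - \<mu> * (t - t'))"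

definition objective ::
  "(real^'n^'m \<Rightarrow> real) \<Rightarrow> (real \<Rightarrow> real) \<Rightarrow> real^'n^'m \<Rightarrow> real" where
  "objective L p X = L X + spectral_sum p X"

definition smooth_part ::
  "(real^'n^'m \<Rightarrow> real) \<Rightarrow> real \<Rightarrow> (real \<Rightarrow> real) \<Rightarrow> real^'n^'m \<Rightarrow> real" where
  "smooth_part L lam p X = L X + spectral_sum (concave_part lam p) X"


section \<open>Proximal gradient step\<close>

definition prox_objective ::
  "(real^'n^'m \<Rightarrow> real) \<Rightarrow> real \<Rightarrow> (real \<Rightarrow> real) \<Rightarrow> real \<Rightarrow> real^'n^'m \<Rightarrow> real^'n^'m \<Rightarrow> real" where
  "prox_objective L lam p v Y X =
     1/2 * (frob_norm (X - (Y - (1 / v) *\<^sub>R grad (smooth_part L lam p) Y)))\<^sup>2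
     + lam / v * nuc_norm X"


section \<open>Constants of the convergence theorem\<close>

definition stat_error :: "real \<Rightarrow> real \<Rightarrow> real \<Rightarrow> real^'n^'m \<Rightarrow> real^'n^'m \<Rightarrow> real" where
  "stat_error q R lam Xhat Xstar =
     8 * lam powr (- q / 2) * R powr (1/2) *
       (sqrt 2 * frob_norm (Xhat - Xstar) + lam powr (1 - q / 2) * R powr (1/2))"

definition contraction_factor ::
  "real \<Rightarrow> real \<Rightarrow> real \<Rightarrow> real \<Rightarrow> real \<Rightarrow> real \<Rightarrow> real \<Rightarrow> real" where
  "contraction_factor q R lam \<alpha>\<^sub>2 \<mu> \<tau> v =
     (1 - (2*\<alpha>\<^sub>2 - \<mu>) / (8 * v) + 512 * \<tau> * lam powr (- q) * R / (2*\<alpha>\<^sub>2 - \<mu>))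
     * inverse (1 - 512 * \<tau> * lam powr (- q) * R / (2*\<alpha>\<^sub>2 - \<mu>))"

definition xi_factor ::
  "real \<Rightarrow> real \<Rightarrow> real \<Rightarrow> real \<Rightarrow> real \<Rightarrow> real \<Rightarrow> real \<Rightarrow> real" where
  "xi_factor q R lam \<alpha>\<^sub>2 \<mu> \<tau> v =
     2 * \<tau> * ((2*\<alpha>\<^sub>2 - \<mu>) / (8 * v) + 1024 * \<tau> * lam powr (- q) * R / (2*\<alpha>\<^sub>2 - \<mu>) + 5)
     * inverse (1 - 512 * \<tau> * lam powr (- q) * R / (2*\<alpha>\<^sub>2 - \<mu>))"

text \<open>
  The iterated logarithm enters an iteration count, where it stands for a number of
  stages.  It is \<open>log\<^sub>2 (log\<^sub>2 x)\<close> wherever that is nonnegative, and \<open>0\<close> for \<open>x < 2\<close>, where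
  the formula is negative (\<open>1 < x < 2\<close>) or undefined (\<open>x \<le> 1\<close>).
\<close>

definition loglog2 :: "real \<Rightarrow> real" where
  "loglog2 x = (if x < 2 then 0 else log 2 (log 2 x))"

text \<open>
  \<open>gap\<close> is the initial excess of the objective over its minimum, hence nonnegative; the
  extended reals give \<open>log 0 = -\<infinity>\<close> its usual meaning (the library's \<open>ln 0\<close> is \<open>0\<close>).
\<close>

definition iteration_bound :: "real \<Rightarrow> real \<Rightarrow> real \<Rightarrow> real \<Rightarrow> real \<Rightarrow> ereal" where
  "iteration_bound \<omega> lam \<kappa> gap \<delta> =
     ereal (loglog2 (\<omega> * lam / \<delta>) * (1 + ln 2 / ln (1 / \<kappa>)))
     + (if gap = 0 then - \<infinity> else ereal (ln (gap / \<delta>) / ln (1 / \<kappa>)))"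

end

theory Submission
  imports Defs
begin

text \<open>
  Each iterate is compared with the minimizer through single-step inequalities, without an
  induction over stages.  The restricted lower bound of the regularizer at the true parameter shows
  that the nuclear norm of \<open>X - That\<close> is at most a multiple of its Frobenius norm plus the statistical
  error, up to an excess \<open>z\<close> that is paid for by the objective: in units of \<open>\<omega>\<close> and \<open>\<tau> * \<omega>\<^sup>2\<close>,
  \<open>6 * z - z\<^sup>2\<close> is at most the objective gap.  A proximal step satisfies the usual three-point
  inequality for the gap, and a second inequality in which strong convexity is used at both end
  points (through second differences of the smooth part) and the gap is replaced by its
  linearization at the minimizer.  Together they give \<open>A f\<^sup>+ + \<beta> (z\<^sup>+)\<^sup>2 \<le> B f + \<gamma> z\<^sup>2 + K\<close> for the squared
  Frobenius distance \<open>f\<close>, contracting at least as fast as \<open>\<kappa>\<close>.  If \<open>2\<alpha>\<^sub>2 - \<mu>\<close> is large compared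
  with \<open>v\<close>, testing both curvature conditions on a rank one matrix bounds \<open>v\<close> by a multiple of \<open>\<tau>\<close>;
  with \<open>\<kappa> < 1\<close>, no singular value of the true parameter exceeds \<open>\<lambda>\<close>, so the noise is purely statistical, and
  a large distance to the minimizer contradicts the second inequality directly.
\<close>

section \<open>Singular value decomposition\<close>

text \<open>The iteration count says only that \<open>\<kappa> ^ t\<close> times the initial gap is
  at most \<open>\<delta>\<close>; the gap itself is not shown to decay at that rate, so the squared
  distance and the excess \<open>z\<close> are tracked jointly. The three-point inequality alone
  cannot contract \<open>z\<close>: the new excess \<open>y\<close> pays \<open>6 * y - y^2\<close>
  and is charged \<open>z^2 + (z + y)^2\<close>, which at the value 1 is 5 on both sides. The
  linearized gap is convex, so it can be bounded from points close to the minimizer, where the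
  quadratic loss fades; it then pays almost \<open>6 * y\<close> against \<open>(z + y)^2\<close>, 6
  against 4. The price of going only a fraction \<open>r\<close> of the way is twofold: the
  statistical noise counts \<open>1 / r\<close> times, and a share \<open>r\<close> of the new
  squared distance is lost. With \<open>a = (2\<alpha>\<^sub>2 - \<mu>) / (4 v)\<close> and
  \<open>b = 4 * a\<close>, the factors \<open>1 + b - r\<close> and \<open>1 - b\<close> contract
  only for \<open>r < 8 * a\<close>. For small \<open>a\<close> such an \<open>r\<close> makes the
  noise too large, and the two inequalities must be mixed; for larger \<open>a\<close> the
  linearized one suffices. The noise budget is fixed by \<xi> and leaves little slack, hence the
  separate ranges of \<open>a\<close>, each with its own constants.\<close>

lemma exists_orthonormal_eigenvectors:
  fixes f :: "'a::euclidean_space \<Rightarrow> 'a"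
  assumes lin: "linear f" and sym: "\<And>x y. f x \<bullet> y = x \<bullet> f y"
  assumes "k \<le> DIM('a)"
  shows "\<exists>B. finite B \<and> card B = k \<and> pairwise orthogonal B \<and> (\<forall>b\<in>B. norm b = 1 \<and> (\<exists>c. f b = c *\<^sub>R b))"
  using assms(3)
proof (induction k)
  case 0
  then show ?case by (intro exI[of _ "{}"]) auto
next
  case (Suc k)
  then have "\<exists>B. finite B \<and> card B = k \<and> pairwise orthogonal B \<and> (\<forall>b\<in>B. norm b = 1 \<and> (\<exists>c. f b = c *\<^sub>R b))"
    by simp
  then obtain B where B: "finite B" "card B = k" "pairwise orthogonal B"
    "\<And>b. b \<in> B \<Longrightarrow> norm b = 1" "\<And>b. b \<in> B \<Longrightarrow> \<exists>c. f b = c *\<^sub>R b" by blast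
  define S where "S = {x. \<forall>b\<in>B. b \<bullet> x = 0}"
  have subS: "subspace S" unfolding S_def subspace_def by (auto simp: inner_right_distrib)
  have fS: "f x \<in> S" if "x \<in> S" for x
  proof -
    have "b \<bullet> f x = 0" if bB: "b \<in> B" for b
    proof -
      obtain c where "f b = c *\<^sub>R b" using B(5)[OF bB] by blast
      then show ?thesis using sym[of b x] \<open>x \<in> S\<close> bB by (auto simp: S_def)
    qed
    then show ?thesis by (auto simp: S_def)
  qed
  have "span B \<noteq> UNIV"
  proof
    assume "span B = UNIV"
    then have "DIM('a) \<le> card B" using dim_le_card[of UNIV B] B(1) by simp
    then show False using Suc.prems B(2) by simp
  qed
  then obtain a where a: "a \<noteq> 0" "\<And>x. x \<in> span B \<Longrightarrow> a \<bullet> x = 0"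
    using span_not_UNIV_orthogonal by blast
  then have aS: "a \<in> S" by (auto simp: S_def inner_commute span_base)
  \<comment> \<open>The next eigenvector is the maximizer of the Rayleigh quotient on the unit
    sphere of the invariant complement \<open>S\<close>.\<close>
  define K where "K = S \<inter> sphere 0 1"
  have "compact K" unfolding K_def by (intro closed_Int_compact closed_subspace subS) auto
  moreover have "a /\<^sub>R norm a \<in> K" using a aS subS by (auto simp: K_def subspace_scale)
  moreover have "continuous_on K (\<lambda>x. x \<bullet> f x)"
    using lin by (intro continuous_intros linear_continuous_on) (simp add: linear_conv_bounded_linear)
  ultimately obtain e where e: "e \<in> K" "\<And>y. y \<in> K \<Longrightarrow> y \<bullet> f y \<le> e \<bullet> f e"
    using continuous_attains_sup[of K "\<lambda>x. x \<bullet> f x"] by blast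
  define M where "M = e \<bullet> f e"
  define g where "g x = M *\<^sub>R x - f x" for x
  have eS: "e \<in> S" and ne: "norm e = 1" using e(1) by (auto simp: K_def)
  have ling: "linear g" unfolding g_def using lin by (intro linear_compose_sub) (auto intro!: linearI simp: algebra_simps)
  have gS: "g x \<in> S" if "x \<in> S" for x using fS that subS by (auto simp: g_def subspace_diff subspace_scale)
  have psd: "0 \<le> x \<bullet> g x" if "x \<in> S" for x
  proof (cases "x = 0")
    case False
    have "x /\<^sub>R norm x \<in> K" using that False subS by (auto simp: K_def subspace_scale)
    from e(2)[OF this] have "(x \<bullet> f x) / (norm x)\<^sup>2 \<le> M"
      using lin by (simp add: M_def linear_scale power2_eq_square field_simps)
    then have "x \<bullet> f x \<le> M * (norm x)\<^sup>2" using False by (simp add: divide_le_eq)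
    then show ?thesis by (simp add: g_def inner_diff_right dot_square_norm)
  qed (simp add: g_def)
  have symg: "g x \<bullet> y = x \<bullet> g y" for x y by (simp add: g_def inner_diff_left inner_diff_right sym)
  have ege: "e \<bullet> g e = 0" using ne by (simp add: g_def inner_diff_right M_def dot_square_norm)
  \<comment> \<open>On \<open>S\<close> the form of \<open>g\<close> is nonnegative and vanishes at
    \<open>e\<close>. If \<open>y = g e\<close> were nonzero, a small step from \<open>e\<close>
    against \<open>y\<close> would make the form negative. The denominator \<open>A + 1\<close>
    keeps \<open>t\<close> defined when \<open>A\<close> is zero.\<close>
  have "g e = 0"
  proof (rule ccontr)
    assume ge: "g e \<noteq> 0"
    define y where "y = g e"
    define A where "A = y \<bullet> g y"
    have A: "A \<ge> 0" unfolding A_def y_def using psd gS eS by blast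
    have yy: "y \<bullet> y > 0" using ge by (simp add: y_def)
    define t where "t = - (y \<bullet> y) / (A + 1)"
    have "0 \<le> (e + t *\<^sub>R y) \<bullet> g (e + t *\<^sub>R y)"
      using subS gS eS by (intro psd) (simp add: y_def subspace_add subspace_scale)
    also have "\<dots> = e \<bullet> g e + 2 * t * (y \<bullet> y) + t\<^sup>2 * A"
      using ling symg[of e y] by (simp add: linear_add linear_scale inner_add_left inner_add_right A_def y_def power2_eq_square algebra_simps inner_commute)
    also have "\<dots> = t * (2 * (y \<bullet> y) + t * A)" using ege by (simp add: power2_eq_square algebra_simps)
    finally have *: "0 \<le> t * (2 * (y \<bullet> y) + t * A)" .
    have tneg: "t < 0" using yy A by (simp add: t_def divide_neg_pos)
    have "t * A = - (y \<bullet> y) * (A / (A + 1))" by (simp add: t_def)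
    also have "\<dots> \<ge> - (y \<bullet> y)" using A yy by (simp add: mult_le_cancel_left1 field_simps)
    finally have "2 * (y \<bullet> y) + t * A > 0" using yy by linarith
    with tneg have "t * (2 * (y \<bullet> y) + t * A) < 0" by (simp add: mult_neg_pos)
    with * show False by simp
  qed
  then have fe: "f e = M *\<^sub>R e" by (simp add: g_def)
  have eB: "e \<notin> B" using eS ne by (auto simp: S_def)
  have "pairwise orthogonal (insert e B)"
    using B(3) eS by (auto simp: pairwise_insert S_def orthogonal_def inner_commute)
  then show ?case using B fe ne eB by (intro exI[of _ "insert e B"]) auto
qed

lemma gram_inner:
  fixes X :: "real^'n^'m"
  shows "((transpose X ** X) *v x) \<bullet> y = (X *v x) \<bullet> (X *v y)"
  by (metis dot_lmul_matrix inner_commute matrix_vector_mul_assoc vector_transpose_matrix)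

text \<open>The diagonalization takes place over the polynomial ring: with the eigenvectors as
  constant columns of \<open>P\<close>, \<open>M ** P = P ** Dg\<close>, and \<open>det P\<close>
  can be cancelled because \<open>P\<close> is orthogonal.\<close>

lemma charpoly_eigenbasis:
  fixes A :: "real^'n^'n" and h :: "'n \<Rightarrow> real^'n"
  assumes orth: "\<And>i j. h i \<bullet> h j = (if i = j then 1 else 0)"
    and eig: "\<And>i. A *v h i = e i *s h i"
  shows "charpoly A = (\<Prod>k\<in>UNIV. [:- e k, 1:])"
proof -
  define P :: "real poly^'n^'n" where "P = (\<chi> i j. [:h j $ i:])"
  define M :: "real poly^'n^'n" where "M = (\<chi> i j. (if i = j then [:0, 1:] else 0) - [:A $ i $ j:])"
  define Dg :: "real poly^'n^'n" where "Dg = (\<chi> i j. if i = j then [:- e i, 1:] else 0)"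
  have Aeig: "(\<Sum>j\<in>UNIV. A $ i $ j * h k $ j) = e k * h k $ i" for i k
    using eig[of k] by (simp add: vec_eq_iff matrix_vector_mult_def)
  have const_sum: "(\<Sum>j\<in>UNIV. [:F j:]) = [:\<Sum>j\<in>UNIV. F j:]" for F :: "'n \<Rightarrow> real"
    by (induction rule: finite_induct[OF finite[of UNIV]]) (auto)
  have "(M ** P) $ i $ k = (P ** Dg) $ i $ k" for i k
  proof -
    have "(M ** P) $ i $ k = (\<Sum>j\<in>UNIV. (if i = j then [:0,1:] * [:h k $ j:] else 0)) - (\<Sum>j\<in>UNIV. [:A $ i $ j * h k $ j:])"
      unfolding sum_subtractf[symmetric] matrix_matrix_mult_def M_def P_def
      by (simp, intro sum.cong) (auto simp: algebra_simps)
    also have "\<dots> = [:0, 1:] * [:h k $ i:] - [:e k * h k $ i:]" by (simp add: const_sum Aeig)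
    also have "\<dots> = (\<Sum>j\<in>UNIV. P $ i $ j * (if j = k then [:- e k, 1:] else 0))"
      by (simp add: P_def if_distrib[where f="\<lambda>x. _ * x"] cong: if_cong)
    also have "\<dots> = (P ** Dg) $ i $ k"
      unfolding matrix_matrix_mult_def Dg_def by (simp, intro sum.cong) auto
    finally show ?thesis .
  qed
  then have MP: "M ** P = P ** Dg" by (simp add: vec_eq_iff)
  have "transpose P ** P = mat 1"
  proof -
    have "(transpose P ** P) $ i $ k = mat 1 $ i $ k" for i k
    proof -
      have "(transpose P ** P) $ i $ k = (\<Sum>j\<in>UNIV. [:h i $ j * h k $ j:])"
        by (simp add: transpose_def matrix_matrix_mult_def P_def mult.commute)
      also have "\<dots> = [:h i \<bullet> h k:]" by (simp add: const_sum inner_vec_def)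
      finally show ?thesis by (simp add: orth mat_def one_pCons)
    qed
    then show ?thesis by (simp add: vec_eq_iff)
  qed
  then have "det (transpose P) * det P = 1" by (metis det_mul det_I)
  then have "det P \<noteq> 0" by auto
  moreover have "det M * det P = det P * det Dg" by (metis MP det_mul)
  ultimately have "det M = det Dg" by (simp add: mult.commute)
  moreover have "det Dg = (\<Prod>k\<in>UNIV. Dg $ k $ k)" by (rule det_diagonal) (simp add: Dg_def)
  ultimately show ?thesis by (simp add: charpoly_def M_def Dg_def)
qed

text \<open>Norms at most one rather than equal to one: families may contain zero vectors, and
  Bessel's inequality survives.\<close>

definition orthogonal_contractions :: "'i set \<Rightarrow> ('i \<Rightarrow> 'a::real_inner) \<Rightarrow> bool" where
  "orthogonal_contractions I u \<longleftrightarrow>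
     finite I \<and> (\<forall>i\<in>I. norm (u i) \<le> 1) \<and> (\<forall>i\<in>I. \<forall>j\<in>I. i \<noteq> j \<longrightarrow> u i \<bullet> u j = 0)"

definition outer :: "real^'m \<Rightarrow> real^'n \<Rightarrow> real^'n^'m" where
  "outer u v = (\<chi> i j. u $ i * v $ j)"

lemma outer_mult_vec: "outer u v *v w = (v \<bullet> w) *\<^sub>R u"
  by (simp add: vec_eq_iff outer_def matrix_vector_mult_def inner_vec_def sum_distrib_left mult_ac)

lemma inner_outer: "outer u v \<bullet> Y = u \<bullet> (Y *v v)"
  by (simp add: inner_vec_def outer_def matrix_vector_mult_def sum_distrib_left mult_ac)

text \<open>The list of singular values is sorted without its eigenvectors. Sorting the index type
  by the key \<open>f\<close> produces the same list together with a matching order of the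
  eigenvectors. Indices run to the number of columns, the size of the Gram matrix.\<close>

lemma exists_sing_val_eigenbasis:
  fixes X :: "real^'n^'m"
  obtains v where
    "\<And>i j. i \<in> {1..CARD('n)} \<Longrightarrow> j \<in> {1..CARD('n)} \<Longrightarrow> v i \<bullet> v j = (if i = j then 1 else 0)"
    "\<And>j. j \<in> {1..CARD('n)} \<Longrightarrow> (transpose X ** X) *v v j = (sing_val j X)\<^sup>2 *\<^sub>R v j"
    "\<And>j. j \<in> {1..CARD('n)} \<Longrightarrow> 0 \<le> sing_val j X"
    "\<And>i j. 1 \<le> i \<Longrightarrow> i \<le> j \<Longrightarrow> j \<le> CARD('n) \<Longrightarrow> sing_val j X \<le> sing_val i X"
proof -
  let ?A = "transpose X ** X"
  have "linear ((*v) ?A)" by (rule matrix_vector_mul_linear)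
  moreover have "(?A *v x) \<bullet> y = x \<bullet> (?A *v y)" for x y
    by (metis gram_inner inner_commute)
  ultimately obtain B where B: "finite B" "card B = CARD('n)" "pairwise orthogonal B"
      "\<forall>b\<in>B. norm b = 1 \<and> (\<exists>c. ?A *v b = c *\<^sub>R b)"
    using exists_orthonormal_eigenvectors[of "(*v) ?A" "CARD('n)"] by auto
  obtain h :: "'n \<Rightarrow> real^'n" where h: "bij_betw h UNIV B"
    using B(1,2) by (metis finite_code finite_same_card_bij)
  then have hB: "h i \<in> B" for i by (auto simp: bij_betw_def)
  have orth: "h i \<bullet> h j = (if i = j then 1 else 0)" for i j
  proof (cases "i = j")
    case False
    then have "h i \<noteq> h j" using h by (auto simp: bij_betw_def inj_on_def)
    then show ?thesis using B(3) hB False by (auto simp: pairwise_def orthogonal_def)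
  qed (use B(4) hB in \<open>auto simp: dot_square_norm\<close>)
  have "\<forall>i. \<exists>c. ?A *v h i = c *\<^sub>R h i" using B(4) hB by blast
  then obtain e where e: "\<And>i. ?A *v h i = e i *\<^sub>R h i" by metis
  have e0: "e i \<ge> 0" for i
  proof -
    have "(?A *v h i) \<bullet> h i = (X *v h i) \<bullet> (X *v h i)" by (rule gram_inner)
    then show ?thesis by (metis e inner_ge_zero inner_scaleR_left mult.right_neutral orth)
  qed
  define f where "f i = sqrt (e i)" for i
  have "proots (charpoly ?A) = image_mset e (mset_set UNIV)"
  proof -
    have "charpoly ?A = (\<Prod>k\<in>UNIV. [:- e k, 1:])"
      by (rule charpoly_eigenbasis[OF orth]) (simp add: e scalar_mult_eq_scaleR)
    then have "proots (charpoly ?A) = (\<Sum>k\<in>UNIV. {#e k#})"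
      by (simp add: proots_prod)
    also have "\<dots> = image_mset e (mset_set UNIV)"
      by (induction rule: finite_induct[OF finite[of UNIV]]) auto
    finally show ?thesis .
  qed
  then have ms: "image_mset sqrt (proots (charpoly ?A)) = image_mset f (mset_set UNIV)"
    by (simp add: multiset.map_comp o_def f_def[abs_def])
  obtain xs :: "'n list" where xs: "set xs = UNIV" "distinct xs"
    using finite_distinct_list[OF finite[of "UNIV :: 'n set"]] by auto
  define ls where "ls = rev (sort_key f xs)"
  have "mset_set UNIV = mset xs" using xs by (metis mset_set_set)
  then have "sorted_list_of_multiset (image_mset f (mset_set UNIV)) = sort (map f xs)"
    by (simp flip: mset_map)
  also have "\<dots> = map f (sort_key f xs)"
    by (rule properties_for_sort) auto
  finally have sq: "sqrt_eigenvalues X = map f ls"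
    by (simp add: sqrt_eigenvalues_def ms ls_def rev_map)
  have len: "length ls = CARD('n)"
    using distinct_card[OF xs(2)] xs(1) by (simp add: ls_def)
  have dist: "distinct ls" using xs by (simp add: ls_def)
  have sv: "sing_val j X = f (ls ! (j - 1))" if "j \<in> {1..CARD('n)}" for j
  proof -
    have "j - 1 < length ls" using that len by auto
    then show ?thesis by (simp add: sing_val_def sq)
  qed
  have srt: "sorted (rev (map f ls))" by (simp add: ls_def rev_map)
  show ?thesis
  proof (rule that[of "\<lambda>j. h (ls ! (j - 1))"])
    show "h (ls ! (i - 1)) \<bullet> h (ls ! (j - 1)) = (if i = j then 1 else 0)"
      if "i \<in> {1..CARD('n)}" "j \<in> {1..CARD('n)}" for i j
    proof -
      have "ls ! (i - 1) = ls ! (j - 1) \<longleftrightarrow> i - 1 = j - 1"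
        using that len dist by (intro nth_eq_iff_index_eq) auto
      then show ?thesis using that by (auto simp: orth)
    qed
    show "?A *v h (ls ! (j - 1)) = (sing_val j X)\<^sup>2 *\<^sub>R h (ls ! (j - 1))" if "j \<in> {1..CARD('n)}" for j
      using that e0 by (simp add: sv e f_def)
    show "0 \<le> sing_val j X" if "j \<in> {1..CARD('n)}" for j
      using that e0 by (simp add: sv f_def)
    show "sing_val j X \<le> sing_val i X" if "1 \<le> i" "i \<le> j" "j \<le> CARD('n)" for i j
    proof -
      have "map f ls ! (j - 1) \<le> map f ls ! (i - 1)"
        using that len srt by (intro sorted_rev_nth_mono) auto
      then show ?thesis using that len by (simp add: sv)
    qed
  qed
qed

lemma card_orthonormal_le:
  fixes w :: "'i \<Rightarrow> 'a::euclidean_space"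
  assumes "finite I" "\<And>i j. i \<in> I \<Longrightarrow> j \<in> I \<Longrightarrow> w i \<bullet> w j = (if i = j then 1 else 0)"
  shows "card I \<le> DIM('a)"
proof -
  have inj: "inj_on w I"
    by (rule inj_onI) (metis assms(2) zero_neq_one)
  have "0 \<notin> w ` I" using assms(2) by (metis image_iff inner_zero_left zero_neq_one)
  moreover have "pairwise orthogonal (w ` I)"
    using assms(2) by (auto simp: pairwise_def orthogonal_def)
  ultimately have "independent (w ` I)" by (rule pairwise_orthogonal_independent[rotated])
  then have "card (w ` I) \<le> DIM('a)" using independent_bound by blast
  then show ?thesis using card_image[OF inj] by simp
qed

text \<open>A nonzero residual, normalized and placed at the free index 0, would be one orthonormal
  vector too many.\<close>

lemma orthonormal_expand:
  fixes v :: "nat \<Rightarrow> real^'n"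
  assumes "\<And>i j. i \<in> {1..CARD('n)} \<Longrightarrow> j \<in> {1..CARD('n)} \<Longrightarrow> v i \<bullet> v j = (if i = j then 1 else 0)"
  shows "w = (\<Sum>j = 1..CARD('n). (v j \<bullet> w) *\<^sub>R v j)"
proof (rule ccontr)
  define r where "r = w - (\<Sum>j = 1..CARD('n). (v j \<bullet> w) *\<^sub>R v j)"
  assume "\<not> ?thesis"
  then have r0: "r \<noteq> 0" by (simp add: r_def)
  have vr: "v i \<bullet> r = 0" if "i \<in> {1..CARD('n)}" for i
  proof -
    have "v i \<bullet> (\<Sum>j = 1..CARD('n). (v j \<bullet> w) *\<^sub>R v j) = (\<Sum>j = 1..CARD('n). if i = j then v j \<bullet> w else 0)"
      unfolding inner_sum_right using assms that by (intro sum.cong) auto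
    then show ?thesis using that by (simp add: r_def inner_diff_right)
  qed
  define v' where "v' j = (if j = 0 then r /\<^sub>R norm r else v j)" for j
  have "(r /\<^sub>R norm r) \<bullet> (r /\<^sub>R norm r) = 1"
    using r0 by (simp add: dot_square_norm power2_eq_square)
  then have "card {0..CARD('n)} \<le> DIM(real^'n)"
    using assms vr vr[unfolded inner_commute[of _ r]] by (intro card_orthonormal_le[of _ v']) (auto simp: v'_def)
  then show False by simp
qed

text \<open>A reduced decomposition: at a zero singular value the left vector is 0, so the left
  family need not be completed to an orthonormal one and the outer product there contributes nothing
  to any sum.\<close>

definition is_svd :: "real^'n^'m \<Rightarrow> (nat \<Rightarrow> real^'m) \<Rightarrow> (nat \<Rightarrow> real^'n) \<Rightarrow> bool" where
  "is_svd X u v \<longleftrightarrow>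
     orthogonal_contractions {1..min_dim X} u \<and> orthogonal_contractions {1..min_dim X} v \<and>
     (\<forall>j\<in>{1..min_dim X}. 0 < sing_val j X \<longrightarrow> norm (u j) = 1 \<and> norm (v j) = 1) \<and>
     (\<forall>j\<in>{1..min_dim X}. sing_val j X = 0 \<longrightarrow> u j = 0) \<and>
     (\<forall>j\<in>{1..min_dim X}. X *v v j = sing_val j X *\<^sub>R u j) \<and>
     (\<forall>j\<in>{1..min_dim X}. 0 < sing_val j X \<longrightarrow> transpose X *v u j = sing_val j X *\<^sub>R v j) \<and>
     X = (\<Sum>j = 1..min_dim X. sing_val j X *\<^sub>R outer (u j) (v j))"

lemma sing_val_nonneg: "j \<in> {1..min_dim X} \<Longrightarrow> 0 \<le> sing_val j X"
  by (rule exists_sing_val_eigenbasis[of X]) (auto simp: min_dim_def)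

lemma sing_val_antimono:
  "1 \<le> i \<Longrightarrow> i \<le> j \<Longrightarrow> j \<le> min_dim X \<Longrightarrow> sing_val j X \<le> sing_val i X"
  by (rule exists_sing_val_eigenbasis[of X]) (auto simp: min_dim_def)

lemma exists_svd:
  fixes X :: "real^'n^'m"
  shows "\<exists>u v. is_svd X u v"
proof -
  let ?n = "CARD('n)" and ?s = "\<lambda>j. sing_val j X"
  obtain v where v: "\<And>i j. i \<in> {1..?n} \<Longrightarrow> j \<in> {1..?n} \<Longrightarrow> v i \<bullet> v j = (if i = j then 1 else 0)"
    and eig: "\<And>j. j \<in> {1..?n} \<Longrightarrow> (transpose X ** X) *v v j = (?s j)\<^sup>2 *\<^sub>R v j"
    and nonneg: "\<And>j. j \<in> {1..?n} \<Longrightarrow> 0 \<le> ?s j"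
    and dec: "\<And>i j. 1 \<le> i \<Longrightarrow> i \<le> j \<Longrightarrow> j \<le> ?n \<Longrightarrow> ?s j \<le> ?s i"
    by (rule exists_sing_val_eigenbasis[of X]) (rule that)
  define u where "u j = (if ?s j = 0 then 0 else (X *v v j) /\<^sub>R ?s j)" for j
  have XX: "(X *v v i) \<bullet> (X *v v j) = (if i = j then (?s i)\<^sup>2 else 0)" if "i \<in> {1..?n}" "j \<in> {1..?n}" for i j
    using gram_inner[of X "v i" "v j"] eig[of i] v[of i j] that by (auto split: if_splits)
  have Xv: "X *v v j = ?s j *\<^sub>R u j" if "j \<in> {1..?n}" for j
    using XX[of j j] that by (auto simp: u_def)
  have uu: "u i \<bullet> u j = (if i = j \<and> ?s i \<noteq> 0 then 1 else 0)" if "i \<in> {1..?n}" "j \<in> {1..?n}" for i j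
    using XX[OF that] by (auto simp: u_def power2_eq_square field_simps)
  \<comment> \<open>By monotonicity a nonzero value at \<open>j\<close> makes all of the first
    \<open>j\<close> nonzero, and their left vectors would be \<open>j > CARD('m)\<close>
    orthonormal vectors.\<close>
  have zero: "?s j = 0" if j: "j \<in> {1..?n}" "CARD('m) < j" for j
  proof (rule ccontr)
    assume "?s j \<noteq> 0"
    then have "?s i \<noteq> 0" if "i \<in> {1..j}" for i using dec[of i j] nonneg[of j] that j by force
    then have "card {1..j} \<le> DIM(real^'m)"
      using j by (intro card_orthonormal_le[of _ u]) (auto simp: uu)
    then show False using j by simp
  qed
  have md: "min_dim X \<le> ?n" by (simp add: min_dim_def)
  have Xexp: "X = (\<Sum>j = 1..min_dim X. ?s j *\<^sub>R outer (u j) (v j))"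
  proof -
    have "X *v w = (\<Sum>j = 1..min_dim X. ?s j *\<^sub>R outer (u j) (v j)) *v w" for w
    proof -
      have "X *v w = X *v (\<Sum>j = 1..?n. (v j \<bullet> w) *\<^sub>R v j)"
        using orthonormal_expand[of v w, OF v] by simp
      also have "\<dots> = (\<Sum>j = 1..?n. (v j \<bullet> w) *\<^sub>R (X *v v j))"
        by (simp add: linear_sum[OF matrix_vector_mul_linear] matrix_vector_mult_scaleR)
      also have "\<dots> = (\<Sum>j = 1..?n. ?s j *\<^sub>R (v j \<bullet> w) *\<^sub>R u j)"
        by (intro sum.cong) (simp_all add: Xv)
      also have "\<dots> = (\<Sum>j = 1..min_dim X. ?s j *\<^sub>R (v j \<bullet> w) *\<^sub>R u j)"
        using md zero by (intro sum.mono_neutral_right) (auto simp: min_dim_def)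
      also have "\<dots> = (\<Sum>j = 1..min_dim X. (?s j *\<^sub>R outer (u j) (v j)) *v w)"
        by (simp add: outer_mult_vec flip: scaleR_matrix_vector_assoc)
      also have "\<dots> = (\<Sum>j = 1..min_dim X. ?s j *\<^sub>R outer (u j) (v j)) *v w"
        by (induction rule: infinite_finite_induct) (auto simp: matrix_vector_mult_add_rdistrib)
      finally show ?thesis .
    qed
    then show ?thesis by (simp add: matrix_eq)
  qed
  have 1: "orthogonal_contractions {1..min_dim X} u"
    using md by (auto simp: orthogonal_contractions_def uu norm_eq_sqrt_inner)
  have 2: "orthogonal_contractions {1..min_dim X} v"
    using md by (auto simp: orthogonal_contractions_def v norm_eq_sqrt_inner)
  have 3: "transpose X *v u j = ?s j *\<^sub>R v j" if "j \<in> {1..min_dim X}" "0 < ?s j" for j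
  proof -
    have "transpose X *v u j = ((transpose X ** X) *v v j) /\<^sub>R ?s j"
      using that by (simp add: u_def matrix_vector_mult_scaleR matrix_vector_mul_assoc)
    then show ?thesis using eig[of j] that md by (simp add: power2_eq_square)
  qed
  have 4: "norm (u j) = 1 \<and> norm (v j) = 1" if "j \<in> {1..min_dim X}" "0 < ?s j" for j
    using that md uu[of j j] v[of j j] by (simp add: norm_eq_sqrt_inner)
  have 5: "u j = 0" if "?s j = 0" for j
    using that by (simp add: u_def)
  have 6: "X *v v j = ?s j *\<^sub>R u j" if "j \<in> {1..min_dim X}" for j
    using that md by (intro Xv) auto
  show ?thesis
    unfolding is_svd_def using 1 2 3 4 5 6 Xexp by blast
qed

section \<open>Trace inequality and nuclear norm\<close>

lemma orthogonal_contractions_norm_sq_le: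
  "orthogonal_contractions I u \<Longrightarrow> i \<in> I \<Longrightarrow> (norm (u i))\<^sup>2 \<le> 1"
  by (simp add: orthogonal_contractions_def power_le_one)

lemma bessel:
  assumes "orthogonal_contractions I u"
  shows "(\<Sum>i\<in>I. (u i \<bullet> x)\<^sup>2) \<le> (norm x)\<^sup>2"
proof -
  have fin: "finite I" using assms by (simp add: orthogonal_contractions_def)
  let ?p = "\<Sum>i\<in>I. (u i \<bullet> x) *\<^sub>R u i"
  have "?p \<bullet> ?p = (\<Sum>i\<in>I. (u i \<bullet> x) * (u i \<bullet> ?p))" by (simp add: inner_sum_left)
  also have "\<dots> = (\<Sum>i\<in>I. (u i \<bullet> x)\<^sup>2 * (norm (u i))\<^sup>2)"
  proof (intro sum.cong refl)
    fix i assume i: "i \<in> I"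
    have "u i \<bullet> ?p = (\<Sum>j\<in>I. if i = j then (u j \<bullet> x) * (u j \<bullet> u j) else 0)"
      unfolding inner_sum_right using assms i
      by (intro sum.cong) (auto simp: orthogonal_contractions_def)
    then show "(u i \<bullet> x) * (u i \<bullet> ?p) = (u i \<bullet> x)\<^sup>2 * (norm (u i))\<^sup>2"
      using i fin by (simp add: power2_eq_square dot_square_norm)
  qed
  also have "\<dots> \<le> (\<Sum>i\<in>I. (u i \<bullet> x)\<^sup>2)"
    using assms by (intro sum_mono) (auto simp: orthogonal_contractions_def intro!: mult_left_le power_le_one)
  finally have pp: "?p \<bullet> ?p \<le> (\<Sum>i\<in>I. (u i \<bullet> x)\<^sup>2)" .
  have px: "x \<bullet> ?p = (\<Sum>i\<in>I. (u i \<bullet> x)\<^sup>2)"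
    by (simp add: inner_sum_right power2_eq_square inner_commute)
  have "0 \<le> (x - ?p) \<bullet> (x - ?p)" by simp
  also have "\<dots> = x \<bullet> x - 2 * (x \<bullet> ?p) + ?p \<bullet> ?p"
    by (simp add: inner_diff_left inner_diff_right inner_commute)
  finally show ?thesis using pp px by (simp add: dot_square_norm)
qed

lemma bessel_product:
  assumes "orthogonal_contractions I u" "orthogonal_contractions I v"
  shows "(\<Sum>i\<in>I. \<bar>u i \<bullet> x\<bar> * \<bar>v i \<bullet> y\<bar>) \<le> norm x * norm y"
proof -
  have "(\<Sum>i\<in>I. \<bar>u i \<bullet> x\<bar> * \<bar>v i \<bullet> y\<bar>)\<^sup>2 \<le> (\<Sum>i\<in>I. \<bar>u i \<bullet> x\<bar>\<^sup>2) * (\<Sum>i\<in>I. \<bar>v i \<bullet> y\<bar>\<^sup>2)"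
    by (rule Cauchy_Schwarz_ineq_sum)
  also have "\<dots> \<le> (norm x)\<^sup>2 * (norm y)\<^sup>2"
    using bessel[OF assms(1), of x] bessel[OF assms(2), of y] by (intro mult_mono) (auto simp: sum_nonneg)
  finally have "(\<Sum>i\<in>I. \<bar>u i \<bullet> x\<bar> * \<bar>v i \<bullet> y\<bar>)\<^sup>2 \<le> (norm x * norm y)\<^sup>2"
    by (simp add: power_mult_distrib)
  then show ?thesis by (rule power2_le_imp_le) simp
qed

text \<open>Bathtub principle with threshold \<open>s k\<close>: moving weight from indices after
  \<open>k\<close> to the first \<open>k\<close> never lowers the sum, and the weight available fits
  there.\<close>

lemma sum_rearrange_le:
  fixes s :: "nat \<Rightarrow> real"
  assumes s0: "\<And>i. i \<in> {1..d} \<Longrightarrow> 0 \<le> s i"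
    and dec: "\<And>i j. 1 \<le> i \<Longrightarrow> i \<le> j \<Longrightarrow> j \<le> d \<Longrightarrow> s j \<le> s i"
    and w: "\<And>i. i \<in> {1..d} \<Longrightarrow> 0 \<le> w i \<and> w i \<le> 1" "(\<Sum>i = 1..d. w i) \<le> real k"
    and k: "k \<in> {1..d}"
  shows "(\<Sum>i = 1..d. s i * w i) \<le> (\<Sum>i = 1..k. s i)"
proof -
  have split: "(\<Sum>i = 1..d. F i) = (\<Sum>i = 1..k. F i) + (\<Sum>i\<in>{k<..d}. F i)" for F :: "nat \<Rightarrow> real"
  proof -
    have "{1..d} = {1..k} \<union> {k<..d}" using k by auto
    moreover have "{1..k} \<inter> {k<..d} = {}" by auto
    ultimately show ?thesis by (simp only: sum.union_disjoint finite_atLeastAtMost finite_greaterThanAtMost)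
  qed
  have 1: "(\<Sum>i\<in>{k<..d}. s i * w i) \<le> (\<Sum>i\<in>{k<..d}. s k * w i)"
    using k w dec by (intro sum_mono mult_right_mono) auto
  have 2: "(\<Sum>i = 1..k. s k * (1 - w i)) \<le> (\<Sum>i = 1..k. s i * (1 - w i))"
    using k w dec by (intro sum_mono mult_right_mono) auto
  have "s k * ((\<Sum>i\<in>{k<..d}. w i) + (\<Sum>i = 1..k. w i)) \<le> s k * real k"
    using w(2) split[of w] s0 k by (intro mult_left_mono) auto
  then have "s k * ((\<Sum>i\<in>{k<..d}. w i) + (\<Sum>i = 1..k. w i)) \<le> real k * s k"
    by (simp only: mult.commute[of "real k"])
  then show ?thesis
    using 1 2 unfolding split by (simp add: right_diff_distrib sum_subtractf sum_distrib_left ring_distribs)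
qed

lemma abel_sum_le:
  fixes a e :: "nat \<Rightarrow> real"
  assumes "\<And>i. i \<in> {1..d} \<Longrightarrow> 0 \<le> a i"
    and "\<And>i j. 1 \<le> i \<Longrightarrow> i \<le> j \<Longrightarrow> j \<le> d \<Longrightarrow> a j \<le> a i"
    and "\<And>k. k \<in> {1..d} \<Longrightarrow> 0 \<le> (\<Sum>i = 1..k. e i)"
  shows "0 \<le> (\<Sum>i = 1..d. a i * e i)"
proof (cases "d = 0")
  case False
  have "a k * (\<Sum>i = 1..k. e i) \<le> (\<Sum>i = 1..k. a i * e i)" if "1 \<le> k" "k \<le> d" for k
    using that
  proof (induction k rule: dec_induct)
    case (step k)
    have "a (Suc k) * (\<Sum>i = 1..k. e i) \<le> a k * (\<Sum>i = 1..k. e i)"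
      using step assms by (intro mult_right_mono) auto
    then show ?case using step by (simp add: ring_distribs)
  qed simp
  from this[of d] have "a d * (\<Sum>i = 1..d. e i) \<le> (\<Sum>i = 1..d. a i * e i)" using False by simp
  moreover have "0 \<le> a d * (\<Sum>i = 1..d. e i)" using assms(1,3)[of d] False by simp
  ultimately show ?thesis by linarith
qed simp

text \<open>Majorization in two moves: by the bathtub principle every partial sum of
  \<open>s\<close> dominates that of its image under \<open>M\<close>, and Abel summation against
  the nonincreasing \<open>a\<close> carries this over to the weighted sums.\<close>

lemma substochastic_sum_le:
  fixes a s :: "nat \<Rightarrow> real"
  assumes a: "\<And>i. i \<in> {1..d} \<Longrightarrow> 0 \<le> a i" "\<And>i j. 1 \<le> i \<Longrightarrow> i \<le> j \<Longrightarrow> j \<le> d \<Longrightarrow> a j \<le> a i"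
    and s: "\<And>i. i \<in> {1..d} \<Longrightarrow> 0 \<le> s i" "\<And>i j. 1 \<le> i \<Longrightarrow> i \<le> j \<Longrightarrow> j \<le> d \<Longrightarrow> s j \<le> s i"
    and M: "\<And>i j. 0 \<le> M j i"
      "\<And>i. i \<in> {1..d} \<Longrightarrow> (\<Sum>j = 1..d. M j i) \<le> 1" "\<And>j. j \<in> {1..d} \<Longrightarrow> (\<Sum>i = 1..d. M j i) \<le> 1"
  shows "(\<Sum>j = 1..d. \<Sum>i = 1..d. a j * s i * M j i) \<le> (\<Sum>j = 1..d. a j * s j)"
proof -
  define e where "e j = s j - (\<Sum>i = 1..d. s i * M j i)" for j
  have "0 \<le> (\<Sum>i = 1..d. a i * e i)"
  proof (rule abel_sum_le[OF a])
    fix k assume k: "k \<in> {1..d}"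
    have "(\<Sum>j = 1..k. \<Sum>i = 1..d. s i * M j i) = (\<Sum>i = 1..d. s i * (\<Sum>j = 1..k. M j i))"
      by (subst sum.swap) (simp add: sum_distrib_left)
    also have "\<dots> \<le> (\<Sum>i = 1..k. s i)"
    proof (rule sum_rearrange_le[OF s _ _ k])
      fix i assume i: "i \<in> {1..d}"
      have "(\<Sum>j = 1..k. M j i) \<le> (\<Sum>j = 1..d. M j i)" using k M(1) by (intro sum_mono2) auto
      then show "0 \<le> (\<Sum>j = 1..k. M j i) \<and> (\<Sum>j = 1..k. M j i) \<le> 1"
        using M(1) M(2)[OF i] by (auto intro: sum_nonneg)
    next
      have "(\<Sum>i = 1..d. \<Sum>j = 1..k. M j i) = (\<Sum>j = 1..k. \<Sum>i = 1..d. M j i)" by (rule sum.swap)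
      also have "\<dots> \<le> (\<Sum>j = 1..k. 1)" using k M(3) by (intro sum_mono) auto
      finally show "(\<Sum>i = 1..d. \<Sum>j = 1..k. M j i) \<le> real k" by simp
    qed
    finally show "0 \<le> (\<Sum>i = 1..k. e i)" by (simp add: e_def sum_subtractf)
  qed
  then show ?thesis by (simp add: e_def right_diff_distrib sum_subtractf sum_distrib_left mult_ac)
qed

lemma is_svdD:
  assumes "is_svd X u v"
  shows "orthogonal_contractions {1..min_dim X} u" "orthogonal_contractions {1..min_dim X} v"
    "X = (\<Sum>j = 1..min_dim X. sing_val j X *\<^sub>R outer (u j) (v j))"
    "j \<in> {1..min_dim X} \<Longrightarrow> X *v v j = sing_val j X *\<^sub>R u j"
    "j \<in> {1..min_dim X} \<Longrightarrow> 0 < sing_val j X \<Longrightarrow> transpose X *v u j = sing_val j X *\<^sub>R v j"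
    "j \<in> {1..min_dim X} \<Longrightarrow> sing_val j X = 0 \<Longrightarrow> u j = 0"
    "j \<in> {1..min_dim X} \<Longrightarrow> sing_val j X * (u j \<bullet> u j) = sing_val j X"
proof -
  show "j \<in> {1..min_dim X} \<Longrightarrow> sing_val j X * (u j \<bullet> u j) = sing_val j X"
    using assms sing_val_nonneg[of j X] by (cases "sing_val j X = 0") (auto simp: is_svd_def dot_square_norm)
qed (use assms in \<open>auto simp: is_svd_def\<close>)

lemma inner_svd:
  assumes "is_svd X u v"
  shows "Z \<bullet> X = (\<Sum>j = 1..min_dim X. sing_val j X * (u j \<bullet> (Z *v v j)))"
proof -
  have "Z \<bullet> X = Z \<bullet> (\<Sum>j = 1..min_dim X. sing_val j X *\<^sub>R outer (u j) (v j))"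
    using is_svdD(3)[OF assms] by simp
  then show ?thesis by (simp add: inner_sum_right inner_outer inner_commute[of Z])
qed

lemma sum_outer_mult_vec: "(\<Sum>i\<in>I. a i *\<^sub>R outer (u i) (v i)) *v w = (\<Sum>i\<in>I. (a i * (v i \<bullet> w)) *\<^sub>R u i)"
  by (induction I rule: infinite_finite_induct)
    (simp_all add: matrix_vector_mult_add_rdistrib outer_mult_vec flip: scaleR_matrix_vector_assoc)

lemma inner_sum_outer_svd:
  assumes "is_svd Y x y"
  shows "(\<Sum>i\<in>I. a i *\<^sub>R outer (u i) (v i)) \<bullet> Y
       = (\<Sum>i\<in>I. \<Sum>j = 1..min_dim Y. a i * sing_val j Y * ((u i \<bullet> x j) * (v i \<bullet> y j)))"
  unfolding inner_svd[OF assms] sum_outer_mult_vec inner_sum_right sum_distrib_left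
  by (subst sum.swap) (simp add: inner_commute mult_ac)

text \<open>Von Neumann's trace inequality. Products of cosines are at most the averages
  \<open>M\<close> of their squares, and Bessel's inequality bounds the row and column sums of
  \<open>M\<close> by one.\<close>

lemma trace_inequality:
  fixes Y :: "real^'n^'m"
  assumes u: "orthogonal_contractions {1..min_dim Y} u" and v: "orthogonal_contractions {1..min_dim Y} v"
    and a: "\<And>i. i \<in> {1..min_dim Y} \<Longrightarrow> 0 \<le> a i"
      "\<And>i j. 1 \<le> i \<Longrightarrow> i \<le> j \<Longrightarrow> j \<le> min_dim Y \<Longrightarrow> a j \<le> a i"
  shows "(\<Sum>i = 1..min_dim Y. a i *\<^sub>R outer (u i) (v i)) \<bullet> Y \<le> (\<Sum>i = 1..min_dim Y. a i * sing_val i Y)"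
proof -
  obtain x y where xy: "is_svd Y x y" using exists_svd by blast
  let ?d = "min_dim Y"
  define M where "M j i = ((u j \<bullet> x i)\<^sup>2 + (v j \<bullet> y i)\<^sup>2) / 2" for j i
  have "(\<Sum>i = 1..?d. a i *\<^sub>R outer (u i) (v i)) \<bullet> Y
      = (\<Sum>j = 1..?d. \<Sum>i = 1..?d. a j * sing_val i Y * ((u j \<bullet> x i) * (v j \<bullet> y i)))"
    by (rule inner_sum_outer_svd[OF xy])
  also have "\<dots> \<le> (\<Sum>j = 1..?d. \<Sum>i = 1..?d. a j * sing_val i Y * M j i)"
  proof (intro sum_mono mult_left_mono)
    fix i j assume ij: "j \<in> {1..?d}" "i \<in> {1..?d}"
    show "(u j \<bullet> x i) * (v j \<bullet> y i) \<le> M j i"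
      unfolding M_def using sum_squares_bound[of "u j \<bullet> x i" "v j \<bullet> y i"] by simp
    show "0 \<le> a j * sing_val i Y" using ij a(1) sing_val_nonneg[of i Y] by simp
  qed
  also have "\<dots> \<le> (\<Sum>i = 1..?d. a i * sing_val i Y)"
  proof (rule substochastic_sum_le[OF a sing_val_nonneg sing_val_antimono])
    fix i assume i: "i \<in> {1..?d}"
    have "(\<Sum>j = 1..?d. (u j \<bullet> x i)\<^sup>2) \<le> 1" "(\<Sum>j = 1..?d. (v j \<bullet> y i)\<^sup>2) \<le> 1"
      using bessel[OF u, of "x i"] bessel[OF v, of "y i"] orthogonal_contractions_norm_sq_le[OF is_svdD(1)[OF xy] i]
        orthogonal_contractions_norm_sq_le[OF is_svdD(2)[OF xy] i] by linarith+
    then show "(\<Sum>j = 1..?d. M j i) \<le> 1"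
      unfolding M_def by (simp add: add_divide_distrib sum.distrib flip: sum_divide_distrib)
    have "(\<Sum>j = 1..?d. (x j \<bullet> u i)\<^sup>2) \<le> 1" "(\<Sum>j = 1..?d. (y j \<bullet> v i)\<^sup>2) \<le> 1"
      using bessel[OF is_svdD(1)[OF xy], of "u i"] bessel[OF is_svdD(2)[OF xy], of "v i"] orthogonal_contractions_norm_sq_le[OF u i]
        orthogonal_contractions_norm_sq_le[OF v i] by linarith+
    then show "(\<Sum>j = 1..?d. M i j) \<le> 1"
      unfolding M_def by (simp add: add_divide_distrib sum.distrib inner_commute flip: sum_divide_distrib)
  qed (auto simp: M_def)
  finally show ?thesis .
qed

text \<open>Duality of operator and nuclear norm: the sum has operator norm at most
  \<open>c\<close>. The index set is arbitrary so that two families can later be glued along a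
  disjoint union.\<close>

lemma inner_outer_sum_le_nuc:
  fixes Y :: "real^'n^'m"
  assumes u: "orthogonal_contractions I u" and v: "orthogonal_contractions I v"
    and c: "\<And>i. i \<in> I \<Longrightarrow> \<bar>a i\<bar> \<le> c" "0 \<le> c"
  shows "\<bar>(\<Sum>i\<in>I. a i *\<^sub>R outer (u i) (v i)) \<bullet> Y\<bar> \<le> c * nuc_norm Y"
proof -
  obtain x y where xy: "is_svd Y x y" using exists_svd by blast
  let ?d = "min_dim Y"
  have "\<bar>(\<Sum>i\<in>I. a i *\<^sub>R outer (u i) (v i)) \<bullet> Y\<bar>
      = \<bar>\<Sum>j = 1..?d. \<Sum>i\<in>I. a i * sing_val j Y * ((u i \<bullet> x j) * (v i \<bullet> y j))\<bar>"
    by (subst inner_sum_outer_svd[OF xy], subst sum.swap) simp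
  also have "\<dots> \<le> (\<Sum>j = 1..?d. \<Sum>i\<in>I. \<bar>a i * sing_val j Y * ((u i \<bullet> x j) * (v i \<bullet> y j))\<bar>)"
    by (intro order_trans[OF sum_abs] sum_mono sum_abs)
  also have "\<dots> \<le> (\<Sum>j = 1..?d. \<Sum>i\<in>I. (c * sing_val j Y) * (\<bar>u i \<bullet> x j\<bar> * \<bar>v i \<bullet> y j\<bar>))"
    using c sing_val_nonneg[of _ Y]
    by (intro sum_mono) (auto simp: abs_mult intro!: mult_mono)
  also have "\<dots> \<le> (\<Sum>j = 1..?d. (c * sing_val j Y) * 1)"
    unfolding sum_distrib_left[symmetric]
  proof (intro sum_mono mult_left_mono)
    fix j assume j: "j \<in> {1..?d}"
    have "(\<Sum>i\<in>I. \<bar>u i \<bullet> x j\<bar> * \<bar>v i \<bullet> y j\<bar>) \<le> norm (x j) * norm (y j)"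
      by (rule bessel_product[OF u v])
    also have "\<dots> \<le> 1 * 1" using is_svdD(1,2)[OF xy] j
      by (intro mult_mono) (auto simp: orthogonal_contractions_def)
    finally show "(\<Sum>i\<in>I. \<bar>u i \<bullet> x j\<bar> * \<bar>v i \<bullet> y j\<bar>) \<le> 1" by simp
  qed (use c sing_val_nonneg[of _ Y] in auto)
  finally show ?thesis by (simp add: nuc_norm_def sum_distrib_left)
qed

text \<open>The polar factor attains the duality bound. The nuclear norm is thus a maximum of linear
  functionals, and its norm laws follow.\<close>

lemma inner_polar_eq_nuc:
  assumes "is_svd X u v"
  shows "(\<Sum>j = 1..min_dim X. outer (u j) (v j)) \<bullet> X = nuc_norm X"
proof -
  have "(\<Sum>j = 1..min_dim X. outer (u j) (v j)) \<bullet> X = (\<Sum>j = 1..min_dim X. u j \<bullet> (X *v v j))"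
    by (simp add: inner_sum_left inner_outer)
  also have "\<dots> = nuc_norm X"
    unfolding nuc_norm_def using is_svdD(4,7)[OF assms] by (intro sum.cong) auto
  finally show ?thesis .
qed

lemma nuc_norm_nonneg: "0 \<le> nuc_norm X"
  unfolding nuc_norm_def by (intro sum_nonneg sing_val_nonneg)

lemma nuc_norm_outer_le: "nuc_norm (outer a b) \<le> norm a * norm b"
proof -
  obtain u v where uv: "is_svd (outer a b) u v" using exists_svd by blast
  have "nuc_norm (outer a b) = (\<Sum>j = 1..min_dim (outer a b). outer (u j) (v j)) \<bullet> outer a b"
    using inner_polar_eq_nuc[OF uv] by simp
  also have "\<dots> = (\<Sum>j = 1..min_dim (outer a b). (u j \<bullet> a) * (v j \<bullet> b))"
    unfolding inner_sum_left inner_outer outer_mult_vec inner_scaleR_right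
    by (intro sum.cong) (simp_all add: inner_commute)
  also have "\<dots> \<le> (\<Sum>j = 1..min_dim (outer a b). \<bar>u j \<bullet> a\<bar> * \<bar>v j \<bullet> b\<bar>)"
    by (intro sum_mono) (metis abs_ge_self abs_mult)
  also have "\<dots> \<le> norm a * norm b" by (rule bessel_product[OF is_svdD(1,2)[OF uv]])
  finally show ?thesis .
qed

lemma nuc_norm_triangle: "nuc_norm (X + Y) \<le> nuc_norm X + nuc_norm Y"
proof -
  obtain u v where uv: "is_svd (X + Y) u v" using exists_svd by blast
  have md: "min_dim (X + Y) = min_dim X" "min_dim (X + Y) = min_dim Y" by (simp_all add: min_dim_def)
  let ?W = "\<Sum>j = 1..min_dim (X + Y). 1 *\<^sub>R outer (u j) (v j)"
  have "nuc_norm (X + Y) = ?W \<bullet> X + ?W \<bullet> Y"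
    using inner_polar_eq_nuc[OF uv] by (simp add: inner_add_right)
  also have "\<dots> \<le> 1 * nuc_norm X + 1 * nuc_norm Y"
    by (intro add_mono order_trans[OF abs_ge_self inner_outer_sum_le_nuc] is_svdD(1,2)[OF uv]) auto
  finally show ?thesis by simp
qed

lemma nuc_norm_scaleR_le: "nuc_norm (c *\<^sub>R X) \<le> \<bar>c\<bar> * nuc_norm X"
proof -
  obtain u v where uv: "is_svd (c *\<^sub>R X) u v" using exists_svd by blast
  let ?W = "\<Sum>j = 1..min_dim (c *\<^sub>R X). 1 *\<^sub>R outer (u j) (v j)"
  have "nuc_norm (c *\<^sub>R X) = c * (?W \<bullet> X)" using inner_polar_eq_nuc[OF uv] by simp
  also have "\<dots> \<le> \<bar>c\<bar> * \<bar>?W \<bullet> X\<bar>"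
    using abs_ge_self[of "c * (?W \<bullet> X)"] by (simp only: abs_mult)
  also have "\<dots> \<le> \<bar>c\<bar> * (1 * nuc_norm X)"
    by (intro mult_left_mono inner_outer_sum_le_nuc is_svdD(1,2)[OF uv]) auto
  finally show ?thesis by simp
qed

lemma nuc_norm_minus: "nuc_norm (- X) = nuc_norm X"
proof (rule antisym)
  show "nuc_norm (- X) \<le> nuc_norm X"
    using nuc_norm_scaleR_le[of "-1" X] by simp
  show "nuc_norm X \<le> nuc_norm (- X)"
    using nuc_norm_scaleR_le[of "-1" "- X"] by simp
qed

lemma nuc_norm_scaleR: "nuc_norm (c *\<^sub>R X) = \<bar>c\<bar> * nuc_norm X"
proof (cases "c = 0")
  case True
  then show ?thesis using nuc_norm_scaleR_le[of c X] nuc_norm_nonneg[of "c *\<^sub>R X"] by simp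
next
  case False
  have "\<bar>c\<bar> * nuc_norm X \<le> nuc_norm (c *\<^sub>R X)"
    using nuc_norm_scaleR_le[of "1 / c" "c *\<^sub>R X"] False by (simp add: field_simps)
  then show ?thesis using nuc_norm_scaleR_le[of c X] by simp
qed

lemma nuc_norm_zero [simp]: "nuc_norm (0 :: real^'n^'m) = 0"
  using nuc_norm_scaleR[of 0 "0 :: real^'n^'m"] by simp

lemma nuc_norm_diff_le: "nuc_norm (X - Y) \<le> nuc_norm X + nuc_norm Y"
  using nuc_norm_triangle[of X "- Y"] by (simp add: nuc_norm_minus)

lemma nuc_norm_minus_commute: "nuc_norm (X - Y) = nuc_norm (Y - X)"
  using nuc_norm_minus[of "X - Y"] by simp

lemma nuc_norm_sum_le: "nuc_norm (\<Sum>i\<in>I. f i) \<le> (\<Sum>i\<in>I. nuc_norm (f i))"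
proof (induction I rule: infinite_finite_induct)
  case (insert i I)
  then show ?case using nuc_norm_triangle[of "f i" "\<Sum>i\<in>I. f i"] by simp
qed simp_all

lemma norm_sq_eq_sum_sing_val: "(norm X)\<^sup>2 = (\<Sum>j = 1..min_dim X. (sing_val j X)\<^sup>2)"
proof -
  obtain u v where uv: "is_svd X u v" using exists_svd by blast
  have "X \<bullet> X = (\<Sum>j = 1..min_dim X. sing_val j X * (u j \<bullet> (X *v v j)))" by (rule inner_svd[OF uv])
  also have "\<dots> = (\<Sum>j = 1..min_dim X. (sing_val j X)\<^sup>2)"
    using is_svdD(4,7)[OF uv] by (intro sum.cong) (auto simp: power2_eq_square)
  finally show ?thesis by (simp add: dot_square_norm)
qed

lemma frob_norm_eq_norm: "frob_norm X = norm X"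
  unfolding frob_norm_def norm_sq_eq_sum_sing_val[symmetric] by simp

lemma norm_le_nuc_norm: "norm X \<le> nuc_norm X"
proof -
  have "(\<Sum>j = 1..min_dim X. (sing_val j X)\<^sup>2) \<le> (\<Sum>j = 1..min_dim X. sing_val j X * nuc_norm X)"
    unfolding power2_eq_square nuc_norm_def
    using sing_val_nonneg[of _ X] by (intro sum_mono mult_left_mono member_le_sum) auto
  also have "\<dots> = (nuc_norm X)\<^sup>2"
    by (simp add: nuc_norm_def power2_eq_square sum_distrib_right)
  finally have "(norm X)\<^sup>2 \<le> (nuc_norm X)\<^sup>2"
    unfolding norm_sq_eq_sum_sing_val .
  then show ?thesis using nuc_norm_nonneg by (rule power2_le_imp_le)
qed

lemma inner_le_op_norm_nuc_norm: "\<bar>A \<bullet> B\<bar> \<le> op_norm A * nuc_norm B"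
proof -
  obtain u v where uv: "is_svd A u v" using exists_svd by blast
  have 1: "1 \<in> {1..min_dim A}" by (simp add: min_dim_def Suc_leI)
  have "\<bar>(\<Sum>j = 1..min_dim A. sing_val j A *\<^sub>R outer (u j) (v j)) \<bullet> B\<bar> \<le> op_norm A * nuc_norm B"
    unfolding op_norm_def
    by (rule inner_outer_sum_le_nuc[OF is_svdD(1,2)[OF uv]])
      (use sing_val_nonneg[of _ A] sing_val_antimono[of 1 _ A] 1 in auto)
  then show ?thesis using is_svdD(3)[OF uv] by simp
qed

section \<open>The spectral regularizer\<close>

text \<open>Tangent inequalities are summed over the singular values. The mixed terms need the trace
  inequality, which asks for coefficients that are nonnegative and ordered like the singular values:
  hence the conditions on \<open>f'\<close>.\<close>

lemma spectral_sum_subgradient: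
  fixes X Y :: "real^'n^'m"
  assumes tangent: "\<And>s t. 0 \<le> s \<Longrightarrow> 0 \<le> t \<Longrightarrow> f t + f' t * (s - t) \<le> f s"
    and mono: "\<And>s t. 0 \<le> s \<Longrightarrow> s \<le> t \<Longrightarrow> f' s \<le> f' t"
    and nonneg: "\<And>t. 0 \<le> t \<Longrightarrow> (0::real) \<le> f' t"
    and uv: "is_svd X u v"
  shows "spectral_sum f X + (\<Sum>j = 1..min_dim X. f' (sing_val j X) *\<^sub>R outer (u j) (v j)) \<bullet> (Y - X)
       \<le> spectral_sum f Y"
proof -
  have md: "min_dim Y = min_dim X" by (simp add: min_dim_def)
  let ?d = "min_dim X" and ?G = "\<Sum>j = 1..min_dim X. f' (sing_val j X) *\<^sub>R outer (u j) (v j)"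
  have GX: "?G \<bullet> X = (\<Sum>j = 1..?d. f' (sing_val j X) * sing_val j X)"
  proof -
    have "?G \<bullet> X = (\<Sum>j = 1..?d. f' (sing_val j X) * (u j \<bullet> (X *v v j)))"
      by (simp add: inner_sum_left inner_outer)
    also have "\<dots> = (\<Sum>j = 1..?d. f' (sing_val j X) * sing_val j X)"
      using is_svdD(4,7)[OF uv] by (intro sum.cong) auto
    finally show ?thesis .
  qed
  have GY: "?G \<bullet> Y \<le> (\<Sum>j = 1..?d. f' (sing_val j X) * sing_val j Y)"
    unfolding md[symmetric]
  proof (rule trace_inequality)
    show "0 \<le> f' (sing_val i X)" if "i \<in> {1..min_dim Y}" for i
      using that nonneg sing_val_nonneg md by metis
    show "f' (sing_val j X) \<le> f' (sing_val i X)" if "1 \<le> i" "i \<le> j" "j \<le> min_dim Y" for i j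
      using that md by (intro mono sing_val_antimono sing_val_nonneg) auto
  qed (use is_svdD(1,2)[OF uv] md in auto)
  have "spectral_sum f X + ?G \<bullet> (Y - X)
      \<le> (\<Sum>j = 1..?d. f (sing_val j X) + f' (sing_val j X) * (sing_val j Y - sing_val j X))"
    using GX GY by (simp add: inner_diff_right spectral_sum_def sum.distrib right_diff_distrib sum_subtractf)
  also have "\<dots> \<le> spectral_sum f Y"
    unfolding spectral_sum_def md
    by (intro sum_mono tangent sing_val_nonneg) (auto simp: md)
  finally show ?thesis .
qed

text \<open>The point needing care is 0, where \<open>p\<close> itself has a kink: differentiability
  of \<open>h\<close> there comes from evenness, concavity and the limit of
  \<open>deriv p\<close>.\<close>

lemma concave_part_tangent:
  fixes p :: "real \<Rightarrow> real" and lam \<mu> :: real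
  defines "h \<equiv> concave_part lam p"
  assumes reg: "admissible_regularizer lam \<mu> p"
  shows "(h has_real_derivative deriv h t) (at t)"
    and "deriv h 0 = 0"
    and "h s \<le> h t + deriv h t * (s - t)"
    and "h t + deriv h t * (s - t) - \<mu> / 2 * (s - t)\<^sup>2 \<le> h s"
    and "s \<le> t \<Longrightarrow> deriv h t \<le> deriv h s"
    and "0 \<le> t \<Longrightarrow> deriv h t \<le> 0"
    and "0 \<le> lam \<Longrightarrow> 0 \<le> t \<Longrightarrow> - lam \<le> deriv h t"
    and "s \<le> t \<Longrightarrow> - \<mu> * (t - s) \<le> deriv h t - deriv h s"
proof -
  have conc: "concave_on UNIV h" and p0: "p 0 = 0" and even: "\<And>t. p t = p (- t)"
    and pdiff: "\<And>t. t \<noteq> 0 \<Longrightarrow> p differentiable (at t)"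
    and lim: "((\<lambda>t. deriv p t) \<longlongrightarrow> lam) (at_right 0)"
    and pmono: "mono_on {0..} p"
    and wc: "\<And>t t'. t > t' \<Longrightarrow> deriv h t - deriv h t' \<ge> - \<mu> * (t - t')"
    using reg unfolding admissible_regularizer_def h_def by auto
  have h_even: "h (- t) = h t" for t using even[of t] by (simp add: h_def concave_part_def)
  have conv: "convex_on UNIV (\<lambda>t. - h t)" using conc by (simp add: concave_on_def)
  have p_der: "(p has_real_derivative deriv p t) (at t)" if "t \<noteq> 0" for t
    using pdiff[OF that] by (metis DERIV_deriv_iff_real_differentiable)
  have h_pos: "(h has_real_derivative (deriv p t - lam)) (at t)" if "t > 0" for t
  proof -
    have "((\<lambda>t. p t - lam * t) has_real_derivative (deriv p t - lam * 1)) (at t)"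
      by (intro derivative_intros p_der) (use that in auto)
    then have "((\<lambda>t. p t - lam * t) has_real_derivative (deriv p t - lam)) (at t)" by simp
    then show ?thesis
      by (rule has_field_derivative_transform_within_open[of _ _ _ "{0<..}"])
        (use that in \<open>auto simp: h_def concave_part_def\<close>)
  qed
  have tan: "h s \<le> h t + D * (s - t)" if "(h has_real_derivative D) (at t)" for s t D
  proof -
    have "((\<lambda>t. - h t) has_real_derivative - D) (at t)" by (intro derivative_intros that)
    then have "- h s - - h t \<ge> - D * (s - t)"
      by (intro convex_on_imp_above_tangent[OF conv]) auto
    then show ?thesis by simp
  qed
  \<comment> \<open>An even concave function peaks at 0, the midpoint of \<open>t\<close> and
    \<open>- t\<close>.\<close>
  have h_le: "h t \<le> h 0" for t
  proof -
    have "- h ((1 - 1/2) *\<^sub>R t + (1/2) *\<^sub>R (- t)) \<le> (1 - 1/2) * (- h t) + (1/2) * (- h (- t))"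
      by (rule convex_onD[OF conv]) auto
    then show ?thesis by (simp add: h_even)
  qed
  \<comment> \<open>The tangent at \<open>t\<close>, evaluated at 0, bounds the quotient from below
    by \<open>deriv p t - lam\<close>, which tends to 0; the peak at 0 bounds it from above.\<close>
  have quot_right: "((\<lambda>t. (h t - h 0) / t) \<longlongrightarrow> 0) (at_right 0)"
  proof (rule tendsto_sandwich[of "\<lambda>t. deriv p t - lam" _ _ "\<lambda>_. 0"])
    show "\<forall>\<^sub>F t in at_right 0. deriv p t - lam \<le> (h t - h 0) / t"
      using eventually_at_right_less[of 0]
    proof (rule eventually_mono)
      fix t :: real assume "0 < t"
      then show "deriv p t - lam \<le> (h t - h 0) / t"
        using tan[OF h_pos, of t 0] by (simp add: field_simps)
    qed
    show "\<forall>\<^sub>F t in at_right 0. (h t - h 0) / t \<le> 0"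
      using eventually_at_right_less[of 0]
      by (rule eventually_mono) (use h_le in \<open>simp add: divide_nonpos_pos\<close>)
    show "((\<lambda>t. deriv p t - lam) \<longlongrightarrow> 0) (at_right 0)"
      using tendsto_diff[OF lim tendsto_const[of lam]] by simp
  qed simp
  have quot_left: "((\<lambda>t. (h t - h 0) / t) \<longlongrightarrow> 0) (at_left 0)"
    using tendsto_minus[OF quot_right] by (simp add: filterlim_at_left_to_right h_even)
  have h0: "(h has_real_derivative 0) (at 0)"
    using filterlim_split_at[OF quot_left quot_right] by (simp add: DERIV_def)
  have "h differentiable (at t)" for t
  proof (cases "0::real" t rule: linorder_cases)
    case less
    then show ?thesis using h_pos[of t] by (auto simp: real_differentiable_def)
  next
    case greater
    then have "((\<lambda>x. h (- x)) has_real_derivative - (deriv p (- t) - lam)) (at t)"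
      using DERIV_mirror[THEN iffD1, OF h_pos[of "- t"]] by simp
    then show ?thesis by (auto simp: h_even real_differentiable_def)
  qed (use h0 in \<open>auto simp: real_differentiable_def\<close>)
  then show der: "(h has_real_derivative deriv h t) (at t)" for t
    by (metis DERIV_deriv_iff_real_differentiable)
  show d0: "deriv h 0 = 0" using h0 by (rule DERIV_imp_deriv)
  show tang: "h s \<le> h t + deriv h t * (s - t)" for s t by (rule tan[OF der])
  show anti: "s \<le> t \<Longrightarrow> deriv h t \<le> deriv h s" for s t
  proof (cases "s = t")
    case False
    assume "s \<le> t"
    have "(deriv h t - deriv h s) * (t - s) \<le> 0"
      using tang[of s t] tang[of t s] by (simp add: algebra_simps)
    then show ?thesis using False \<open>s \<le> t\<close> by (simp add: mult_le_0_iff)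
  qed simp
  show "0 \<le> t \<Longrightarrow> deriv h t \<le> 0" using anti[of 0 t] d0 by simp
  show "- lam \<le> deriv h t" if "0 \<le> lam" "0 \<le> t"
  proof (cases "t = 0")
    case False
    then have t: "t > 0" using that by simp
    then have "deriv p t \<ge> 0"
      by (intro mono_on_imp_deriv_nonneg[OF pmono p_der]) auto
    then show ?thesis using DERIV_imp_deriv[OF h_pos[OF t]] by simp
  qed (use d0 that in simp)
  show wc': "s \<le> t \<Longrightarrow> - \<mu> * (t - s) \<le> deriv h t - deriv h s" for s t
    using wc[of s t] by (cases "s = t") auto
  show "h t + deriv h t * (s - t) - \<mu> / 2 * (s - t)\<^sup>2 \<le> h s" for s t
  proof -
    \<comment> \<open>Condition (v) says that adding this quadratic makes \<open>h\<close> convex;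
      the tangent inequality of \<open>g\<close> is the claim.\<close>
    define g where "g t = h t + \<mu> / 2 * t\<^sup>2" for t
    have gder: "(g has_real_derivative deriv h t + \<mu> * t) (at t)" for t
      unfolding g_def by (auto intro!: derivative_eq_intros der)
    have "convex_on UNIV g"
      by (rule convex_on_realI[OF _ gder]) (use wc' in \<open>auto simp: algebra_simps\<close>)
    then have "g s - g t \<ge> (deriv h t + \<mu> * t) * (s - t)"
      by (rule convex_on_imp_above_tangent) (use gder in auto)
    then show ?thesis by (simp add: g_def algebra_simps power2_eq_square)
  qed
qed

text \<open>The subgradient lemma is applied to two convex nondecreasing functions on the half-line,
  \<open>- h\<close> and \<open>h\<close> plus \<open>\<mu> / 2 * t^2\<close>; the squares add up to
  the Frobenius norm.\<close>

lemma spectral_sum_concave_part_bounds: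
  fixes X Y :: "real^'n^'m" and lam \<mu> :: real and p u v
  defines "Q \<equiv> spectral_sum (concave_part lam p)"
  assumes reg: "admissible_regularizer lam \<mu> p" and uv: "is_svd X u v"
  defines "G \<equiv> \<Sum>j = 1..min_dim X. deriv (concave_part lam p) (sing_val j X) *\<^sub>R outer (u j) (v j)"
  shows "Q Y \<le> Q X + G \<bullet> (Y - X)"
    and "Q X + G \<bullet> (Y - X) - \<mu> / 2 * (norm (Y - X))\<^sup>2 \<le> Q Y"
proof -
  let ?h = "concave_part lam p"
  note tan = concave_part_tangent[OF reg]
  have "spectral_sum (\<lambda>t. - ?h t) X
      + (\<Sum>j = 1..min_dim X. (- deriv ?h (sing_val j X)) *\<^sub>R outer (u j) (v j)) \<bullet> (Y - X)
      \<le> spectral_sum (\<lambda>t. - ?h t) Y"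
    by (rule spectral_sum_subgradient[OF _ _ _ uv]) (use tan(3,5,6) in \<open>auto simp: algebra_simps\<close>)
  then show "Q Y \<le> Q X + G \<bullet> (Y - X)"
    by (simp add: Q_def G_def spectral_sum_def sum_negf)
  have md: "min_dim Y = min_dim X" by (simp add: min_dim_def)
  have sq: "spectral_sum (\<lambda>t. ?h t + \<mu> / 2 * t\<^sup>2) Z = Q Z + \<mu> / 2 * (norm Z)\<^sup>2" for Z :: "real^'n^'m"
    by (simp add: Q_def spectral_sum_def norm_sq_eq_sum_sing_val sum.distrib sum_distrib_left)
  have "spectral_sum (\<lambda>t. ?h t + \<mu> / 2 * t\<^sup>2) X
      + (\<Sum>j = 1..min_dim X. (deriv ?h (sing_val j X) + \<mu> * sing_val j X) *\<^sub>R outer (u j) (v j)) \<bullet> (Y - X)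
      \<le> spectral_sum (\<lambda>t. ?h t + \<mu> / 2 * t\<^sup>2) Y"
  proof (rule spectral_sum_subgradient[OF _ _ _ uv, where f' = "\<lambda>t. deriv ?h t + \<mu> * t"])
    fix s t :: real
    show "?h t + \<mu> / 2 * t\<^sup>2 + (deriv ?h t + \<mu> * t) * (s - t) \<le> ?h s + \<mu> / 2 * s\<^sup>2"
      using tan(4)[of t s] by (simp add: algebra_simps power2_eq_square)
    show "deriv ?h s + \<mu> * s \<le> deriv ?h t + \<mu> * t" if "s \<le> t"
      using tan(8)[OF that] by (simp add: algebra_simps)
    show "0 \<le> deriv ?h t + \<mu> * t" if "0 \<le> t"
      using tan(8)[OF that] tan(2) by (simp add: algebra_simps)
  qed
  moreover have "(\<Sum>j = 1..min_dim X. (deriv ?h (sing_val j X) + \<mu> * sing_val j X) *\<^sub>R outer (u j) (v j)) = G + \<mu> *\<^sub>R X"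
  proof -
    have "\<mu> *\<^sub>R X = (\<Sum>j = 1..min_dim X. (\<mu> * sing_val j X) *\<^sub>R outer (u j) (v j))"
      by (subst is_svdD(3)[OF uv]) (simp add: scaleR_sum_right)
    then show ?thesis by (simp add: G_def scaleR_add_left sum.distrib)
  qed
  ultimately have "Q X + \<mu> / 2 * (norm X)\<^sup>2 + (G + \<mu> *\<^sub>R X) \<bullet> (Y - X) \<le> Q Y + \<mu> / 2 * (norm Y)\<^sup>2"
    unfolding sq by simp
  then show "Q X + G \<bullet> (Y - X) - \<mu> / 2 * (norm (Y - X))\<^sup>2 \<le> Q Y"
    unfolding dot_square_norm[symmetric]
    by (simp add: inner_diff_left inner_diff_right inner_add_left inner_commute algebra_simps)
qed

lemma spectral_sum_split: "spectral_sum p X = spectral_sum (concave_part lam p) X + lam * nuc_norm X"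
proof -
  have "spectral_sum (concave_part lam p) X + lam * nuc_norm X
      = (\<Sum>j = 1..min_dim X. p (sing_val j X) - lam * \<bar>sing_val j X\<bar> + lam * sing_val j X)"
    by (simp add: spectral_sum_def concave_part_def nuc_norm_def sum.distrib sum_distrib_left)
  also have "\<dots> = spectral_sum p X"
    unfolding spectral_sum_def using sing_val_nonneg[of _ X] by (intro sum.cong) auto
  finally show ?thesis by simp
qed

text \<open>The subgradients of the concave part and of the nuclear norm share singular vectors, and
  their coefficients add up to slopes between 0 and \<open>lam\<close>. So the linear term is at
  most \<open>lam\<close> times the nuclear norm, and only weak convexity adds an error.\<close>

lemma spectral_sum_step_le:
  fixes X Y :: "real^'n^'m"
  assumes reg: "admissible_regularizer lam \<mu> p" and lam: "0 \<le> lam"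
  shows "spectral_sum p X - spectral_sum p Y \<le> lam * nuc_norm (Y - X) + \<mu> / 2 * (norm (Y - X))\<^sup>2"
proof -
  obtain u v where uv: "is_svd X u v" using exists_svd by blast
  let ?h = "concave_part lam p"
  define G where "G = (\<Sum>j = 1..min_dim X. deriv ?h (sing_val j X) *\<^sub>R outer (u j) (v j))"
  define W where "W = (\<Sum>j = 1..min_dim X. 1 *\<^sub>R outer (u j) (v j))"
  note tan = concave_part_tangent[OF reg]
  have WX: "W \<bullet> X = nuc_norm X" using inner_polar_eq_nuc[OF uv] by (simp add: W_def)
  have "\<bar>W \<bullet> Y\<bar> \<le> 1 * nuc_norm Y"
    unfolding W_def by (rule inner_outer_sum_le_nuc[OF is_svdD(1,2)[OF uv]]) auto
  then have WY: "lam * nuc_norm X + lam * (W \<bullet> (Y - X)) \<le> lam * nuc_norm Y"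
    using WX lam by (simp add: inner_diff_right right_diff_distrib mult_left_mono)
  have "G + lam *\<^sub>R W = (\<Sum>j = 1..min_dim X. (deriv ?h (sing_val j X) + lam) *\<^sub>R outer (u j) (v j))"
    by (simp add: G_def W_def scaleR_add_left sum.distrib scaleR_sum_right)
  moreover have bnd: "\<bar>deriv ?h (sing_val j X) + lam\<bar> \<le> lam" if "j \<in> {1..min_dim X}" for j
    using tan(6)[OF sing_val_nonneg[OF that]] tan(7)[OF lam sing_val_nonneg[OF that]] lam by linarith
  ultimately have "\<bar>(G + lam *\<^sub>R W) \<bullet> (Y - X)\<bar> \<le> lam * nuc_norm (Y - X)"
    using inner_outer_sum_le_nuc[OF is_svdD(1,2)[OF uv] bnd lam, where Y = "Y - X"] by simp
  then show ?thesis
    using WY spectral_sum_concave_part_bounds(2)[OF reg uv, of Y]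
    unfolding spectral_sum_split[of p _ lam] G_def[symmetric]
    by (simp add: inner_add_left)
qed

text \<open>The quadratic error of a single step disappears when the segment is subdivided.\<close>

lemma spectral_sum_lipschitz:
  fixes X Y :: "real^'n^'m"
  assumes reg: "admissible_regularizer lam \<mu> p" and lam: "0 \<le> lam"
  shows "spectral_sum p X - spectral_sum p Y \<le> lam * nuc_norm (Y - X)"
proof -
  define c where "c = \<mu> / 2 * (norm (Y - X))\<^sup>2"
  have step: "spectral_sum p X - spectral_sum p Y \<le> lam * nuc_norm (Y - X) + c / real (Suc n)" for n
  proof -
    define k where "k = Suc n"
    have k: "real k > 0" by (simp add: k_def)
    define Z where "Z i = X + (real i / real k) *\<^sub>R (Y - X)" for i
    have dZ: "Z (Suc i) - Z i = (1 / real k) *\<^sub>R (Y - X)" for i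
      by (simp add: Z_def add_divide_distrib scaleR_add_left)
    have "spectral_sum p (Z i) - spectral_sum p (Z (Suc i)) \<le> lam * nuc_norm (Y - X) / real k + c / (real k)\<^sup>2" for i
      using spectral_sum_step_le[OF reg lam, of "Z i" "Z (Suc i)"] k
      unfolding dZ nuc_norm_scaleR by (simp add: c_def power_divide)
    then have "(\<Sum>i<k. spectral_sum p (Z i) - spectral_sum p (Z (Suc i)))
        \<le> (\<Sum>i<k. lam * nuc_norm (Y - X) / real k + c / (real k)\<^sup>2)"
      by (rule sum_mono)
    also have "\<dots> = lam * nuc_norm (Y - X) + c / real k"
      using k by (simp add: distrib_left power2_eq_square)
    also have "(\<Sum>i<k. spectral_sum p (Z i) - spectral_sum p (Z (Suc i))) = spectral_sum p (Z 0) - spectral_sum p (Z k)"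
      by (rule sum_lessThan_telescope')
    finally show ?thesis using k by (simp add: Z_def k_def)
  qed
  have "(\<lambda>n. lam * nuc_norm (Y - X) + c / real (Suc n)) \<longlonglongrightarrow> lam * nuc_norm (Y - X) + 0"
    by (intro tendsto_add tendsto_const LIMSEQ_Suc[OF lim_const_over_n])
  then show ?thesis using step by (intro LIMSEQ_le_const[of _ _ "spectral_sum p X - spectral_sum p Y"]) auto
qed

section \<open>Gradients and the Taylor error of the smooth part\<close>

lemma has_derivative_grad:
  assumes "f differentiable (at X)"
  shows "(f has_derivative (\<lambda>H. grad f X \<bullet> H)) (at X)"
proof -
  obtain D where D: "(f has_derivative D) (at X)" using assms by (auto simp: differentiable_def)
  define G where "G = adjoint D 1"
  have "D = (\<lambda>H. mat_inner G H)"
    using adjoint_works[OF has_derivative_linear[OF D], of _ 1]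
    by (simp add: fun_eq_iff G_def mat_inner_eq_inner inner_commute)
  with D have ex: "(f has_derivative (\<lambda>H. mat_inner G H)) (at X)" by simp
  have "(f has_derivative (\<lambda>H. mat_inner (grad f X) H)) (at X)"
    unfolding grad_def
  proof (rule theI[where P = "\<lambda>G. (f has_derivative (\<lambda>H. mat_inner G H)) (at X)"], rule ex)
    fix G' assume "(f has_derivative (\<lambda>H. mat_inner G' H)) (at X)"
    from has_derivative_unique[OF this ex] have "G' \<bullet> H = G \<bullet> H" for H
      unfolding mat_inner_eq_inner by metis
    then show "G' = G" by (metis inner_commute vector_eq_rdot)
  qed
  then show ?thesis by (simp add: mat_inner_eq_inner)
qed

lemma grad_eqI:
  assumes "(f has_derivative (\<lambda>H. G \<bullet> H)) (at X)"
  shows "grad f X = G"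
proof -
  have "(f has_derivative (\<lambda>H. grad f X \<bullet> H)) (at X)"
    using assms by (intro has_derivative_grad) (auto simp: differentiable_def)
  from has_derivative_unique[OF this assms] have "grad f X \<bullet> H = G \<bullet> H" for H by metis
  then show ?thesis by (metis inner_commute vector_eq_rdot)
qed

lemma has_derivative_quadratic_error:
  fixes f :: "'a::real_inner \<Rightarrow> real"
  assumes "\<And>Y. \<bar>f Y - f X - G \<bullet> (Y - X)\<bar> \<le> c * (norm (Y - X))\<^sup>2"
  shows "(f has_derivative (\<lambda>H. G \<bullet> H)) (at X)"
  unfolding has_derivative_at_within
proof
  show "bounded_linear (\<lambda>H. G \<bullet> H)" by (rule bounded_linear_inner_right)
  have lim: "((\<lambda>Y. c * norm (Y - X)) \<longlongrightarrow> c * norm (X - X)) (at X)"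
    by (intro tendsto_intros)
  show "((\<lambda>Y. (f Y - f X - G \<bullet> (Y - X)) /\<^sub>R norm (Y - X)) \<longlongrightarrow> 0) (at X)"
  proof (rule tendsto_0_le[where K = 1])
    show "((\<lambda>Y. c * norm (Y - X)) \<longlongrightarrow> 0) (at X)" using lim by simp
    show "\<forall>\<^sub>F Y in at X. norm ((f Y - f X - G \<bullet> (Y - X)) /\<^sub>R norm (Y - X)) \<le> norm (c * norm (Y - X)) * 1"
    proof (rule eventuallyI)
      fix Y
      have "norm ((f Y - f X - G \<bullet> (Y - X)) /\<^sub>R norm (Y - X)) = \<bar>f Y - f X - G \<bullet> (Y - X)\<bar> / norm (Y - X)"
        by (simp add: abs_mult divide_inverse mult.commute)
      also have "\<dots> \<le> c * (norm (Y - X))\<^sup>2 / norm (Y - X)"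
        using assms by (intro divide_right_mono) auto
      also have "\<dots> = c * norm (Y - X)" by (simp add: power2_eq_square)
      also have "\<dots> \<le> norm (c * norm (Y - X)) * 1" by simp
      finally show "norm ((f Y - f X - G \<bullet> (Y - X)) /\<^sub>R norm (Y - X)) \<le> norm (c * norm (Y - X)) * 1" .
    qed
  qed
qed

text \<open>The upper and the lower bound share the linear term \<open>G\<close> and differ by a
  quadratic, which makes \<open>G\<close> the gradient, also where singular values coincide or
  vanish. In particular \<open>G\<close> does not depend on the chosen decomposition.\<close>

lemma spectral_sum_concave_part_derivative:
  fixes X :: "real^'n^'m" and lam \<mu> :: real and p u v
  defines "Q \<equiv> spectral_sum (concave_part lam p)"
  assumes reg: "admissible_regularizer lam \<mu> p" and uv: "is_svd X u v"
  defines "G \<equiv> \<Sum>j = 1..min_dim X. deriv (concave_part lam p) (sing_val j X) *\<^sub>R outer (u j) (v j)"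
  shows "(Q has_derivative (\<lambda>H. G \<bullet> H)) (at X)"
proof (rule has_derivative_quadratic_error)
  show "\<bar>Q Y - Q X - G \<bullet> (Y - X)\<bar> \<le> \<mu> / 2 * (norm (Y - X))\<^sup>2" for Y
    using spectral_sum_concave_part_bounds[OF reg uv, of Y] unfolding Q_def G_def by linarith
qed

lemma taylor_error_smooth_part:
  fixes X Y :: "real^'n^'m"
  assumes reg: "admissible_regularizer lam \<mu> p" and diff: "\<forall>X. L differentiable (at X)"
  shows "smooth_part L lam p differentiable (at X)"
    and "taylor_error L X Y - \<mu> / 2 * (norm (X - Y))\<^sup>2 \<le> taylor_error (smooth_part L lam p) X Y"
    and "taylor_error (smooth_part L lam p) X Y \<le> taylor_error L X Y"
proof -
  define Q where "Q = (spectral_sum (concave_part lam p) :: real^'n^'m \<Rightarrow> real)"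
  have der: "\<exists>G. (smooth_part L lam p has_derivative (\<lambda>H. (grad L Y + G) \<bullet> H)) (at Y)
      \<and> (\<forall>X. Q X \<le> Q Y + G \<bullet> (X - Y) \<and> Q Y + G \<bullet> (X - Y) - \<mu> / 2 * (norm (X - Y))\<^sup>2 \<le> Q X)" for Y
  proof -
    obtain u v where uv: "is_svd Y u v" using exists_svd by blast
    have "((\<lambda>X. L X + Q X) has_derivative (\<lambda>H. (grad L Y) \<bullet> H +
        (\<Sum>j = 1..min_dim Y. deriv (concave_part lam p) (sing_val j Y) *\<^sub>R outer (u j) (v j)) \<bullet> H)) (at Y)"
      unfolding Q_def
      by (intro has_derivative_add has_derivative_grad spectral_sum_concave_part_derivative[OF reg uv])
        (use diff in blast)
    then show ?thesis
      using spectral_sum_concave_part_bounds[OF reg uv]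
      by (intro exI[of _ "\<Sum>j = 1..min_dim Y. deriv (concave_part lam p) (sing_val j Y) *\<^sub>R outer (u j) (v j)"])
        (simp add: smooth_part_def[abs_def] Q_def inner_add_left)
  qed
  show "smooth_part L lam p differentiable (at X)" using der[of X] by (auto simp: differentiable_def)
  obtain G where G: "(smooth_part L lam p has_derivative (\<lambda>H. (grad L Y + G) \<bullet> H)) (at Y)"
      "Q X \<le> Q Y + G \<bullet> (X - Y)" "Q Y + G \<bullet> (X - Y) - \<mu> / 2 * (norm (X - Y))\<^sup>2 \<le> Q X"
    using der[of Y] by blast
  have "taylor_error (smooth_part L lam p) X Y = taylor_error L X Y + (Q X - Q Y - G \<bullet> (X - Y))"
    unfolding taylor_error_def grad_eqI[OF G(1)] mat_inner_eq_inner
    by (simp add: smooth_part_def Q_def inner_add_left)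
  with G(2,3) show "taylor_error L X Y - \<mu> / 2 * (norm (X - Y))\<^sup>2 \<le> taylor_error (smooth_part L lam p) X Y"
    "taylor_error (smooth_part L lam p) X Y \<le> taylor_error L X Y" by auto
qed

section \<open>Restricted lower bound of the regularizer\<close>

lemma orthogonal_contractionsD:
  assumes "orthogonal_contractions I u" "i \<in> I"
  shows "norm (u i) \<le> 1" and "j \<in> I \<Longrightarrow> i \<noteq> j \<Longrightarrow> u i \<bullet> u j = 0"
  using assms by (auto simp: orthogonal_contractions_def)

lemma orthogonal_contractions_subset:
  "orthogonal_contractions I u \<Longrightarrow> K \<subseteq> I \<Longrightarrow> orthogonal_contractions K u"
  unfolding orthogonal_contractions_def by (auto intro: finite_subset)

lemma orthogonal_contractions_Plus:
  assumes u: "orthogonal_contractions I u" and x: "orthogonal_contractions K x"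
    and ux: "\<And>k i. k \<in> K \<Longrightarrow> i \<in> I \<Longrightarrow> x k \<bullet> u i = 0"
  shows "orthogonal_contractions (I <+> K) (case_sum u x)"
proof -
  have xu: "u i \<bullet> x k = 0" if "k \<in> K" "i \<in> I" for k i
    using ux[OF that] by (simp add: inner_commute)
  show ?thesis
    unfolding orthogonal_contractions_def
  proof (intro conjI ballI impI)
    show "finite (I <+> K)" using u x by (simp add: orthogonal_contractions_def)
    show "norm (case_sum u x i) \<le> 1" if "i \<in> I <+> K" for i
      using that u x by (auto simp: orthogonal_contractions_def)
    show "case_sum u x i \<bullet> case_sum u x j = 0" if "i \<in> I <+> K" "j \<in> I <+> K" "i \<noteq> j" for i j
      using that
      by (elim PlusE) (simp_all add: ux xu orthogonal_contractionsD(2)[OF u] orthogonal_contractionsD(2)[OF x])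
  qed
qed

lemma is_svd_norm_eq_1:
  assumes "is_svd X u v" "j \<in> {1..min_dim X}" "0 < sing_val j X"
  shows "norm (u j) = 1" "norm (v j) = 1"
  using assms unfolding is_svd_def by blast+

lemma outer_transpose: "transpose (outer a b) = outer b a"
  by (simp add: vec_eq_iff transpose_def outer_def mult.commute)

lemma inner_transpose: "transpose X \<bullet> transpose Y = X \<bullet> (Y :: real^'n^'m)"
  unfolding inner_vec_def transpose_def by (simp, rule sum.swap)

lemma transpose_sum: "transpose (\<Sum>i\<in>I. f i) = (\<Sum>i\<in>I. transpose (f i))"
  by (induction I rule: infinite_finite_induct) (simp_all add: transpose_def vec_eq_iff)

lemma inner_vec_transpose: "(x :: real^'n) \<bullet> (transpose X *v y) = (X *v x) \<bullet> (y :: real^'m)"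
  using dot_lmul_matrix[of x "transpose X" y] by (simp only: vector_transpose_matrix)

lemma sum_norm_le_sqrt_card:
  "(\<Sum>j\<in>J. norm (f j)) \<le> sqrt (real (card J)) * sqrt (\<Sum>j\<in>J. (norm (f j))\<^sup>2)"
proof -
  have "(\<Sum>j\<in>J. 1 * norm (f j))\<^sup>2 \<le> (\<Sum>j\<in>J. 1\<^sup>2) * (\<Sum>j\<in>J. (norm (f j))\<^sup>2)"
    by (rule Cauchy_Schwarz_ineq_sum)
  then have "sqrt ((\<Sum>j\<in>J. norm (f j))\<^sup>2) \<le> sqrt (real (card J) * (\<Sum>j\<in>J. (norm (f j))\<^sup>2))"
    by (intro real_sqrt_le_mono) simp
  then show ?thesis by (simp add: real_sqrt_mult sum_nonneg)
qed

text \<open>For orthonormal \<open>v\<close> this is \<open>C\<close> composed with the orthogonal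
  projection onto their span.\<close>

definition row_part :: "'i set \<Rightarrow> ('i \<Rightarrow> real^'n) \<Rightarrow> real^'n^'m \<Rightarrow> real^'n^'m" where
  "row_part J v C = (\<Sum>j\<in>J. outer (C *v v j) (v j))"

lemma row_part_props:
  fixes C :: "real^'n^'m"
  assumes J: "finite J" and v: "\<And>i j. i \<in> J \<Longrightarrow> j \<in> J \<Longrightarrow> v i \<bullet> v j = (if i = j then 1 else 0)"
  shows "j \<in> J \<Longrightarrow> (C - row_part J v C) *v v j = 0"
    and "(norm C)\<^sup>2 = (\<Sum>j\<in>J. (norm (C *v v j))\<^sup>2) + (norm (C - row_part J v C))\<^sup>2"
    and "nuc_norm (row_part J v C) \<le> sqrt (real (card J)) * sqrt (\<Sum>j\<in>J. (norm (C *v v j))\<^sup>2)"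
proof -
  let ?B = "row_part J v C"
  have Bv: "?B *v w = (\<Sum>j\<in>J. (v j \<bullet> w) *\<^sub>R (C *v v j))" for w
    using sum_outer_mult_vec[of "\<lambda>_. 1" "\<lambda>j. C *v v j" v J w] by (simp add: row_part_def)
  have Bk: "?B *v v k = C *v v k" if "k \<in> J" for k
  proof -
    have "?B *v v k = (\<Sum>j\<in>J. if k = j then C *v v j else 0)"
      unfolding Bv using that v by (intro sum.cong) auto
    then show ?thesis using that J by simp
  qed
  show "(C - ?B) *v v j = 0" if "j \<in> J" for j
    using Bk[OF that] by (simp add: matrix_vector_mult_diff_rdistrib)
  have BC: "?B \<bullet> C = (\<Sum>j\<in>J. (norm (C *v v j))\<^sup>2)"
    by (simp add: row_part_def inner_sum_left inner_outer dot_square_norm)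
  have "?B \<bullet> ?B = (\<Sum>j\<in>J. (C *v v j) \<bullet> (?B *v v j))"
    by (subst (1) row_part_def) (simp add: inner_sum_left inner_outer)
  also have "\<dots> = ?B \<bullet> C" unfolding BC by (intro sum.cong) (simp_all add: Bk dot_square_norm)
  finally have "?B \<bullet> ?B = ?B \<bullet> C" .
  then have "(norm (C - ?B))\<^sup>2 = (norm C)\<^sup>2 - ?B \<bullet> C"
    by (simp add: inner_diff_left inner_diff_right inner_commute flip: dot_square_norm)
  with BC show "(norm C)\<^sup>2 = (\<Sum>j\<in>J. (norm (C *v v j))\<^sup>2) + (norm (C - ?B))\<^sup>2" by simp
  have "nuc_norm ?B \<le> (\<Sum>j\<in>J. nuc_norm (outer (C *v v j) (v j)))"
    unfolding row_part_def by (rule nuc_norm_sum_le)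
  also have "\<dots> \<le> (\<Sum>j\<in>J. norm (C *v v j))"
  proof (intro sum_mono)
    fix j assume "j \<in> J"
    then have "norm (v j) = 1" using v[of j j] by (simp add: norm_eq_sqrt_inner)
    then show "nuc_norm (outer (C *v v j) (v j)) \<le> norm (C *v v j)"
      using nuc_norm_outer_le[of "C *v v j" "v j"] by simp
  qed
  also have "\<dots> \<le> sqrt (real (card J)) * sqrt (\<Sum>j\<in>J. (norm (C *v v j))\<^sup>2)"
    by (rule sum_norm_le_sqrt_card)
  finally show "nuc_norm ?B \<le> sqrt (real (card J)) * sqrt (\<Sum>j\<in>J. (norm (C *v v j))\<^sup>2)" .
qed

lemma column_part_props:
  fixes C :: "real^'n^'m" and u :: "'i \<Rightarrow> real^'m"
  assumes J: "finite J" and u: "\<And>i j. i \<in> J \<Longrightarrow> j \<in> J \<Longrightarrow> u i \<bullet> u j = (if i = j then 1 else 0)"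
  defines "B \<equiv> \<Sum>j\<in>J. outer (u j) (transpose C *v u j)"
  shows "j \<in> J \<Longrightarrow> transpose (C - B) *v u j = 0"
    and "(norm C)\<^sup>2 = (\<Sum>j\<in>J. (norm (transpose C *v u j))\<^sup>2) + (norm (C - B))\<^sup>2"
    and "nuc_norm B \<le> sqrt (real (card J)) * sqrt (\<Sum>j\<in>J. (norm (transpose C *v u j))\<^sup>2)"
proof -
  have B: "transpose B = row_part J u (transpose C)"
    by (simp add: B_def row_part_def transpose_sum outer_transpose)
  have norm_transpose: "norm (transpose X) = norm (X :: real^'n^'m)" for X
    by (simp add: norm_eq_sqrt_inner inner_transpose)
  have tr_diff: "transpose (C - B) = transpose C - transpose B"
    by (simp add: vec_eq_iff transpose_def)
  show "j \<in> J \<Longrightarrow> transpose (C - B) *v u j = 0"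
    unfolding tr_diff B by (rule row_part_props(1)[OF J u])
  show "(norm C)\<^sup>2 = (\<Sum>j\<in>J. (norm (transpose C *v u j))\<^sup>2) + (norm (C - B))\<^sup>2"
    using row_part_props(2)[OF J u, of "transpose C"]
    unfolding B[symmetric] tr_diff[symmetric] norm_transpose by blast
  have "nuc_norm B \<le> (\<Sum>j\<in>J. nuc_norm (outer (u j) (transpose C *v u j)))"
    unfolding B_def by (rule nuc_norm_sum_le)
  also have "\<dots> \<le> (\<Sum>j\<in>J. norm (transpose C *v u j))"
  proof (intro sum_mono)
    fix j assume "j \<in> J"
    then have "norm (u j) = 1" using u[of j j] by (simp add: norm_eq_sqrt_inner)
    then show "nuc_norm (outer (u j) (transpose C *v u j)) \<le> norm (transpose C *v u j)"
      using nuc_norm_outer_le[of "u j" "transpose C *v u j"] by simp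
  qed
  also have "\<dots> \<le> sqrt (real (card J)) * sqrt (\<Sum>j\<in>J. (norm (transpose C *v u j))\<^sup>2)"
    by (rule sum_norm_le_sqrt_card)
  finally show "nuc_norm B \<le> sqrt (real (card J)) * sqrt (\<Sum>j\<in>J. (norm (transpose C *v u j))\<^sup>2)" .
qed

text \<open>Decomposability at the part \<open>TJ\<close> of \<open>T\<close> with singular values
  above \<open>lam\<close>. The difference splits into \<open>D'\<close>, which meets the singular
  spaces of \<open>TJ\<close>, and \<open>D''\<close>, orthogonal to them on both sides;
  \<open>N'\<close> and \<open>N''\<close> are their nuclear norms. Adding \<open>D''\<close> to
  \<open>TJ\<close> adds its full nuclear norm and leaves the concave part unchanged to first order.
  The Lipschitz bound then passes from \<open>TJ\<close> to \<open>T\<close> (cost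
  \<open>lam * n\<close>) and from \<open>TJ + D''\<close> to \<open>X\<close> (cost
  \<open>lam * (N' + n)\<close>).\<close>

lemma spectral_sum_restricted_lower_bound:
  fixes T X :: "real^'n^'m" and lam \<mu> :: real and p
  defines "J \<equiv> {j \<in> {1..min_dim T}. lam < sing_val j T}"
    and "n \<equiv> (\<Sum>j\<in>{j \<in> {1..min_dim T}. \<not> lam < sing_val j T}. sing_val j T)"
  assumes reg: "admissible_regularizer lam \<mu> p" and lam: "0 < lam"
  shows "\<exists>N' N''. 0 \<le> N' \<and> N' \<le> sqrt (2 * real (card J)) * norm (X - T)
    \<and> nuc_norm (X - T) \<le> N' + N'' \<and> N'' \<le> nuc_norm X + n
    \<and> spectral_sum p T + lam * N'' - lam * N' - 2 * lam * n - \<mu> / 2 * (norm (X - T))\<^sup>2 \<le> spectral_sum p X"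
proof -
  obtain u v where uv: "is_svd T u v" using exists_svd by blast
  let ?d = "min_dim T" and ?s = "\<lambda>j. sing_val j T"
  define Jc where "Jc = {j \<in> {1..?d}. \<not> lam < ?s j}"
  have J: "finite J" "J \<subseteq> {1..?d}" by (auto simp: J_def)
  have sJ: "?s j > 0" if "j \<in> J" for j using that lam by (auto simp: J_def)
  have uJ: "u i \<bullet> u j = (if i = j then 1 else 0)" if "i \<in> J" "j \<in> J" for i j
    using that J(2) sJ is_svd_norm_eq_1(1)[OF uv, of i] orthogonal_contractionsD(2)[OF is_svdD(1)[OF uv], of i j]
    by (cases "i = j") (auto simp: dot_square_norm subset_iff)
  have vJ: "v i \<bullet> v j = (if i = j then 1 else 0)" if "i \<in> J" "j \<in> J" for i j
    using that J(2) sJ is_svd_norm_eq_1(2)[OF uv, of i] orthogonal_contractionsD(2)[OF is_svdD(2)[OF uv], of i j]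
    by (cases "i = j") (auto simp: dot_square_norm subset_iff)
  define TJ where "TJ = (\<Sum>j\<in>J. ?s j *\<^sub>R outer (u j) (v j))"
  define TC where "TC = (\<Sum>j\<in>Jc. ?s j *\<^sub>R outer (u j) (v j))"
  have n: "n = (\<Sum>j\<in>Jc. ?s j)" by (simp add: n_def Jc_def)
  have T: "T = TJ + TC"
  proof -
    have eq: "{1..?d} = J \<union> Jc" and disj: "J \<inter> Jc = {}" and fin: "finite Jc"
      by (auto simp: J_def Jc_def)
    have "(\<Sum>j = 1..?d. ?s j *\<^sub>R outer (u j) (v j)) = TJ + TC"
      unfolding eq TJ_def TC_def by (rule sum.union_disjoint[OF J(1) fin disj])
    then show ?thesis using is_svdD(3)[OF uv] by simp
  qed
  have outer1: "nuc_norm (?s j *\<^sub>R outer (u j) (v j)) \<le> ?s j" if "j \<in> {1..?d}" for j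
  proof -
    have "norm (u j) \<le> 1" "norm (v j) \<le> 1"
      using orthogonal_contractionsD(1)[OF is_svdD(1)[OF uv] that]
        orthogonal_contractionsD(1)[OF is_svdD(2)[OF uv] that] by simp_all
    then have "nuc_norm (outer (u j) (v j)) \<le> 1 * 1"
      by (intro order_trans[OF nuc_norm_outer_le] mult_mono) auto
    then show ?thesis
      using sing_val_nonneg[OF that] mult_left_mono[of "nuc_norm (outer (u j) (v j))" 1 "?s j"]
      by (simp add: nuc_norm_scaleR)
  qed
  have nTC: "nuc_norm TC \<le> n"
    unfolding TC_def n
    by (rule order_trans[OF nuc_norm_sum_le]) (intro sum_mono outer1, auto simp: Jc_def)
  have nTJ: "nuc_norm TJ \<le> (\<Sum>j\<in>J. ?s j)"
    unfolding TJ_def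
    by (rule order_trans[OF nuc_norm_sum_le]) (intro sum_mono outer1, auto simp: J_def)
  define D where "D = X - T"
  define A where "A = (\<Sum>j\<in>J. outer (u j) (transpose D *v u j))"
  \<comment> \<open>The row part is taken from what remains after \<open>A\<close>, so the squared
    norms of \<open>A\<close>, \<open>B\<close> and \<open>D''\<close> add up to that of
    \<open>D\<close>. This is what gives the factor \<open>sqrt (2 * card J)\<close>.\<close>
  define B where "B = row_part J v (D - A)"
  define D' where "D' = A + B"
  define D'' where "D'' = D - D'"
  have D''_eq: "D'' = (D - A) - B" by (simp add: D''_def D'_def)
  let ?a = "\<Sum>j\<in>J. (norm (transpose D *v u j))\<^sup>2" and ?b = "\<Sum>j\<in>J. (norm ((D - A) *v v j))\<^sup>2"
  have colp: "j \<in> J \<Longrightarrow> transpose (D - A) *v u j = 0" "(norm D)\<^sup>2 = ?a + (norm (D - A))\<^sup>2"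
      "nuc_norm A \<le> sqrt (real (card J)) * sqrt ?a" for j
    unfolding A_def using column_part_props[where C = D and u = u, OF J(1)] uJ by blast+
  have rowp: "j \<in> J \<Longrightarrow> D'' *v v j = 0" "(norm (D - A))\<^sup>2 = ?b + (norm D'')\<^sup>2"
      "nuc_norm B \<le> sqrt (real (card J)) * sqrt ?b" for j
    unfolding D''_eq B_def using row_part_props[where C = "D - A" and v = v, OF J(1)] vJ by blast+
  have D''v: "D'' *v v j = 0" if "j \<in> J" for j by (rule rowp(1)[OF that])
  have uDA: "u j \<bullet> ((D - A) *v w) = 0" if "j \<in> J" for j w
    using colp(1)[OF that] inner_vec_transpose[of w "D - A" "u j"] by (simp add: inner_commute)
  have uD'': "u j \<bullet> (D'' *v w) = 0" if "j \<in> J" for j w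
  proof -
    have "B *v w = (\<Sum>i\<in>J. (v i \<bullet> w) *\<^sub>R ((D - A) *v v i))"
      using sum_outer_mult_vec[of "\<lambda>_. 1" "\<lambda>j. (D - A) *v v j" v J w] by (simp add: B_def row_part_def)
    then have "u j \<bullet> (B *v w) = 0" by (simp add: inner_sum_right uDA[OF that])
    then show ?thesis
      unfolding D''_eq matrix_vector_mult_diff_rdistrib[of "D - A" B] inner_diff_right
      using uDA[OF that] by simp
  qed
  have ab: "(norm D)\<^sup>2 = ?a + ?b + (norm D'')\<^sup>2" using colp(2) rowp(2) by simp
  have a0: "?a \<ge> 0" "?b \<ge> 0" by (auto intro: sum_nonneg)
  have nD'': "(norm D'')\<^sup>2 \<le> (norm D)\<^sup>2" using ab a0 by simp
  have nD': "nuc_norm D' \<le> sqrt (2 * real (card J)) * norm D"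
  proof -
    have "nuc_norm D' \<le> sqrt (real (card J)) * (sqrt ?a + sqrt ?b)"
      unfolding D'_def using nuc_norm_triangle[of A B] colp(3) rowp(3) by (simp add: distrib_left)
    also have "\<dots> \<le> sqrt (real (card J)) * (sqrt 2 * norm D)"
    proof (intro mult_left_mono, rule power2_le_imp_le)
      have "(sqrt ?a + sqrt ?b)\<^sup>2 \<le> 2 * ((sqrt ?a)\<^sup>2 + (sqrt ?b)\<^sup>2)"
        using sum_squares_bound[of "sqrt ?a" "sqrt ?b"] by (simp add: power2_sum)
      also have "\<dots> \<le> 2 * (norm D)\<^sup>2" using ab a0 by simp
      finally show "(sqrt ?a + sqrt ?b)\<^sup>2 \<le> (sqrt 2 * norm D)\<^sup>2" by (simp add: power_mult_distrib)
    qed simp_all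
    finally show ?thesis by (simp add: real_sqrt_mult mult_ac)
  qed
  obtain x y where xy: "is_svd D'' x y" using exists_svd by blast
  have md: "min_dim D'' = ?d" by (simp add: min_dim_def)
  \<comment> \<open>Only at positive singular values are the vectors \<open>x k\<close>,
    \<open>y k\<close> images under \<open>D''\<close> and its transpose, hence orthogonal to the
    \<open>u j\<close>, \<open>v j\<close>.\<close>
  define K where "K = {k \<in> {1..?d}. 0 < sing_val k D''}"
  have K: "finite K" "K \<subseteq> {1..?d}" by (auto simp: K_def)
  have xu: "x k \<bullet> u j = 0" if "k \<in> K" "j \<in> J" for k j
  proof -
    have "sing_val k D'' * (u j \<bullet> x k) = u j \<bullet> (D'' *v y k)"
      using is_svdD(4)[OF xy, of k] that md by (simp add: K_def)
    then show ?thesis using uD''[OF that(2)] that(1) by (simp add: K_def inner_commute)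
  qed
  have yv: "y k \<bullet> v j = 0" if "k \<in> K" "j \<in> J" for k j
  proof -
    have "sing_val k D'' * (v j \<bullet> y k) = v j \<bullet> (transpose D'' *v x k)"
      using is_svdD(5)[OF xy, of k] that md by (simp add: K_def)
    also have "\<dots> = 0" by (simp only: inner_vec_transpose D''v[OF that(2)] inner_zero_left)
    finally show ?thesis using that(1) by (simp add: K_def inner_commute)
  qed
  have K_sum: "(\<Sum>k = 1..min_dim D''. outer (x k) (y k)) = (\<Sum>k\<in>K. outer (x k) (y k))"
  proof (rule sum.mono_neutral_right)
    show "\<forall>k\<in>{1..min_dim D''} - K. outer (x k) (y k) = 0"
    proof
      fix k assume k: "k \<in> {1..min_dim D''} - K"
      then have "sing_val k D'' = 0" using sing_val_nonneg[of k D''] md by (auto simp: K_def)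
      then have "x k = 0" using is_svdD(6)[OF xy] k by auto
      then show "outer (x k) (y k) = 0" by (simp add: outer_def vec_eq_iff)
    qed
  qed (use K md in auto)
  define W where "W = (\<Sum>k\<in>K. outer (x k) (y k))"
  have WD'': "W \<bullet> D'' = nuc_norm D''"
    using inner_polar_eq_nuc[OF xy] by (simp add: W_def flip: K_sum)
  have W_outer_u: "W \<bullet> outer (u j) w = 0" if "j \<in> J" for j w
    by (simp add: W_def inner_sum_left inner_outer outer_mult_vec xu[OF _ that])
  have W_outer_v: "W \<bullet> outer w (v j) = 0" if "j \<in> J" for j w
    by (simp add: W_def inner_sum_left inner_outer outer_mult_vec yv[OF _ that] inner_commute[of "v j"])
  have WD: "W \<bullet> D'' = W \<bullet> X - W \<bullet> TC"
  proof -
    have "W \<bullet> A = 0" by (simp add: A_def inner_sum_right W_outer_u)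
    moreover have "W \<bullet> B = 0" by (simp add: B_def row_part_def inner_sum_right W_outer_v)
    moreover have "W \<bullet> T = W \<bullet> TC"
      by (subst T) (simp add: inner_add_right TJ_def inner_sum_right W_outer_u)
    ultimately show ?thesis by (simp add: D''_eq D_def inner_diff_right)
  qed
  have Wle: "\<bar>W \<bullet> Z\<bar> \<le> nuc_norm Z" for Z
  proof -
    have "orthogonal_contractions K x" "orthogonal_contractions K y"
      using is_svdD(1,2)[OF xy] K(2) unfolding md by (auto intro: orthogonal_contractions_subset)
    from inner_outer_sum_le_nuc[OF this, of "\<lambda>_. 1" 1 Z] show ?thesis by (simp add: W_def)
  qed
  have N''_le: "nuc_norm D'' \<le> nuc_norm X + n"
    using WD WD'' Wle[of X] Wle[of TC] nTC by linarith
  \<comment> \<open>The polar factors of \<open>TJ\<close> and \<open>D''\<close> have mutually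
    orthogonal singular vectors; their sum is still a contraction and attains both nuclear
    norms.\<close>
  have nuc_add: "nuc_norm TJ + nuc_norm D'' \<le> nuc_norm (TJ + D'')"
  proof -
    define xu' yv' where "xu' = case_sum u x" and "yv' = case_sum v y"
    have "orthogonal_contractions (J <+> K) xu'" "orthogonal_contractions (J <+> K) yv'"
      unfolding xu'_def yv'_def
      using orthogonal_contractions_subset[OF is_svdD(1)[OF uv] J(2)] orthogonal_contractions_subset[OF is_svdD(2)[OF uv] J(2)]
        orthogonal_contractions_subset[OF is_svdD(1)[OF xy, unfolded md] K(2)]
        orthogonal_contractions_subset[OF is_svdD(2)[OF xy, unfolded md] K(2)] xu yv
      by (auto intro!: orthogonal_contractions_Plus)
    from inner_outer_sum_le_nuc[OF this, of "\<lambda>_. 1" 1 "TJ + D''"]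
    have "\<bar>(\<Sum>i\<in>J <+> K. outer (xu' i) (yv' i)) \<bullet> (TJ + D'')\<bar> \<le> nuc_norm (TJ + D'')" by simp
    moreover have "(\<Sum>i\<in>J <+> K. outer (xu' i) (yv' i)) = (\<Sum>j\<in>J. outer (u j) (v j)) + W"
      using J K by (simp add: sum.Plus W_def xu'_def yv'_def)
    moreover have "(\<Sum>j\<in>J. outer (u j) (v j)) \<bullet> D'' = 0"
      by (simp add: inner_sum_left inner_outer D''v)
    moreover have "W \<bullet> TJ = 0" by (simp add: TJ_def inner_sum_right W_outer_u)
    moreover have "(\<Sum>j\<in>J. outer (u j) (v j)) \<bullet> TJ = (\<Sum>j\<in>J. ?s j)"
    proof -
      have "u j \<bullet> (TJ *v v j) = ?s j" if "j \<in> J" for j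
      proof -
        have "TJ *v v j = (\<Sum>i\<in>J. if j = i then ?s i *\<^sub>R u i else 0)"
          unfolding TJ_def sum_outer_mult_vec using vJ that by (intro sum.cong) auto
        then show ?thesis using that J uJ by simp
      qed
      then show ?thesis by (simp add: inner_sum_left inner_outer)
    qed
    ultimately show ?thesis using WD'' nTJ by (simp add: inner_add_left inner_add_right)
  qed
  have PJ: "spectral_sum p TJ + lam * nuc_norm D'' - \<mu> / 2 * (norm D'')\<^sup>2 \<le> spectral_sum p (TJ + D'')"
  proof -
    obtain a b where ab: "is_svd TJ a b" using exists_svd by blast
    \<comment> \<open>The decomposition of \<open>TJ\<close> is an arbitrary one, unrelated to
      \<open>u\<close> and \<open>v\<close>. Its left vectors are multiples of
      \<open>TJ *v b i\<close> and so lie in the span of the \<open>u j\<close>.\<close>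
    have "a i \<bullet> (D'' *v b i) = 0" if i: "i \<in> {1..min_dim TJ}" for i
    proof (cases "sing_val i TJ = 0")
      case True
      then show ?thesis using is_svdD(6)[OF ab i] by simp
    next
      case False
      have "sing_val i TJ * (a i \<bullet> (D'' *v b i)) = (TJ *v b i) \<bullet> (D'' *v b i)"
        using is_svdD(4)[OF ab i] by simp
      also have "\<dots> = 0"
        unfolding TJ_def sum_outer_mult_vec by (simp add: inner_sum_left uD'')
      finally show ?thesis using False by simp
    qed
    then have "(\<Sum>j = 1..min_dim TJ. deriv (concave_part lam p) (sing_val j TJ) *\<^sub>R outer (a j) (b j)) \<bullet> D'' = 0"
      by (simp add: inner_sum_left inner_outer)
    then have "spectral_sum (concave_part lam p) TJ - \<mu> / 2 * (norm D'')\<^sup>2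
        \<le> spectral_sum (concave_part lam p) (TJ + D'')"
      using spectral_sum_concave_part_bounds(2)[OF reg ab, of "TJ + D''"] by simp
    moreover have "lam * (nuc_norm TJ + nuc_norm D'') \<le> lam * nuc_norm (TJ + D'')"
      using nuc_add lam by (intro mult_left_mono) auto
    ultimately show ?thesis unfolding spectral_sum_split[of p _ lam] by (simp add: distrib_left)
  qed
  have mu: "\<mu> \<ge> 0"
  proof -
    have "deriv (concave_part lam p) 1 - deriv (concave_part lam p) 0 \<le> 0"
      using concave_part_tangent(5)[OF reg, of 0 1] by simp
    then show ?thesis using concave_part_tangent(8)[OF reg, of 0 1] by simp
  qed
  have lip1: "spectral_sum p T - spectral_sum p TJ \<le> lam * n"
  proof -
    have "spectral_sum p T - spectral_sum p TJ \<le> lam * nuc_norm (TJ - T)"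
      using spectral_sum_lipschitz[OF reg] lam by simp
    also have "\<dots> = lam * nuc_norm TC" by (simp add: T nuc_norm_minus)
    also have "\<dots> \<le> lam * n" using nTC lam by (intro mult_left_mono) auto
    finally show ?thesis .
  qed
  have lip2: "spectral_sum p (TJ + D'') - spectral_sum p X \<le> lam * (nuc_norm D' + n)"
  proof -
    have "spectral_sum p (TJ + D'') - spectral_sum p X \<le> lam * nuc_norm (X - (TJ + D''))"
      using spectral_sum_lipschitz[OF reg] lam by simp
    also have "X - (TJ + D'') = D' + TC" by (simp add: D''_def D_def T)
    also have "lam * nuc_norm (D' + TC) \<le> lam * (nuc_norm D' + n)"
      using nuc_norm_triangle[of D' TC] nTC lam by (intro mult_left_mono) auto
    finally show ?thesis .
  qed
  have "\<mu> / 2 * (norm D'')\<^sup>2 \<le> \<mu> / 2 * (norm D)\<^sup>2" using nD'' mu by (intro mult_left_mono) auto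
  then have "spectral_sum p T + lam * nuc_norm D'' - lam * nuc_norm D' - 2 * lam * n - \<mu> / 2 * (norm D)\<^sup>2
      \<le> spectral_sum p X"
    using PJ lip1 lip2 by (simp add: algebra_simps)
  moreover have "nuc_norm D \<le> nuc_norm D' + nuc_norm D''"
    using nuc_norm_triangle[of D' D''] by (simp add: D''_def)
  ultimately show ?thesis using nD' N''_le nuc_norm_nonneg[of D'] unfolding D_def by blast
qed

text \<open>Markov's inequality counts the values above \<open>lam\<close>; below
  \<open>lam\<close>, write \<open>s = s^(1-q) * s^q\<close> and bound the first factor by
  \<open>lam^(1-q)\<close>.\<close>

lemma schatten_ball_large_part:
  fixes T :: "real^'n^'m"
  assumes T: "T \<in> schatten_ball q R" and q: "0 \<le> q" "q \<le> 1" and lam: "0 < lam"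
  shows "real (card {j \<in> {1..min_dim T}. lam < sing_val j T}) \<le> lam powr (- q) * R"
    and "(\<Sum>j\<in>{j \<in> {1..min_dim T}. \<not> lam < sing_val j T}. sing_val j T) \<le> lam * (lam powr (- q) * R)"
proof -
  let ?I = "{1..min_dim T}" and ?s = "\<lambda>j. sing_val j T"
  have R: "(\<Sum>j\<in>?I. ?s j powr q) \<le> R"
  proof -
    have "(\<Sum>j\<in>?I. ?s j powr q) = (\<Sum>j\<in>?I. \<bar>?s j\<bar> powr q)"
      using sing_val_nonneg[of _ T] by (intro sum.cong) auto
    then show ?thesis using T by (simp add: schatten_ball_def)
  qed
  have "real (card {j \<in> ?I. lam < ?s j}) * lam powr q = (\<Sum>j\<in>{j \<in> ?I. lam < ?s j}. lam powr q)" by simp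
  also have "\<dots> \<le> (\<Sum>j\<in>{j \<in> ?I. lam < ?s j}. ?s j powr q)"
    using lam q by (intro sum_mono powr_mono2) auto
  also have "\<dots> \<le> (\<Sum>j\<in>?I. ?s j powr q)" by (intro sum_mono2) auto
  finally have "real (card {j \<in> ?I. lam < ?s j}) * lam powr q \<le> R" using R by simp
  then show "real (card {j \<in> ?I. lam < ?s j}) \<le> lam powr (- q) * R"
    using lam by (simp add: powr_minus divide_simps mult.commute)
  have "?s j \<le> lam powr (1 - q) * ?s j powr q" if j: "j \<in> ?I" "\<not> lam < ?s j" for j
  proof (cases "?s j = 0")
    case False
    then have s: "0 < ?s j" using sing_val_nonneg[OF j(1)] by simp
    have "?s j = ?s j powr (1 - q) * ?s j powr q" using s by (simp flip: powr_add)
    also have "\<dots> \<le> lam powr (1 - q) * ?s j powr q"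
      using s j q by (intro mult_right_mono powr_mono2) auto
    finally show ?thesis .
  qed simp
  then have "(\<Sum>j\<in>{j \<in> ?I. \<not> lam < ?s j}. ?s j) \<le> (\<Sum>j\<in>{j \<in> ?I. \<not> lam < ?s j}. lam powr (1 - q) * ?s j powr q)"
    by (intro sum_mono) auto
  also have "\<dots> \<le> lam powr (1 - q) * (\<Sum>j\<in>?I. ?s j powr q)"
    unfolding sum_distrib_left[symmetric] by (intro mult_left_mono sum_mono2) auto
  also have "\<dots> \<le> lam powr (1 - q) * R" using R by (intro mult_left_mono) auto
  also have "lam powr (1 - q) * R = lam * (lam powr (- q) * R)"
    using lam powr_add[of lam 1 "- q"] by simp
  finally show "(\<Sum>j\<in>{j \<in> ?I. \<not> lam < ?s j}. ?s j) \<le> lam * (lam powr (- q) * R)" .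
qed

section \<open>Proximal gradient steps\<close>

lemma nonneg_of_small_linear:
  fixes a b :: real
  assumes "\<And>r. 0 < r \<Longrightarrow> r \<le> 1 \<Longrightarrow> 0 \<le> a + r * b"
  shows "0 \<le> a"
proof (rule ccontr)
  assume "\<not> 0 \<le> a"
  define B where "B = \<bar>b\<bar> + 1"
  have B: "0 < B" "b \<le> B" by (auto simp: B_def)
  define r where "r = min 1 (- a / (2 * B))"
  have r: "0 < r" "r \<le> 1" "r \<le> - a / (2 * B)"
    using \<open>\<not> 0 \<le> a\<close> B by (auto simp: r_def divide_neg_pos)
  have "r * b \<le> r * B" using r B by (intro mult_left_mono) auto
  also have "\<dots> \<le> - a / (2 * B) * B" using r B by (intro mult_right_mono) auto
  also have "\<dots> = - a / 2" using B by simp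
  finally show False using assms[OF r(1,2)] \<open>\<not> 0 \<le> a\<close> by linarith
qed

text \<open>
  Second differences over the parallelogram spanned by \<open>x / k\<close> and \<open>y / k\<close> are compared with
  the value at its centre; summing along \<open>x\<close> and letting \<open>k\<close> grow yields gradients.
\<close>

lemma gradient_difference_lower_bound:
  fixes f :: "'a::real_inner \<Rightarrow> real" and N :: "'a \<Rightarrow> real"
  assumes der: "\<And>X. (f has_derivative (\<lambda>H. g X \<bullet> H)) (at X)"
    and N: "\<And>c X. N (c *\<^sub>R X) = \<bar>c\<bar> * N X"
    and lower: "\<And>X Y. m * (norm (X - Y))\<^sup>2 - t * (N (X - Y))\<^sup>2 \<le> f X - f Y - g Y \<bullet> (X - Y)"
    and upper: "\<And>X Y. f X - f Y - g Y \<bullet> (X - Y) \<le> M * (norm (X - Y))\<^sup>2 + t * (N (X - Y))\<^sup>2"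
  shows "(m * (norm (x + y))\<^sup>2 - t * (N (x + y))\<^sup>2 - M * (norm (x - y))\<^sup>2 - t * (N (x - y))\<^sup>2) / 2
       \<le> (g (W + x) - g W) \<bullet> y"
proof -
  define E where "E x y = (m * (norm (x + y))\<^sup>2 - t * (N (x + y))\<^sup>2 - M * (norm (x - y))\<^sup>2 - t * (N (x - y))\<^sup>2) / 2" for x y
  have E_scale: "E (c *\<^sub>R x) (c *\<^sub>R y) = c\<^sup>2 * E x y" for c x y
    unfolding E_def scaleR_add_right[symmetric] scaleR_diff_right[symmetric] N norm_scaleR power_mult_distrib power2_abs
    by (simp add: field_simps)
  \<comment> \<open>At the centre the gradient terms of the four corners cancel. The diagonal
    \<open>x + y\<close> uses the lower curvature bound, the diagonal \<open>x - y\<close> the upper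
    one.\<close>
  have par: "E x y \<le> f (w + x + y) - f (w + x) - f (w + y) + f w" for w x y
  proof -
    define z where "z = w + (1/2) *\<^sub>R (x + y)"
    have d: "w + x + y - z = (1/2) *\<^sub>R (x + y)" "w - z = (-1/2) *\<^sub>R (x + y)"
      "w + x - z = (1/2) *\<^sub>R (x - y)" "w + y - z = (-1/2) *\<^sub>R (x - y)"
      by (simp_all add: z_def algebra_simps flip: scaleR_left.add)
    show ?thesis
      using lower[of "w + x + y" z] lower[of w z] upper[of "w + x" z] upper[of "w + y" z]
      unfolding d N E_def by (simp add: power_divide)
  qed
  have sum: "E x y \<le> real (Suc n) * ((f (W + x + (1 / Suc n) *\<^sub>R y) - f (W + x)) - (f (W + (1 / Suc n) *\<^sub>R y) - f W))" for n
  proof -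
    define k where "k = real (Suc n)"
    have k: "k > 0" by (simp add: k_def)
    define h where "h i = f (W + (real i / k) *\<^sub>R x + (1 / k) *\<^sub>R y) - f (W + (real i / k) *\<^sub>R x)" for i
    have "E x y / k\<^sup>2 \<le> h (Suc i) - h i" for i
    proof -
      have "E ((1/k) *\<^sub>R x) ((1/k) *\<^sub>R y) \<le> h (Suc i) - h i"
        using par[of "(1/k) *\<^sub>R x" "(1/k) *\<^sub>R y" "W + (real i / k) *\<^sub>R x"]
        by (simp add: h_def add_divide_distrib scaleR_add_left add_ac)
      then show ?thesis unfolding E_scale by (simp add: power_divide)
    qed
    then have "(\<Sum>i<Suc n. E x y / k\<^sup>2) \<le> (\<Sum>i<Suc n. h (Suc i) - h i)" by (rule sum_mono)
    also have "\<dots> = h (Suc n) - h 0" by (rule sum_lessThan_telescope)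
    finally have "k * (E x y / k\<^sup>2) \<le> h (Suc n) - h 0" by (simp add: k_def)
    then have "E x y \<le> k * (h (Suc n) - h 0)" using k by (simp add: power2_eq_square field_simps)
    then show ?thesis using k by (simp add: h_def k_def)
  qed
  have lim: "(\<lambda>n. real (Suc n) * (f (X + (1 / Suc n) *\<^sub>R y) - f X)) \<longlonglongrightarrow> g X \<bullet> y" for X
  proof -
    have "((\<lambda>s. f (X + s *\<^sub>R y)) has_derivative (\<lambda>s. g X \<bullet> (s *\<^sub>R y))) (at 0)"
      by (rule has_derivative_compose[of "\<lambda>s. X + s *\<^sub>R y" "\<lambda>s. s *\<^sub>R y" 0 UNIV f "\<lambda>H. g X \<bullet> H"])
        (auto intro!: derivative_eq_intros der)
    then have "((\<lambda>s. f (X + s *\<^sub>R y)) has_real_derivative (g X \<bullet> y)) (at 0)"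
      by (simp add: has_field_derivative_def mult.commute[of _ "g X \<bullet> y"])
    then have "((\<lambda>s. (f (X + s *\<^sub>R y) - f X) / s) \<longlongrightarrow> g X \<bullet> y) (at 0)"
      by (simp add: DERIV_def)
    moreover have "filterlim (\<lambda>n. 1 / real (Suc n)) (at 0) sequentially"
      using LIMSEQ_inverse_real_of_nat by (simp add: filterlim_at inverse_eq_divide)
    ultimately have "(\<lambda>n. (f (X + (1 / real (Suc n)) *\<^sub>R y) - f X) / (1 / real (Suc n))) \<longlonglongrightarrow> g X \<bullet> y"
      by (rule filterlim_compose)
    then show ?thesis by (simp add: mult.commute)
  qed
  have "(\<lambda>n. real (Suc n) * ((f (W + x + (1 / Suc n) *\<^sub>R y) - f (W + x)) - (f (W + (1 / Suc n) *\<^sub>R y) - f W)))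
      \<longlonglongrightarrow> g (W + x) \<bullet> y - g W \<bullet> y"
    unfolding right_diff_distrib[of "real (Suc _)" "_ - _"] by (intro tendsto_diff lim)
  then have "E x y \<le> g (W + x) \<bullet> y - g W \<bullet> y"
    using sum by (intro LIMSEQ_le_const[of _ _ "E x y"]) auto
  then show ?thesis by (simp add: E_def inner_diff_left)
qed

lemma feasible_convex:
  assumes "X \<in> feasible \<omega>" "Y \<in> feasible \<omega>" "0 \<le> r" "r \<le> 1"
  shows "X + r *\<^sub>R (Y - X) \<in> feasible \<omega>" and "nuc_norm (X + r *\<^sub>R (Y - X)) \<le> nuc_norm X + r * (nuc_norm Y - nuc_norm X)"
proof -
  have eq: "X + r *\<^sub>R (Y - X) = (1 - r) *\<^sub>R X + r *\<^sub>R Y" by (simp add: algebra_simps)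
  have "nuc_norm (X + r *\<^sub>R (Y - X)) \<le> (1 - r) * nuc_norm X + r * nuc_norm Y"
    unfolding eq using nuc_norm_triangle[of "(1 - r) *\<^sub>R X" "r *\<^sub>R Y"] assms by (simp add: nuc_norm_scaleR)
  moreover have "(1 - r) * nuc_norm X + r * nuc_norm Y \<le> (1 - r) * \<omega> + r * \<omega>"
    using assms by (intro add_mono mult_left_mono) (auto simp: feasible_def)
  ultimately show "X + r *\<^sub>R (Y - X) \<in> feasible \<omega>"
    "nuc_norm (X + r *\<^sub>R (Y - X)) \<le> nuc_norm X + r * (nuc_norm Y - nuc_norm X)"
    by (simp_all add: feasible_def algebra_simps)
qed

text \<open>First-order optimality of \<open>Z\<close> along the segment to \<open>W\<close>: the
  quadratic remainder carries an extra factor \<open>r\<close> and vanishes in the limit, and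
  polarization turns the inner product into squared distances.\<close>

lemma prox_three_point:
  fixes Y Z W :: "real^'n^'m"
  assumes min: "is_arg_min (prox_objective L lam p v Y) (\<lambda>X. X \<in> feasible \<omega>) Z"
    and W: "W \<in> feasible \<omega>" and v: "0 < v" and lam: "0 \<le> lam"
  shows "grad (smooth_part L lam p) Y \<bullet> (Z - W) + lam * (nuc_norm Z - nuc_norm W)
       + v / 2 * ((norm (Z - Y))\<^sup>2 + (norm (Z - W))\<^sup>2 - (norm (Y - W))\<^sup>2) \<le> 0"
proof -
  let ?g = "grad (smooth_part L lam p) Y"
  define c where "c = Y - (1 / v) *\<^sub>R ?g"
  have Z: "Z \<in> feasible \<omega>" and opt: "\<And>X. X \<in> feasible \<omega> \<Longrightarrow> prox_objective L lam p v Y Z \<le> prox_objective L lam p v Y X"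
    using min by (auto simp: is_arg_min_linorder)
  define d where "d = W - Z"
  have "0 \<le> ((Z - c) \<bullet> d + lam / v * (nuc_norm W - nuc_norm Z)) + r * ((norm d)\<^sup>2 / 2)" if r: "0 < r" "r \<le> 1" for r
  proof -
    have "prox_objective L lam p v Y Z \<le> prox_objective L lam p v Y (Z + r *\<^sub>R d)"
      using feasible_convex(1)[OF Z W, of r] r by (intro opt) (simp add: d_def)
    then have "(norm (Z - c))\<^sup>2 / 2 + lam / v * nuc_norm Z
        \<le> (norm (Z - c + r *\<^sub>R d))\<^sup>2 / 2 + lam / v * nuc_norm (Z + r *\<^sub>R d)"
      by (simp add: prox_objective_def frob_norm_eq_norm c_def add_diff_eq diff_add_eq)
    moreover have "(norm (Z - c + r *\<^sub>R d))\<^sup>2 = (norm (Z - c))\<^sup>2 + 2 * (r * ((Z - c) \<bullet> d)) + r * (r * (norm d)\<^sup>2)"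
      unfolding power2_norm_eq_inner
      by (simp add: inner_add_left inner_add_right inner_commute[of d "Z - c"] distrib_left)
    moreover have "lam / v * nuc_norm (Z + r *\<^sub>R d) \<le> lam / v * (nuc_norm Z + r * (nuc_norm W - nuc_norm Z))"
      using feasible_convex(2)[OF Z W, of r] r v lam unfolding d_def by (intro mult_left_mono) auto
    moreover have "lam / v * (nuc_norm Z + r * (nuc_norm W - nuc_norm Z)) = lam / v * nuc_norm Z + r * (lam / v * (nuc_norm W - nuc_norm Z))"
      by (simp only: distrib_left mult.left_commute)
    ultimately have "0 \<le> r * ((Z - c) \<bullet> d) + r * (lam / v * (nuc_norm W - nuc_norm Z)) + r * (r * (norm d)\<^sup>2) / 2"
      by linarith
    then have "0 \<le> r * (((Z - c) \<bullet> d + lam / v * (nuc_norm W - nuc_norm Z)) + r * ((norm d)\<^sup>2 / 2))"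
      by (simp only: distrib_left times_divide_eq_right)
    then show ?thesis using r by (simp add: zero_le_mult_iff)
  qed
  then have "0 \<le> (Z - c) \<bullet> d + lam / v * (nuc_norm W - nuc_norm Z)" by (rule nonneg_of_small_linear)
  then have "0 \<le> v * ((Z - c) \<bullet> d + lam / v * (nuc_norm W - nuc_norm Z))" using v by simp
  also have "\<dots> = v * ((Z - Y) \<bullet> d) + ?g \<bullet> d + lam * (nuc_norm W - nuc_norm Z)"
    using v by (simp add: c_def inner_diff_left inner_add_left distrib_left field_simps)
  also have "(Z - Y) \<bullet> d = ((norm (Y - W))\<^sup>2 - (norm (Z - Y))\<^sup>2 - (norm (Z - W))\<^sup>2) / 2"
    unfolding power2_norm_eq_inner by (simp add: d_def inner_diff_left inner_diff_right inner_commute)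
  finally show ?thesis by (simp add: d_def inner_diff_right field_simps)
qed

locale composite_problem =
  fixes L :: "real^'n^'m \<Rightarrow> real" and p :: "real \<Rightarrow> real" and That :: "real^'n^'m"
    and \<omega> lam \<mu> \<alpha>\<^sub>2 \<alpha>\<^sub>3 \<tau> v :: real
  assumes diff: "\<forall>X. L differentiable (at X)"
    and reg: "admissible_regularizer lam \<mu> p"
    and pos: "0 < \<omega>" "0 < lam" "0 < \<tau>" "0 < v"
    and rsc: "\<And>X Y. \<alpha>\<^sub>2 * (norm (X - Y))\<^sup>2 - \<tau> * (nuc_norm (X - Y))\<^sup>2 \<le> taylor_error L X Y"
    and rsm: "\<And>X Y. taylor_error L X Y \<le> \<alpha>\<^sub>3 * (norm (X - Y))\<^sup>2 + \<tau> * (nuc_norm (X - Y))\<^sup>2"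
    and That_feasible: "That \<in> feasible \<omega>"
    and That_minimal: "\<And>X. X \<in> feasible \<omega> \<Longrightarrow> objective L p That \<le> objective L p X"
    and step: "2 * \<alpha>\<^sub>3 \<le> v"
begin

definition gap :: "real^'n^'m \<Rightarrow> real" where
  "gap X = objective L p X - objective L p That"

abbreviation "f \<equiv> smooth_part L lam p"
abbreviation "D \<equiv> 2 * \<alpha>\<^sub>2 - \<mu>"

lemma gap_nonneg: "X \<in> feasible \<omega> \<Longrightarrow> 0 \<le> gap X"
  using That_minimal by (simp add: gap_def)

lemma taylor_lower: "D / 2 * (norm (X - Y))\<^sup>2 - \<tau> * (nuc_norm (X - Y))\<^sup>2 \<le> f X - f Y - grad f Y \<bullet> (X - Y)"
  using taylor_error_smooth_part(2)[OF reg diff, of X Y] rsc[of X Y]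
  by (simp add: taylor_error_def[of f] mat_inner_eq_inner field_simps)

lemma taylor_upper: "f X - f Y - grad f Y \<bullet> (X - Y) \<le> v / 2 * (norm (X - Y))\<^sup>2 + \<tau> * (nuc_norm (X - Y))\<^sup>2"
proof -
  have "\<alpha>\<^sub>3 * (norm (X - Y))\<^sup>2 \<le> v / 2 * (norm (X - Y))\<^sup>2" using step by (intro mult_right_mono) auto
  then show ?thesis
    using taylor_error_smooth_part(3)[OF reg diff, of X Y] rsm[of X Y]
    by (simp add: taylor_error_def[of f] mat_inner_eq_inner)
qed

lemma gap_eq: "gap X = f X - f That + lam * (nuc_norm X - nuc_norm That)"
  by (simp add: gap_def objective_def smooth_part_def spectral_sum_split[of p _ lam] algebra_simps)

text \<open>The gap with the smooth part replaced by its first-order model at \<open>That\<close>.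
  Unlike the gap it is convex in \<open>X\<close>; its nonnegativity is the first-order optimality
  of \<open>That\<close>.\<close>

definition linearized_gap :: "real^'n^'m \<Rightarrow> real" where
  "linearized_gap X = grad f That \<bullet> (X - That) + lam * (nuc_norm X - nuc_norm That)"

lemma gap_le_linearized_gap:
  assumes X: "X \<in> feasible \<omega>" and r: "0 < r" "r \<le> 1"
  shows "gap (That + r *\<^sub>R (X - That)) - r\<^sup>2 * (v / 2 * (norm (X - That))\<^sup>2 + \<tau> * (nuc_norm (X - That))\<^sup>2)
       \<le> r * linearized_gap X"
proof -
  let ?Z = "That + r *\<^sub>R (X - That)"
  have "lam * (nuc_norm ?Z - nuc_norm That) \<le> lam * (r * (nuc_norm X - nuc_norm That))"
    using feasible_convex(2)[OF That_feasible X, of r] r pos by (intro mult_left_mono) auto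
  moreover have "f ?Z - f That - r * (grad f That \<bullet> (X - That))
      \<le> v / 2 * (r\<^sup>2 * (norm (X - That))\<^sup>2) + \<tau> * (r\<^sup>2 * (nuc_norm (X - That))\<^sup>2)"
    using taylor_upper[of ?Z That] r
    by (simp add: nuc_norm_scaleR power_mult_distrib)
  ultimately show ?thesis
    unfolding gap_eq linearized_gap_def distrib_left by (simp add: mult.left_commute)
qed

lemma linearized_gap_nonneg:
  assumes X: "X \<in> feasible \<omega>"
  shows "0 \<le> linearized_gap X"
proof (rule nonneg_of_small_linear)
  fix r :: real assume r: "0 < r" "r \<le> 1"
  let ?B = "v / 2 * (norm (X - That))\<^sup>2 + \<tau> * (nuc_norm (X - That))\<^sup>2"
  have "0 \<le> gap (That + r *\<^sub>R (X - That))"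
    using feasible_convex(1)[OF That_feasible X, of r] r by (intro gap_nonneg) auto
  then have "0 \<le> r * (linearized_gap X + r * ?B)"
    using gap_le_linearized_gap[OF X r] by (simp add: distrib_left power2_eq_square)
  then show "0 \<le> linearized_gap X + r * ?B" using r by (simp add: zero_le_mult_iff)
qed

lemma gap_quadratic_growth:
  assumes "X \<in> feasible \<omega>"
  shows "D / 2 * (norm (X - That))\<^sup>2 - \<tau> * (nuc_norm (X - That))\<^sup>2 \<le> gap X"
  using taylor_lower[of X That] linearized_gap_nonneg[OF assms] by (simp add: gap_eq linearized_gap_def)

context
  fixes Y Z :: "real^'n^'m"
  assumes prox: "is_arg_min (prox_objective L lam p v Y) (\<lambda>X. X \<in> feasible \<omega>) Z"
begin

text \<open>The three-point inequality at \<open>W = That\<close>. Its term \<open>v / 2\<close>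
  times the squared step length absorbs the quadratic part of the smoothness error, as
  \<open>2 * \<alpha>\<^sub>3 \<le> v\<close>.\<close>

lemma prox_step_gap:
  "gap Z + v / 2 * (norm (Z - That))\<^sup>2
   \<le> v / 2 * (norm (Y - That))\<^sup>2 - D / 2 * (norm (Y - That))\<^sup>2
     + \<tau> * (nuc_norm (Y - That))\<^sup>2 + \<tau> * (nuc_norm (Y - That) + nuc_norm (Z - That))\<^sup>2"
proof -
  have "nuc_norm (Z - Y) \<le> nuc_norm (Y - That) + nuc_norm (Z - That)"
    using nuc_norm_diff_le[of "Z - That" "Y - That"] by simp
  then have "\<tau> * (nuc_norm (Z - Y))\<^sup>2 \<le> \<tau> * (nuc_norm (Y - That) + nuc_norm (Z - That))\<^sup>2"
    using pos nuc_norm_nonneg by (intro mult_left_mono power_mono) auto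
  then show ?thesis
    using prox_three_point[OF prox That_feasible pos(4) less_imp_le[OF pos(2)]]
      taylor_lower[of That Y] taylor_upper[of Z Y]
    by (simp add: gap_eq norm_minus_commute nuc_norm_minus_commute inner_diff_right algebra_simps)
qed

text \<open>The gradient at \<open>Y\<close> is split into the one at \<open>That\<close>, which
  makes up the linearized gap, and the difference, which the parallelogram bound controls; so
  curvature helps both at \<open>Y\<close> and at \<open>Z\<close>. The parameter \<open>b\<close>
  is capped at 1 because \<open>D / v\<close> can exceed 1, and the leftover multiple
  \<open>1 - b\<close> of the squared step must be nonnegative.\<close>

lemma prox_step_linearized_gap:
  fixes b :: real
  assumes b: "b \<le> 1" "v * b \<le> D"
  shows "linearized_gap Z + v / 2 * (1 + b) * (norm (Z - That))\<^sup>2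
       \<le> v / 2 * (1 - b) * (norm (Y - That))\<^sup>2 + \<tau> * (nuc_norm (Y - That) + nuc_norm (Z - That))\<^sup>2"
proof -
  define x where "x = Y - That"
  define y where "y = Z - That"
  have low: "v * b / 2 * (norm (X - Y))\<^sup>2 - \<tau> * (nuc_norm (X - Y))\<^sup>2 \<le> f X - f Y - grad f Y \<bullet> (X - Y)" for X Y
  proof -
    have "v * b / 2 * (norm (X - Y))\<^sup>2 \<le> D / 2 * (norm (X - Y))\<^sup>2" using b by (intro mult_right_mono) auto
    then show ?thesis using taylor_lower[of X Y] by linarith
  qed
  have "(v * b / 2 * (norm (x + y))\<^sup>2 - \<tau> * (nuc_norm (x + y))\<^sup>2
      - v / 2 * (norm (x - y))\<^sup>2 - \<tau> * (nuc_norm (x - y))\<^sup>2) / 2 \<le> (grad f (That + x) - grad f That) \<bullet> y"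
    by (rule gradient_difference_lower_bound[OF _ nuc_norm_scaleR low taylor_upper])
      (intro has_derivative_grad taylor_error_smooth_part(1)[OF reg diff])
  moreover have "\<tau> * (nuc_norm (x + y))\<^sup>2 \<le> \<tau> * (nuc_norm x + nuc_norm y)\<^sup>2"
    "\<tau> * (nuc_norm (x - y))\<^sup>2 \<le> \<tau> * (nuc_norm x + nuc_norm y)\<^sup>2"
    using pos nuc_norm_nonneg nuc_norm_triangle[of x y] nuc_norm_diff_le[of x y]
    by (auto intro!: mult_left_mono power_mono)
  moreover have "grad f (That + x) \<bullet> y + lam * (nuc_norm Z - nuc_norm That)
      + v / 2 * ((norm (x - y))\<^sup>2 + (norm y)\<^sup>2 - (norm x)\<^sup>2) \<le> 0"
    using prox_three_point[OF prox That_feasible pos(4) less_imp_le[OF pos(2)]]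
    by (simp add: x_def y_def norm_minus_commute)
  moreover have "v * b / 2 * (norm (x + y))\<^sup>2 = v * b / 2 * (2 * (norm x)\<^sup>2 + 2 * (norm y)\<^sup>2 - (norm (x - y))\<^sup>2)"
    unfolding power2_norm_eq_inner
    by (simp add: inner_diff_left inner_diff_right inner_add_left inner_add_right inner_commute)
  moreover have "0 \<le> v / 4 * (1 - b) * (norm (x - y))\<^sup>2" using b pos by simp
  ultimately show ?thesis
    unfolding linearized_gap_def x_def[symmetric] y_def[symmetric] inner_diff_left
    by (auto simp: field_simps)
qed

end

end

section \<open>The gap as a price for leaving the low-rank cone\<close>

locale low_rank_problem = composite_problem L p That \<omega> lam \<mu> \<alpha>\<^sub>2 \<alpha>\<^sub>3 \<tau> v
  for L :: "real^'n^'m \<Rightarrow> real" and p That \<omega> lam \<mu> \<alpha>\<^sub>2 \<alpha>\<^sub>3 \<tau> v +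
  fixes T :: "real^'n^'m" and q R :: real
  assumes T_ball: "T \<in> schatten_ball q R" and T_feasible: "T \<in> feasible \<omega>"
    and q: "0 \<le> q" "q \<le> 1" and R: "0 < R"
    and mu: "0 \<le> \<mu>" and curvature: "0 < D"
    and lam_ge: "4 * op_norm (grad L T) \<le> lam" "8 * \<omega> * \<tau> \<le> lam"
begin

text \<open>The effective rank: it bounds the number of singular values of \<open>T\<close> above
  \<open>lam\<close>, and \<open>lam * rho\<close> bounds the sum of the others.\<close>

definition rho :: real where "rho = lam powr (- q) * R"

definition large_part_rank :: nat where
  "large_part_rank = card {j \<in> {1..min_dim T}. lam < sing_val j T}"

definition eps :: real where "eps = stat_error q R lam That T"

text \<open>Built so that \<open>r * noise r X\<close> is \<open>noise 1\<close> at the point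
  \<open>That + r *\<^sub>R (X - That)\<close>: the first summand is homogeneous, the statistical
  error is not.\<close>

definition noise :: "real \<Rightarrow> real^'n^'m \<Rightarrow> real" where
  "noise r X = 4 * sqrt (2 * real large_part_rank) * norm (X - That) + eps / r"

lemma rho_pos: "0 < rho"
  using R pos by (simp add: rho_def)

lemma large_part_rank_le: "real large_part_rank \<le> rho"
  unfolding large_part_rank_def rho_def by (rule schatten_ball_large_part(1)[OF T_ball q pos(2)])

lemma eps_eq: "eps = 8 * (sqrt (2 * rho) * norm (That - T) + lam * rho)"
proof -
  have "lam powr (- q / 2) * R powr (1/2) = sqrt rho"
    using pos R by (simp add: rho_def powr_half_sqrt[symmetric] powr_mult powr_powr)
  moreover have "lam powr (1 - q / 2) * R powr (1/2) = lam * sqrt rho"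
    using pos R by (simp add: rho_def powr_half_sqrt[symmetric] powr_mult powr_powr diff_conv_add_uminus powr_add
        del: add_uminus_conv_diff)
  ultimately have "eps = 8 * sqrt rho * (sqrt 2 * norm (That - T) + lam * sqrt rho)"
    by (simp add: eps_def stat_error_def frob_norm_eq_norm)
  also have "\<dots> = 8 * (sqrt 2 * sqrt rho * norm (That - T) + lam * (sqrt rho * sqrt rho))"
    by (simp only: distrib_left mult_ac)
  finally show ?thesis using rho_pos by (simp add: real_sqrt_mult)
qed

lemma eps_pos: "0 < eps"
proof -
  have "0 \<le> sqrt (2 * rho) * norm (That - T)" "0 < lam * rho" using rho_pos pos by simp_all
  then show ?thesis unfolding eps_eq by (simp add: add_nonneg_pos)
qed

text \<open>The gap is at least the difference of objectives between \<open>X\<close> and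
  \<open>T\<close>. There the regularizer gains \<open>lam\<close> per unit of excess, and the
  gradient takes back at most a quarter of \<open>lam\<close> times the nuclear norm.\<close>

lemma gap_ge_away_from_parameter:
  assumes X: "X \<in> feasible \<omega>"
    and j: "sqrt (2 * real large_part_rank) * norm (X - T) + lam * rho \<le> j"
    and z: "z = nuc_norm (X - T) - 4 * j" "0 \<le> z"
  shows "z \<le> \<omega>" and "\<tau> * (6 * \<omega> * z - z\<^sup>2) \<le> gap X"
proof -
  define n where "n = (\<Sum>j\<in>{j \<in> {1..min_dim T}. \<not> lam < sing_val j T}. sing_val j T)"
  obtain N' N'' where N: "0 \<le> N'" "N' \<le> sqrt (2 * real large_part_rank) * norm (X - T)"
      "nuc_norm (X - T) \<le> N' + N''" "N'' \<le> nuc_norm X + n"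
      "spectral_sum p T + lam * N'' - lam * N' - 2 * lam * n - \<mu> / 2 * (norm (X - T))\<^sup>2 \<le> spectral_sum p X"
    using spectral_sum_restricted_lower_bound[OF reg pos(2), of T X, folded n_def large_part_rank_def] that by blast
  have n: "n \<le> lam * rho"
    unfolding n_def rho_def by (rule schatten_ball_large_part(2)[OF T_ball q pos(2)])
  have j0: "0 \<le> j" using j N(1,2) mult_pos_pos[OF pos(2) rho_pos] by linarith
  have nucX: "nuc_norm X \<le> \<omega>" using X by (simp add: feasible_def)
  have z_le: "z \<le> \<omega> - 3 * j" using N n j nucX z by linarith
  then show "z \<le> \<omega>" using j0 by linarith
  have "\<bar>grad L T \<bullet> (X - T)\<bar> \<le> op_norm (grad L T) * nuc_norm (X - T)" by (rule inner_le_op_norm_nuc_norm)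
  also have "\<dots> \<le> lam / 4 * nuc_norm (X - T)" using lam_ge nuc_norm_nonneg by (intro mult_right_mono) auto
  finally have g: "- (lam / 4 * nuc_norm (X - T)) \<le> grad L T \<bullet> (X - T)" by linarith
  have F: "\<mu> / 2 * (norm (X - T))\<^sup>2 \<le> \<alpha>\<^sub>2 * (norm (X - T))\<^sup>2" using curvature by (intro mult_right_mono) auto
  have "lam * nuc_norm (X - T) \<le> lam * (N' + N'')" "lam * (2 * N' + 2 * n) \<le> lam * (2 * j)"
    using pos N n j by (auto intro!: mult_left_mono)
  then have "lam * nuc_norm (X - T) - 2 * lam * j \<le> lam * N'' - lam * N' - 2 * lam * n"
    by (simp add: algebra_simps)
  then have "3 / 4 * (lam * nuc_norm (X - T)) - 2 * lam * j - \<tau> * (nuc_norm (X - T))\<^sup>2 \<le> gap X"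
    using N(5) g F rsc[of X T] That_minimal[OF T_feasible]
    by (simp add: gap_def objective_def taylor_error_def mat_inner_eq_inner)
  moreover have "3 / 4 * (lam * nuc_norm (X - T)) - 2 * lam * j = lam * (3 / 4 * z + j)"
    by (simp add: z algebra_simps)
  \<comment> \<open>Replacing \<open>lam\<close> by \<open>8 * \<omega> * \<tau>\<close> produces
    the coefficient \<open>6 = 8 * 3 / 4\<close>. What is left with \<open>j\<close> factors as
    \<open>8 * \<tau> * j * (\<omega> - z - 2 * j)\<close>, nonnegative since
    \<open>z \<le> \<omega> - 3 * j\<close>.\<close>
  moreover have "8 * \<omega> * \<tau> * (3 / 4 * z + j) \<le> lam * (3 / 4 * z + j)"
    using lam_ge z j0 by (intro mult_right_mono) auto
  moreover have "\<tau> * (nuc_norm (X - T))\<^sup>2 = \<tau> * (z\<^sup>2 + 8 * j * z + 16 * j\<^sup>2)"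
    by (simp add: z power2_eq_square algebra_simps)
  moreover have "0 \<le> 8 * (\<tau> * j * (\<omega> - z - 2 * j))"
    using pos j0 z_le by (intro mult_nonneg_nonneg) auto
  ultimately show "\<tau> * (6 * \<omega> * z - z\<^sup>2) \<le> gap X"
    by (simp add: algebra_simps power2_eq_square)
qed

lemma minimizer_cone: "nuc_norm (That - T) \<le> 4 * (sqrt (2 * real large_part_rank) * norm (That - T) + lam * rho)"
proof (rule ccontr)
  define z where "z = nuc_norm (That - T) - 4 * (sqrt (2 * real large_part_rank) * norm (That - T) + lam * rho)"
  assume "\<not> ?thesis"
  then have z: "0 < z" by (simp add: z_def)
  have "z \<le> \<omega>" "\<tau> * (6 * \<omega> * z - z\<^sup>2) \<le> 0"
    using gap_ge_away_from_parameter[OF That_feasible order_refl z_def] z by (auto simp: gap_def)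
  moreover have "0 < \<tau> * (z * (6 * \<omega> - z))" using z pos \<open>z \<le> \<omega>\<close> by (intro mult_pos_pos) auto
  ultimately show False by (simp add: power2_eq_square algebra_simps)
qed

text \<open>The reference point moves from \<open>T\<close> to \<open>That\<close>. The factor 8 in
  \<open>eps\<close> is twice 4: once for the cone bound at \<open>X\<close>, once for the cone
  bound at the minimizer. Passing from \<open>z'\<close> to the smaller \<open>z\<close> uses that
  \<open>6 * \<omega> * z - z^2\<close> increases there.\<close>

lemma gap_ge_away_from_minimizer:
  assumes X: "X \<in> feasible \<omega>" and z: "0 \<le> z" "z \<le> nuc_norm (X - That) - noise 1 X"
  shows "z \<le> \<omega>" and "\<tau> * (6 * \<omega> * z - z\<^sup>2) \<le> gap X"
proof -
  define s where "s = sqrt (2 * real large_part_rank)"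
  define j where "j = s * norm (X - T) + lam * rho"
  define z' where "z' = nuc_norm (X - T) - 4 * j"
  have s: "0 \<le> s" "s \<le> sqrt (2 * rho)" using large_part_rank_le by (auto simp: s_def)
  have "nuc_norm (X - That) \<le> nuc_norm (X - T) + nuc_norm (That - T)"
    using nuc_norm_diff_le[of "X - T" "That - T"] by simp
  moreover have "s * norm (X - T) \<le> s * (norm (X - That) + norm (That - T))"
    using s norm_triangle_ineq[of "X - That" "That - T"] by (intro mult_left_mono) auto
  moreover have "s * norm (That - T) \<le> sqrt (2 * rho) * norm (That - T)"
    using s by (intro mult_right_mono) auto
  ultimately have zz': "z \<le> z'"
    using z minimizer_cone unfolding z'_def j_def noise_def eps_eq s_def[symmetric] distrib_left mult.assoc div_by_1 by linarith
  have *: "z' \<le> \<omega>" "\<tau> * (6 * \<omega> * z' - z'\<^sup>2) \<le> gap X"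
    using gap_ge_away_from_parameter[OF X order_refl z'_def[unfolded j_def s_def]] z zz' by auto
  then show "z \<le> \<omega>" using zz' by simp
  have "0 \<le> \<tau> * ((z' - z) * (6 * \<omega> - z' - z))" using * zz' z pos by (intro mult_nonneg_nonneg) auto
  then show "\<tau> * (6 * \<omega> * z - z\<^sup>2) \<le> gap X" using * by (simp add: algebra_simps power2_eq_square)
qed

end

section \<open>The scaled recursion\<close>

text \<open>
  With \<open>a = (2\<alpha>\<^sub>2 - \<mu>) / (4 v)\<close>, the sequences are \<open>f = v |\<Theta>\<^sub>s - That|\<^sup>2 / (2 \<tau> \<omega>\<^sup>2)\<close>, \<open>N\<close> the nuclear norm of
  \<open>\<Theta>\<^sub>s - That\<close> over \<open>\<omega>\<close>, and \<open>G\<close> the gap over \<open>\<tau> \<omega>\<^sup>2\<close>.  In \<open>m r s\<close> the statistical error is divided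
  by \<open>r\<close>, because the cone condition is applied at the point \<open>That + r (\<Theta>\<^sub>s - That)\<close>.
\<close>

locale scaled_recursion =
  fixes f N G :: "nat \<Rightarrow> real" and m :: "real \<Rightarrow> nat \<Rightarrow> real" and a \<Delta> \<kappa> P :: real
  assumes a: "0 < a" "a \<le> 1" and \<Delta>: "0 < \<Delta>" and \<kappa>: "1 - a / 2 \<le> \<kappa>" "\<kappa> < 1"
    and f_nonneg: "0 \<le> f s" and N_nonneg: "0 \<le> N s" and G_nonneg: "0 \<le> G s"
    and m_nonneg: "0 < r \<Longrightarrow> 0 \<le> m r s"
    and gap_step: "f (Suc s) + G (Suc s) \<le> (1 - 4 * a) * f s + (N s)\<^sup>2 + (N s + N (Suc s))\<^sup>2"
    and growth: "4 * a * f s \<le> G s + (N s)\<^sup>2"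
    and linear_step: "0 < r \<Longrightarrow> r \<le> 1 \<Longrightarrow> b \<le> 1 \<Longrightarrow> b \<le> 4 * a \<Longrightarrow>
      (1 + b - r) * f (Suc s) + 6 * max 0 (N (Suc s) - m r (Suc s)) - 2 * r * (N (Suc s))\<^sup>2
        \<le> (1 - b) * f s + (N s + N (Suc s))\<^sup>2"
    and noise: "0 < r \<Longrightarrow> r \<le> 1 \<Longrightarrow> (m r s)\<^sup>2 \<le> P * f s + a * \<Delta> / 160 / r\<^sup>2"
    and cone: "0 < r \<Longrightarrow> r \<le> 1 \<Longrightarrow> 0 \<le> z \<Longrightarrow> z \<le> N s - m r s \<Longrightarrow> z \<le> 1 \<and> 6 * z - z\<^sup>2 \<le> G s"
    and P: "0 \<le> P" "P \<le> a\<^sup>2 / 8"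
    and large_P: "3 / 10 \<le> a \<Longrightarrow> P = 0"
    and large_N: "3 / 10 \<le> a \<Longrightarrow> 2 * (a - 1 / 4) * f s \<le> (N s)\<^sup>2"

lemma square_sum_le:
  fixes x y \<theta> :: real
  assumes \<theta>: "0 < \<theta>" and N: "0 \<le> N" "N \<le> x + y"
  shows "N\<^sup>2 \<le> (1 + \<theta>) * x\<^sup>2 + (1 + 1 / \<theta>) * y\<^sup>2"
proof -
  have "0 \<le> (\<theta> * x - y)\<^sup>2 / \<theta>" using \<theta> by simp
  also have "\<dots> = \<theta> * x\<^sup>2 + 1 / \<theta> * y\<^sup>2 - 2 * x * y"
    using \<theta> by (simp add: field_simps power2_eq_square)
  finally have "(x + y)\<^sup>2 \<le> (1 + \<theta>) * x\<^sup>2 + (1 + 1 / \<theta>) * y\<^sup>2" by (simp add: power2_sum algebra_simps)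
  moreover have "N\<^sup>2 \<le> (x + y)\<^sup>2" using N by (intro power_mono)
  ultimately show ?thesis by linarith
qed

text \<open>A concave quadratic lies above its chord, so checking an interval reduces to its two end
  points.\<close>

lemma concave_quadratic_pos:
  fixes c0 c1 c2 x y0 y1 :: real
  assumes "0 \<le> c2" "y0 \<le> x" "x \<le> y1" "0 < c0 + c1 * y0 - c2 * y0\<^sup>2" "0 < c0 + c1 * y1 - c2 * y1\<^sup>2"
  shows "0 < c0 + c1 * x - c2 * x\<^sup>2"
proof (cases "y0 = y1")
  case True
  then show ?thesis using assms by (metis antisym)
next
  case False
  then have d: "0 < y1 - y0" using assms by linarith
  have "(y1 - y0) * (c0 + c1 * x - c2 * x\<^sup>2) = (y1 - x) * (c0 + c1 * y0 - c2 * y0\<^sup>2)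
      + (x - y0) * (c0 + c1 * y1 - c2 * y1\<^sup>2) + c2 * ((x - y0) * (y1 - x) * (y1 - y0))"
    by (simp add: algebra_simps power2_eq_square)
  moreover have "0 \<le> c2 * ((x - y0) * (y1 - x) * (y1 - y0))" using assms d by simp
  moreover have "0 < (y1 - x) * (c0 + c1 * y0 - c2 * y0\<^sup>2) + (x - y0) * (c0 + c1 * y1 - c2 * y1\<^sup>2)"
  proof (cases "x = y1")
    case True
    then show ?thesis using assms d by simp
  next
    case False
    then show ?thesis using assms by (intro add_pos_nonneg mult_pos_pos mult_nonneg_nonneg) auto
  qed
  ultimately have "0 < (y1 - y0) * (c0 + c1 * x - c2 * x\<^sup>2)" by linarith
  then show ?thesis using d by (simp add: zero_less_mult_iff)
qed

lemma linear_recursion_bound: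
  fixes u :: "nat \<Rightarrow> real"
  assumes step: "\<And>s. u (Suc s) \<le> \<rho> * u s + (1 - \<rho>) * c" and "0 \<le> \<rho>" and init: "u 0 \<le> i + c"
  shows "u s \<le> \<rho> ^ s * i + c"
proof (induction s)
  case 0
  then show ?case using init by simp
next
  case (Suc s)
  have "u (Suc s) \<le> \<rho> * (\<rho> ^ s * i + c) + (1 - \<rho>) * c"
    using step[of s] mult_left_mono[OF Suc \<open>0 \<le> \<rho>\<close>] by linarith
  also have "\<dots> = \<rho> ^ Suc s * i + c" by (simp add: algebra_simps)
  finally show ?case .
qed

context scaled_recursion begin

definition z :: "real \<Rightarrow> nat \<Rightarrow> real" where "z r s = max 0 (N s - m r s)"

lemma z:
  assumes "0 < r" "r \<le> 1"
  shows "0 \<le> z r s" "z r s \<le> 1" "N s \<le> z r s + m r s" "6 * z r s - (z r s)\<^sup>2 \<le> G s" "5 * (z r s)\<^sup>2 \<le> G s"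
    "(z r s)\<^sup>2 \<le> z r s"
proof -
  show 0: "0 \<le> z r s" "N s \<le> z r s + m r s" by (auto simp: z_def)
  have "z r s \<le> 1 \<and> 6 * z r s - (z r s)\<^sup>2 \<le> G s"
    using cone[OF assms, of "z r s" s] G_nonneg[of s] by (cases "N s - m r s \<ge> 0") (auto simp: z_def)
  then show 1: "z r s \<le> 1" "6 * z r s - (z r s)\<^sup>2 \<le> G s" by auto
  show 2: "(z r s)\<^sup>2 \<le> z r s" using 0 1 by (simp add: power2_eq_square mult_left_le)
  show "5 * (z r s)\<^sup>2 \<le> G s" using 1 2 by auto
qed

lemma Pf_le: "P * f s \<le> a\<^sup>2 / 8 * f s"
  using P f_nonneg by (intro mult_right_mono) auto

lemma noise_le: "0 < r \<Longrightarrow> r \<le> 1 \<Longrightarrow> (m r s)\<^sup>2 \<le> a\<^sup>2 / 8 * f s + a * \<Delta> / 160 / r\<^sup>2"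
  using noise Pf_le by (meson add_right_mono order_trans)

text \<open>Quadratic growth at the starting point; with the weight 1/4 the excess costs
  \<open>5/4 * z^2\<close>, at most a quarter of the gap. The second claim settles iteration
  0.\<close>

lemma initial_distance:
  shows "a \<le> 3 / 10 \<Longrightarrow> 2 * a * f 0 \<le> 33 / 50 * G 0 + a * \<Delta> / 50"
    and "G 0 \<le> \<Delta> \<Longrightarrow> 2 * a * f 0 \<le> \<Delta>"
proof -
  have "(N 0)\<^sup>2 \<le> (1 + 1 / 4) * (z 1 0)\<^sup>2 + (1 + 1 / (1 / 4)) * (m 1 0)\<^sup>2"
    using N_nonneg z(3)[of 1 0] by (intro square_sum_le) auto
  then have "4 * a * f 0 \<le> 5 / 4 * G 0 + 5 * (a\<^sup>2 / 8 * f 0) + a * \<Delta> / 32"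
    using growth[of 0] z(5)[of 1 0] noise_le[of 1 0] by simp
  then have *: "(4 - 5 / 8 * a) * (a * f 0) \<le> 5 / 4 * G 0 + a * \<Delta> / 32"
    by (simp add: algebra_simps power2_eq_square)
  have af: "0 \<le> a * f 0" using a f_nonneg by simp
  {
    assume "a \<le> 3 / 10"
    then have "61 / 16 * (a * f 0) \<le> (4 - 5 / 8 * a) * (a * f 0)" using af by (intro mult_right_mono) auto
    then show "2 * a * f 0 \<le> 33 / 50 * G 0 + a * \<Delta> / 50"
      using * G_nonneg[of 0] mult_pos_pos[OF a(1) \<Delta>] by simp
  }
  {
    assume "G 0 \<le> \<Delta>"
    have "27 / 8 * (a * f 0) \<le> (4 - 5 / 8 * a) * (a * f 0)" using a af by (intro mult_right_mono) auto
    moreover have "a * \<Delta> \<le> 1 * \<Delta>" using a \<Delta> by (intro mult_right_mono) auto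
    ultimately show "2 * a * f 0 \<le> \<Delta>" using * \<open>G 0 \<le> \<Delta>\<close> \<Delta> by linarith
  }
qed

text \<open>\<open>k * \<Delta>\<close> is the stationary level of the recursion. The first step
  starts from quantities bounded by the initial gap, so only \<open>\<kappa> ^ t\<close> is
  available where the hypothesis has \<open>\<kappa> ^ Suc t\<close>; \<open>c\<close>, at least
  \<open>1 / \<kappa>\<close>, repairs this. \<open>final\<close> adds the shares of the decayed
  gap, of the noise in the initial distance and of the stationary level.\<close>

lemma distance_le_of_recursion:
  fixes A B \<beta> \<gamma> k \<rho> c K :: real and Z :: "nat \<Rightarrow> real"
  assumes a_le: "a \<le> 3 / 10"
    and step: "\<And>s. A * f (Suc s) + \<beta> * (Z (Suc s))\<^sup>2 \<le> B * f s + \<gamma> * (Z s)\<^sup>2 + K"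
    and Z0: "5 * (Z 0)\<^sup>2 \<le> G 0"
    and t: "\<kappa> ^ Suc t * G 0 \<le> \<Delta>"
    and nonneg: "0 \<le> A" "0 \<le> \<beta>" "0 \<le> B" "0 \<le> \<gamma>" "0 \<le> k"
    and \<rho>: "0 \<le> \<rho>" "\<rho> < 1" "\<rho> \<le> \<kappa>" "B \<le> \<rho> * A" "\<gamma> \<le> \<rho> * \<beta>"
    and K: "0 \<le> K" "K \<le> (1 - \<rho>) * (k * \<Delta>)"
    and c: "0 \<le> c" "1 \<le> c * (1 - a / 2)"
    and final: "c * (33 / 50 * B + 2 / 5 * (a * \<gamma>)) + a * B / 50 + 2 * (a * k) < A"
  shows "2 * a * f (Suc t) \<le> \<Delta>"
proof -
  define u where "u s = A * f (Suc s) + \<beta> * (Z (Suc s))\<^sup>2" for s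
  define I where "I = B * f 0 + \<gamma> * (Z 0)\<^sup>2"
  have "u t \<le> \<rho> ^ t * I + k * \<Delta>"
  proof (rule linear_recursion_bound[OF _ \<rho>(1)])
    fix s
    have "B * f (Suc s) \<le> \<rho> * A * f (Suc s)" "\<gamma> * (Z (Suc s))\<^sup>2 \<le> \<rho> * \<beta> * (Z (Suc s))\<^sup>2"
      using \<rho> f_nonneg by (auto intro!: mult_right_mono)
    then have "B * f (Suc s) + \<gamma> * (Z (Suc s))\<^sup>2 \<le> \<rho> * u s"
      by (simp only: u_def distrib_left mult.assoc)
    then show "u (Suc s) \<le> \<rho> * u s + (1 - \<rho>) * (k * \<Delta>)"
      using step[of "Suc s"] K by (simp add: u_def)
    have "(1 - \<rho>) * (k * \<Delta>) \<le> 1 * (k * \<Delta>)" using \<rho> nonneg \<Delta> by (intro mult_right_mono) auto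
    then show "u 0 \<le> I + k * \<Delta>" using step[of 0] K by (simp add: u_def I_def)
  qed
  moreover have I: "0 \<le> I" using nonneg f_nonneg by (simp add: I_def)
  then have "\<rho> ^ t * I \<le> \<kappa> ^ t * I" using \<rho> by (intro mult_right_mono power_mono) auto
  moreover have "A * f (Suc t) \<le> u t" using nonneg by (simp add: u_def)
  ultimately have "A * f (Suc t) \<le> \<kappa> ^ t * I + k * \<Delta>" by linarith
  then have "2 * a * (A * f (Suc t)) \<le> 2 * a * (\<kappa> ^ t * I + k * \<Delta>)" using a by (intro mult_left_mono) auto
  then have main: "2 * a * (A * f (Suc t)) \<le> \<kappa> ^ t * (2 * a * I) + 2 * (a * k) * \<Delta>"
    by (simp add: algebra_simps)
  have \<kappa>0: "0 \<le> \<kappa>" "\<kappa> ^ t \<le> 1" using \<rho> \<kappa> by (auto intro: power_le_one)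
  have "B * (2 * a * f 0) \<le> B * (33 / 50 * G 0 + a * \<Delta> / 50)"
    using initial_distance(1)[OF a_le] nonneg by (intro mult_left_mono) auto
  moreover have "2 / 5 * (a * \<gamma>) * (5 * (Z 0)\<^sup>2) \<le> 2 / 5 * (a * \<gamma>) * G 0"
    by (rule mult_left_mono[OF Z0]) (use a nonneg in simp)
  ultimately have "2 * a * I \<le> (33 / 50 * B + 2 / 5 * (a * \<gamma>)) * G 0 + a * B / 50 * \<Delta>"
    by (simp add: I_def algebra_simps)
  then have "\<kappa> ^ t * (2 * a * I) \<le> \<kappa> ^ t * ((33 / 50 * B + 2 / 5 * (a * \<gamma>)) * G 0 + a * B / 50 * \<Delta>)"
    using \<kappa>0 by (intro mult_left_mono) auto
  also have "\<dots> = (33 / 50 * B + 2 / 5 * (a * \<gamma>)) * (\<kappa> ^ t * G 0) + \<kappa> ^ t * (a * B / 50 * \<Delta>)"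
    by (simp add: algebra_simps)
  also have "\<kappa> ^ t * (a * B / 50 * \<Delta>) \<le> 1 * (a * B / 50 * \<Delta>)"
    using \<kappa>0 nonneg a \<Delta> by (intro mult_right_mono) auto
  also have "\<kappa> ^ t * G 0 \<le> c * \<Delta>"
  proof -
    have "1 \<le> c * \<kappa>" using c \<kappa> mult_left_mono[of "1 - a / 2" \<kappa> c] by linarith
    then have "1 * (\<kappa> ^ t * G 0) \<le> c * \<kappa> * (\<kappa> ^ t * G 0)" using \<kappa>0 G_nonneg by (intro mult_right_mono) auto
    also have "\<dots> = c * (\<kappa> ^ Suc t * G 0)" by simp
    also have "\<dots> \<le> c * \<Delta>" using t c by (intro mult_left_mono) auto
    finally show ?thesis by simp
  qed
  finally have "\<kappa> ^ t * (2 * a * I) \<le> (33 / 50 * B + 2 / 5 * (a * \<gamma>)) * (c * \<Delta>) + 1 * (a * B / 50 * \<Delta>)"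
    using nonneg a by (simp add: mult_left_mono)
  with main have "A * (2 * a * f (Suc t)) \<le> (c * (33 / 50 * B + 2 / 5 * (a * \<gamma>)) + a * B / 50 + 2 * (a * k)) * \<Delta>"
    by (simp add: algebra_simps)
  also have "\<dots> \<le> A * \<Delta>" using final \<Delta> by (intro mult_right_mono) auto
  finally have *: "A * (2 * a * f (Suc t)) \<le> A * \<Delta>" .
  have "0 \<le> c * (33 / 50 * B + 2 / 5 * (a * \<gamma>)) + a * B / 50 + 2 * (a * k)" using c a nonneg by simp
  then have "0 < A" using final by linarith
  then show ?thesis using * by (simp add: mult_le_cancel_left)
qed


text \<open>The linearized inequality with \<open>N \<le> z + m\<close> inserted. The weight
  \<theta> separates excess from noise: a small \<theta> spares the excess and inflates the
  noise.\<close>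

lemma step_medium:
  fixes r \<theta> b :: real
  assumes r: "0 < r" "r \<le> 1" and \<theta>: "0 < \<theta>" and b: "b \<le> 1" "b \<le> 4 * a"
  shows "(1 + b - r) * f (Suc s) + 6 * z r (Suc s)
    \<le> (1 - b) * f s + (1 + \<theta>) * ((z r s + z r (Suc s))\<^sup>2 + 2 * r * (z r (Suc s))\<^sup>2)
      + (1 + 1 / \<theta>) * (2 * (a\<^sup>2 / 8 * f s) + (2 + 2 * r) * (a\<^sup>2 / 8 * f (Suc s))
          + (4 + 2 * r) * (a * \<Delta> / 160 / r\<^sup>2))"
proof -
  let ?m = "m r s" and ?m' = "m r (Suc s)" and ?z = "z r s" and ?z' = "z r (Suc s)"
  have N: "N s \<le> ?z + ?m" "N (Suc s) \<le> ?z' + ?m'" using z(3)[OF r] by auto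
  have "(N s + N (Suc s))\<^sup>2 \<le> (1 + \<theta>) * (?z + ?z')\<^sup>2 + (1 + 1 / \<theta>) * (?m + ?m')\<^sup>2"
    using N N_nonneg by (intro square_sum_le \<theta>) auto
  moreover have "2 * r * (N (Suc s))\<^sup>2 \<le> 2 * r * ((1 + \<theta>) * ?z'\<^sup>2 + (1 + 1 / \<theta>) * ?m'\<^sup>2)"
    using N N_nonneg r by (intro mult_left_mono square_sum_le \<theta>) auto
  moreover have "(1 + 1 / \<theta>) * ((?m + ?m')\<^sup>2 + 2 * r * ?m'\<^sup>2)
      \<le> (1 + 1 / \<theta>) * (2 * (a\<^sup>2 / 8 * f s) + (2 + 2 * r) * (a\<^sup>2 / 8 * f (Suc s)) + (4 + 2 * r) * (a * \<Delta> / 160 / r\<^sup>2))"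
  proof (intro mult_left_mono)
    have "(?m + ?m')\<^sup>2 \<le> 2 * ?m\<^sup>2 + 2 * ?m'\<^sup>2"
      using zero_le_power2[of "?m - ?m'"] by (simp add: power2_sum power2_diff)
    moreover have "2 * r * ?m'\<^sup>2 \<le> 2 * r * (a\<^sup>2 / 8 * f (Suc s) + a * \<Delta> / 160 / r\<^sup>2)"
      using noise_le[OF r] r by (intro mult_left_mono) auto
    ultimately show "(?m + ?m')\<^sup>2 + 2 * r * ?m'\<^sup>2
        \<le> 2 * (a\<^sup>2 / 8 * f s) + (2 + 2 * r) * (a\<^sup>2 / 8 * f (Suc s)) + (4 + 2 * r) * (a * \<Delta> / 160 / r\<^sup>2)"
      unfolding distrib_left distrib_right using noise_le[OF r, of s] noise_le[OF r, of "Suc s"] by linarith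
  qed (use \<theta> in auto)
  ultimately show ?thesis
    using linear_step[OF r b, of s] unfolding z_def[symmetric] distrib_left by (simp only: mult_ac)
qed

text \<open>\<open>A\<close>, \<open>B\<close> and \<open>K\<close> are the coefficients of the
  medium step at \<open>r = 1/5\<close>, \<open>\<theta> = 1/4\<close>, \<open>b = 4 * a\<close>. Of
  the 6 units paid per excess, \<open>5/2\<close> go to the mixed product and \<open>7/4\<close> to
  the squares, which leaves \<open>\<beta> = 7/4\<close>. Here \<open>k * \<Delta>\<close> is
  \<open>K / (2 * a)\<close>, and \<open>16/15\<close> is \<open>1 / (1 - a / 2)\<close> at
  \<open>a = 1/8\<close>.\<close>

lemma distance_le_medium1:
  assumes a': "1 / 24 \<le> a" "a \<le> 1 / 8" and t: "\<kappa> ^ Suc t * G 0 \<le> \<Delta>"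
  shows "2 * a * f (Suc t) \<le> \<Delta>"
proof (rule distance_le_of_recursion[where Z = "z (1/5)" and A = "4/5 + 4 * a - 3/2 * a\<^sup>2" and B = "1 - 4 * a + 5/4 * a\<^sup>2"
      and \<beta> = "7/4" and \<gamma> = "5/4" and \<rho> = "1 - 2 * a" and k = "55/32" and K = "55/16 * a * \<Delta>" and c = "16/15", OF _ _ _ t])
  fix s
  let ?z = "z (1/5) s" and ?z' = "z (1/5) (Suc s)"
  have zz: "0 \<le> ?z" "0 \<le> ?z'" "?z \<le> 1" "?z'\<^sup>2 \<le> ?z'" using z[of "1/5"] by auto
  have "?z * ?z' \<le> 1 * ?z'" using zz by (intro mult_right_mono) auto
  then have "7/4 * ?z'\<^sup>2 + 5/4 * ((?z + ?z')\<^sup>2 + 2/5 * ?z'\<^sup>2) \<le> 6 * ?z' + 5/4 * ?z\<^sup>2"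
    using zz by (simp add: power2_sum field_simps)
  then show "(4/5 + 4 * a - 3/2 * a\<^sup>2) * f (Suc s) + 7/4 * ?z'\<^sup>2
      \<le> (1 - 4 * a + 5/4 * a\<^sup>2) * f s + 5/4 * ?z\<^sup>2 + 55/16 * a * \<Delta>"
    using step_medium[of "1/5" "1/4" "4 * a" s] a' by (simp add: algebra_simps power2_eq_square[of "1/5::real"])
next
  have a2: "0 \<le> (a - 1/24) * (1/8 - a)" "0 \<le> a * a * (1/8 - a)" "0 \<le> a * a" using a' by auto
  show "5 * (z (1/5) 0)\<^sup>2 \<le> G 0" using z(5)[of "1/5" 0] by simp
  show "1 - 4 * a + 5/4 * a\<^sup>2 \<le> (1 - 2 * a) * (4/5 + 4 * a - 3/2 * a\<^sup>2)"
  proof -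
    have "(1 - 2 * a) * (4/5 + 4 * a - 3/2 * a\<^sup>2) = 4/5 + 12/5 * a - 19/2 * a\<^sup>2 + 3 * a ^ 3"
      by algebra
    moreover have "a\<^sup>2 \<le> a / 6 - 1 / 192" using a2(1) by (simp add: field_simps power2_eq_square)
    moreover have "0 \<le> a ^ 3" using a by simp
    ultimately show ?thesis using a' by linarith
  qed
  show "16/15 * (33 / 50 * (1 - 4 * a + 5/4 * a\<^sup>2) + 2 / 5 * (a * (5/4))) + a * (1 - 4 * a + 5/4 * a\<^sup>2) / 50 + 2 * (a * (55/32))
      < 4/5 + 4 * a - 3/2 * a\<^sup>2"
  proof -
    have s: "a\<^sup>2 \<le> a / 6 - 1 / 192" using a2(1) by (simp add: field_simps power2_eq_square)
    have "a * (1 - 4 * a + 5/4 * a\<^sup>2) \<le> a * 1" using a' s by (intro mult_left_mono) auto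
    then have "a * (1 - 4 * a + 5/4 * a\<^sup>2) / 50 \<le> a / 50" by simp
    moreover have "16/15 * (33 / 50 * (1 - 4 * a + 5/4 * a\<^sup>2) + 2 / 5 * (a * (5/4))) + a / 50 + 2 * (a * (55/32))
        < 4/5 + 4 * a - 3/2 * a\<^sup>2" using a' s by argo
    ultimately show ?thesis by linarith
  qed
  have "a\<^sup>2 \<le> a / 6 - 1 / 192" using a2(1) by (simp add: field_simps power2_eq_square)
  then show "0 \<le> 4/5 + 4 * a - 3/2 * a\<^sup>2" "0 \<le> 1 - 4 * a + 5/4 * a\<^sup>2" using a' zero_le_power2[of a] by auto
qed (use a' \<kappa> \<Delta> in auto)

text \<open>The medium step at \<open>r = 2/5\<close>, \<open>\<theta> = 1/7\<close>: more curvature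
  affords a larger \<open>r\<close> and hence less noise. \<open>b\<close> stops at 1 once
  \<open>a\<close> passes 1/4. The rate \<open>143/200\<close> lies just above
  \<open>\<gamma> / \<beta> = 5/7\<close>.\<close>

lemma distance_le_medium2:
  assumes a': "1 / 8 \<le> a" "a \<le> 3 / 10" and t: "\<kappa> ^ Suc t * G 0 \<le> \<Delta>"
  shows "2 * a * f (Suc t) \<le> \<Delta>"
proof -
  define b where "b = min (4 * a) 1"
  have b: "b \<le> 1" "b \<le> 4 * a" "(b = 4 * a \<and> a \<le> 1/4) \<or> (b = 1 \<and> 1/4 \<le> a)" by (auto simp: b_def)
  have "0 \<le> (a - 1/8) * (3/10 - a)" using a' by simp
  then have a2: "a\<^sup>2 \<le> 17/40 * a - 3/80" by (simp add: field_simps power2_eq_square)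
  show ?thesis
  proof (rule distance_le_of_recursion[where Z = "z (2/5)" and A = "3/5 + b - 14/5 * a\<^sup>2" and B = "1 - b + 2 * a\<^sup>2"
      and \<beta> = "8/5" and \<gamma> = "8/7" and \<rho> = "143/200" and k = "300/57 * a" and K = "3/2 * a * \<Delta>" and c = "20/17", OF _ _ _ t])
    fix s
    let ?z = "z (2/5) s" and ?z' = "z (2/5) (Suc s)"
    have zz: "0 \<le> ?z" "0 \<le> ?z'" "?z \<le> 1" "?z'\<^sup>2 \<le> ?z'" using z[of "2/5"] by auto
    have "?z * ?z' \<le> 1 * ?z'" using zz by (intro mult_right_mono) auto
    then have "8/5 * ?z'\<^sup>2 + 8/7 * ((?z + ?z')\<^sup>2 + 4/5 * ?z'\<^sup>2) \<le> 6 * ?z' + 8/7 * ?z\<^sup>2"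
      using zz by (simp add: power2_sum field_simps)
    then show "(3/5 + b - 14/5 * a\<^sup>2) * f (Suc s) + 8/5 * ?z'\<^sup>2
        \<le> (1 - b + 2 * a\<^sup>2) * f s + 8/7 * ?z\<^sup>2 + 3/2 * a * \<Delta>"
      using step_medium[of "2/5" "1/7" b s] b by (simp add: algebra_simps power2_eq_square[of "2/5::real"])
  next
    show "5 * (z (2/5) 0)\<^sup>2 \<le> G 0" using z(5)[of "2/5" 0] by simp
    show "1 - b + 2 * a\<^sup>2 \<le> 143/200 * (3/5 + b - 14/5 * a\<^sup>2)"
      using b(3) a' a2 by auto
    show "20/17 * (33 / 50 * (1 - b + 2 * a\<^sup>2) + 2 / 5 * (a * (8/7))) + a * (1 - b + 2 * a\<^sup>2) / 50 + 2 * (a * (300/57 * a))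
        < 3/5 + b - 14/5 * a\<^sup>2"
    proof -
      have "a * (1 - b + 2 * a\<^sup>2) \<le> a * 1" using b(3) a' a2 by (intro mult_left_mono) auto
      then have "a * (1 - b + 2 * a\<^sup>2) / 50 \<le> a / 50" by simp
      moreover have "2 * (a * (300/57 * a)) = 600/57 * a\<^sup>2" by (simp add: power2_eq_square)
      moreover have "20/17 * (33 / 50 * (1 - b + 2 * a\<^sup>2) + 2 / 5 * (a * (8/7))) + a / 50 + 600/57 * a\<^sup>2 < 3/5 + b - 14/5 * a\<^sup>2"
        using b(3) a' a2 by argo
      ultimately show ?thesis by linarith
    qed
    show "0 \<le> 3/5 + b - 14/5 * a\<^sup>2" "0 \<le> 1 - b + 2 * a\<^sup>2" using b(3) a' a2 zero_le_power2[of a] by auto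
  qed (use a' \<kappa> \<Delta> in auto)
qed

text \<open>
  Here the two step inequalities are averaged with weight \<open>10 a\<close> on the linearized one; its noise
  at \<open>r = 1/5\<close> would be too large on its own.
\<close>

lemma distance_le_small:
  assumes a': "a \<le> 1 / 24" and t: "\<kappa> ^ Suc t * G 0 \<le> \<Delta>"
  shows "2 * a * f (Suc t) \<le> \<Delta>"
proof (rule distance_le_of_recursion[where Z = "z 1" and A = "1 - 9/4 * a + 157/4 * a\<^sup>2 - 31/2 * a ^ 3"
      and B = "1 - 29/8 * a - 7/8 * a\<^sup>2 - 5/4 * a ^ 3" and \<beta> = "3 - 7/2 * a - 4 * a\<^sup>2" and \<gamma> = "3 - 7 * a - 10 * a\<^sup>2"
      and \<rho> = "1 - a" and k = "(1 + a) * (5 - 6 * a) / (160 * a) + 75/4 * a"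
      and K = "((1 + a) * (5 - 6 * a) / 160 + 75/4 * a\<^sup>2) * \<Delta>" and c = "48/47", OF _ _ _ t])
  fix s
  let ?z = "z 1 s" and ?y = "z 1 (Suc s)" and ?n = "m 1 s" and ?n' = "m 1 (Suc s)" and ?m = "m (1/5) (Suc s)"
  let ?X = "f s" and ?Y = "f (Suc s)" and ?T = "N s + N (Suc s)"
  define w where "w = 10 * a"
  have w: "0 \<le> w" "w \<le> 1" using a a' by (auto simp: w_def)
  have zz: "0 \<le> ?z" "0 \<le> ?y" "?y \<le> 1" "?y\<^sup>2 \<le> ?y" using z[of 1] by auto
  \<comment> \<open>The linearized inequality measures excess against the noise at
    \<open>r = 1/5\<close>, the recursion against that at \<open>r = 1\<close>. This converts a
    positive part into a square, at the expense of the square of the larger noise.\<close>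
  have "21/4 * ?y\<^sup>2 - 12 * ?m\<^sup>2 \<le> 6 * max 0 (?y - ?m)"
  proof (cases "?m \<le> ?y")
    case True
    show ?thesis
    proof (cases "?y \<le> 1/4")
      case True
      have "0 \<le> (?y - ?m) * (6 - 12 * (?y + ?m))"
        using True \<open>?m \<le> ?y\<close> m_nonneg[of "1/5" "Suc s"] by (intro mult_nonneg_nonneg) auto
      moreover have "(?y - ?m) * (6 - 12 * (?y + ?m)) = 6 * (?y - ?m) - 12 * ?y\<^sup>2 + 12 * ?m\<^sup>2" by algebra
      ultimately have "21/4 * ?y\<^sup>2 - 12 * ?m\<^sup>2 \<le> 6 * (?y - ?m)" using zero_le_power2[of ?y] by linarith
      then show ?thesis using \<open>?m \<le> ?y\<close> by simp
    next
      case False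
      have "0 \<le> 21/4 * ((?y - 1/4) * (1 - ?y))" "0 \<le> 3/4 * (4 * ?m - 1)\<^sup>2" using False zz by auto
      moreover have "6 * (?y - ?m) - 21/4 * ?y\<^sup>2 + 12 * ?m\<^sup>2
          = 21/4 * ((?y - 1/4) * (1 - ?y)) + 3/4 * (4 * ?m - 1)\<^sup>2 + 9/16 * (1 - ?y)" by algebra
      ultimately have "21/4 * ?y\<^sup>2 - 12 * ?m\<^sup>2 \<le> 6 * (?y - ?m)" using zz(3) by argo
      then show ?thesis using \<open>?m \<le> ?y\<close> by simp
    qed
  next
    case False
    then have "?y\<^sup>2 \<le> ?m\<^sup>2" using zz by (intro power_mono) auto
    moreover have "max 0 (?y - ?m) = 0" using False by simp
    ultimately show ?thesis using zero_le_power2[of ?m] by argo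
  qed
  also have "max 0 (?y - ?m) \<le> max 0 (N (Suc s) - ?m)"
    using m_nonneg[of 1 "Suc s"] m_nonneg[of "1/5" "Suc s"] by (auto simp: z_def)
  finally have J: "(4/5 + 4 * a) * ?Y + (21/4 * ?y\<^sup>2 - 12 * ?m\<^sup>2) - 2/5 * (N (Suc s))\<^sup>2 \<le> (1 - 4 * a) * ?X + ?T\<^sup>2"
    using linear_step[of "1/5" "4 * a" s] a' by simp
  have I: "?Y + (6 * ?y - ?y\<^sup>2) \<le> (1 - 4 * a) * ?X + (N s)\<^sup>2 + ?T\<^sup>2"
    using gap_step[of s] z(4)[of 1 "Suc s"] by simp
  have "(1 - w) * (?Y + (6 * ?y - ?y\<^sup>2)) + w * ((4/5 + 4 * a) * ?Y + (21/4 * ?y\<^sup>2 - 12 * ?m\<^sup>2) - 2/5 * (N (Suc s))\<^sup>2)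
      \<le> (1 - w) * ((1 - 4 * a) * ?X + (N s)\<^sup>2 + ?T\<^sup>2) + w * ((1 - 4 * a) * ?X + ?T\<^sup>2)"
    using w by (intro add_mono[OF mult_left_mono[OF I] mult_left_mono[OF J]]) auto
  moreover have "(1 - w) * (?Y + (6 * ?y - ?y\<^sup>2)) + w * ((4/5 + 4 * a) * ?Y + (21/4 * ?y\<^sup>2 - 12 * ?m\<^sup>2) - 2/5 * (N (Suc s))\<^sup>2)
    = (1 - 2 * a + 40 * a\<^sup>2) * ?Y + (1 - w) * (6 * ?y - ?y\<^sup>2) + w * (21/4) * ?y\<^sup>2 - 12 * w * ?m\<^sup>2 - w * (2/5) * (N (Suc s))\<^sup>2"
    unfolding w_def by algebra
  moreover have "(1 - w) * ((1 - 4 * a) * ?X + (N s)\<^sup>2 + ?T\<^sup>2) + w * ((1 - 4 * a) * ?X + ?T\<^sup>2)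
    = (1 - 4 * a) * ?X + (1 - w) * (N s)\<^sup>2 + ?T\<^sup>2" by algebra
  ultimately have h3: "(1 - 2 * a + 40 * a\<^sup>2) * ?Y + (1 - w) * (6 * ?y - ?y\<^sup>2) + w * (21/4) * ?y\<^sup>2 - 12 * w * ?m\<^sup>2
      \<le> (1 - 4 * a) * ?X + (1 - w) * (N s)\<^sup>2 + ?T\<^sup>2 + w * (2/5) * (N (Suc s))\<^sup>2" by linarith
  have N: "N s \<le> ?z + ?n" "N (Suc s) \<le> ?y + ?n'" using z(3)[of 1] by auto
  have h4: "(1 - w) * (N s)\<^sup>2 \<le> (1 - w) * ((1 + a) * ?z\<^sup>2 + (1 + 1 / a) * ?n\<^sup>2)"
    "?T\<^sup>2 \<le> (1 + a) * (?z + ?y)\<^sup>2 + (1 + 1 / a) * (?n + ?n')\<^sup>2"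
    "w * (2/5) * (N (Suc s))\<^sup>2 \<le> w * (2/5) * ((1 + a) * ?y\<^sup>2 + (1 + 1 / a) * ?n'\<^sup>2)"
    using N N_nonneg w by (auto intro!: mult_left_mono square_sum_le[OF a(1)])
  define q where "q F = a\<^sup>2 / 8 * F + a * \<Delta> / 160" for F
  have q: "(1 + 1 / a) * q F = (1 + a) * (a / 8 * F + \<Delta> / 160)" for F
    using a by (simp add: q_def field_simps power2_eq_square)
  have n: "?n\<^sup>2 \<le> q ?X" "?n'\<^sup>2 \<le> q ?Y" using noise_le[of 1] by (simp_all add: q_def)
  have "(1 - w) * ?n\<^sup>2 + (?n + ?n')\<^sup>2 + w * (2/5) * ?n'\<^sup>2 \<le> (1 - w) * q ?X + 2 * (q ?X + q ?Y) + w * (2/5) * q ?Y"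
  proof (intro add_mono mult_left_mono n)
    show "(?n + ?n')\<^sup>2 \<le> 2 * (q ?X + q ?Y)"
      using n zero_le_power2[of "?n - ?n'"] by (simp add: power2_sum power2_diff)
  qed (use w in auto)
  then have "(1 + 1 / a) * ((1 - w) * ?n\<^sup>2 + (?n + ?n')\<^sup>2 + w * (2/5) * ?n'\<^sup>2)
      \<le> (1 + 1 / a) * ((1 - w) * q ?X + 2 * (q ?X + q ?Y) + w * (2/5) * q ?Y)" using a by (intro mult_left_mono) auto
  also have "\<dots> = (3 - w) * ((1 + 1 / a) * q ?X) + (2 + w * (2/5)) * ((1 + 1 / a) * q ?Y)" by algebra
  finally have h5: "(1 - w) * ((1 + 1 / a) * ?n\<^sup>2) + (1 + 1 / a) * (?n + ?n')\<^sup>2 + w * (2/5) * ((1 + 1 / a) * ?n'\<^sup>2)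
      \<le> (3 - w) * ((1 + a) * (a / 8 * ?X + \<Delta> / 160)) + (2 + w * (2/5)) * ((1 + a) * (a / 8 * ?Y + \<Delta> / 160))"
    unfolding q by (simp only: distrib_left mult_ac)
  have h6: "12 * w * ?m\<^sup>2 \<le> 12 * w * (a\<^sup>2 / 8 * ?Y + a * \<Delta> / 160 * 25)"
    using noise_le[of "1/5" "Suc s"] w by (intro mult_left_mono) (auto simp: power2_eq_square)
  \<comment> \<open>The two sides differ by \<open>(1 + a) * (?z - ?y)^2\<close> and a multiple of
    \<open>?y - ?y^2\<close>; discarding these leaves the stated coefficients \<beta> and
    \<gamma>.\<close>
  have h7: "(1 - w) * ((1 + a) * ?z\<^sup>2) + (1 + a) * (?z + ?y)\<^sup>2 + w * (2/5) * ((1 + a) * ?y\<^sup>2) + (3 - 7/2 * a - 4 * a\<^sup>2) * ?y\<^sup>2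
      \<le> (1 - w) * (6 * ?y - ?y\<^sup>2) + w * (21/4) * ?y\<^sup>2 + (3 - 7 * a - 10 * a\<^sup>2) * ?z\<^sup>2"
  proof -
    have "0 \<le> (1 + a) * (?z - ?y)\<^sup>2" "0 \<le> (1 - w) * (6 * (?y - ?y\<^sup>2))" using a w zz by auto
    moreover have "(1 - w) * (6 * ?y - ?y\<^sup>2) + w * (21/4) * ?y\<^sup>2 + (3 - 7 * a - 10 * a\<^sup>2) * ?z\<^sup>2
      - ((1 - w) * ((1 + a) * ?z\<^sup>2) + (1 + a) * (?z + ?y)\<^sup>2 + w * (2/5) * ((1 + a) * ?y\<^sup>2) + (3 - 7/2 * a - 4 * a\<^sup>2) * ?y\<^sup>2)
      = (1 + a) * (?z - ?y)\<^sup>2 + (1 - w) * (6 * (?y - ?y\<^sup>2))" unfolding w_def by algebra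
    ultimately show ?thesis by linarith
  qed
  have "(1 - 9/4 * a + 157/4 * a\<^sup>2 - 31/2 * a ^ 3) * ?Y - (1 - 29/8 * a - 7/8 * a\<^sup>2 - 5/4 * a ^ 3) * ?X
      - ((1 + a) * (5 - 6 * a) / 160 + 75/4 * a\<^sup>2) * \<Delta>
    = (1 - 2 * a + 40 * a\<^sup>2) * ?Y - (1 - 4 * a) * ?X - 12 * w * (a\<^sup>2 / 8 * ?Y + a * \<Delta> / 160 * 25)
      - ((3 - w) * ((1 + a) * (a / 8 * ?X + \<Delta> / 160)) + (2 + w * (2/5)) * ((1 + a) * (a / 8 * ?Y + \<Delta> / 160)))"
    unfolding w_def by algebra
  then show "(1 - 9/4 * a + 157/4 * a\<^sup>2 - 31/2 * a ^ 3) * ?Y + (3 - 7/2 * a - 4 * a\<^sup>2) * ?y\<^sup>2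
      \<le> (1 - 29/8 * a - 7/8 * a\<^sup>2 - 5/4 * a ^ 3) * ?X + (3 - 7 * a - 10 * a\<^sup>2) * ?z\<^sup>2
        + ((1 + a) * (5 - 6 * a) / 160 + 75/4 * a\<^sup>2) * \<Delta>"
    using h3 h4 h5 h6 h7 unfolding distrib_left[of "1 - w"] distrib_left[of "w * (2/5)"] by linarith
next
  have s: "0 \<le> a\<^sup>2" "a\<^sup>2 \<le> a / 24" using a a' by (auto simp: power2_eq_square)
  have q: "0 \<le> a ^ 3" "a ^ 3 \<le> a / 576"
    using a a' mult_mono[OF a' s(2)] by (auto simp: power2_eq_square power3_eq_cube)
  show "5 * (z 1 0)\<^sup>2 \<le> G 0" using z(5)[of 1 0] by simp
  show "3 - 7 * a - 10 * a\<^sup>2 \<le> (1 - a) * (3 - 7/2 * a - 4 * a\<^sup>2)"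
  proof -
    have "(1 - a) * (3 - 7/2 * a - 4 * a\<^sup>2) = 3 - 13/2 * a - 1/2 * a\<^sup>2 + 4 * a ^ 3" by algebra
    then show ?thesis using s q a by linarith
  qed
  show "1 - 29/8 * a - 7/8 * a\<^sup>2 - 5/4 * a ^ 3 \<le> (1 - a) * (1 - 9/4 * a + 157/4 * a\<^sup>2 - 31/2 * a ^ 3)"
  proof -
    have "(1 - a) * (1 - 9/4 * a + 157/4 * a\<^sup>2 - 31/2 * a ^ 3) = 1 - 13/4 * a + 83/2 * a\<^sup>2 - 219/4 * a ^ 3 + 31/2 * (a\<^sup>2)\<^sup>2" by algebra
    then show ?thesis using s q a zero_le_power2[of "a\<^sup>2"] by linarith
  qed
  show B: "0 \<le> 1 - 29/8 * a - 7/8 * a\<^sup>2 - 5/4 * a ^ 3" "0 \<le> 3 - 7 * a - 10 * a\<^sup>2" "0 \<le> 3 - 7/2 * a - 4 * a\<^sup>2"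
    "0 \<le> 1 - 9/4 * a + 157/4 * a\<^sup>2 - 31/2 * a ^ 3"
    using a a' s q by linarith+
  show "0 \<le> (1 + a) * (5 - 6 * a) / (160 * a) + 75/4 * a" "0 \<le> ((1 + a) * (5 - 6 * a) / 160 + 75/4 * a\<^sup>2) * \<Delta>"
    using a a' \<Delta> by auto
  have k: "a * ((1 + a) * (5 - 6 * a) / (160 * a) + 75/4 * a) = (1 + a) * (5 - 6 * a) / 160 + 75/4 * a\<^sup>2"
    using a by (simp add: distrib_left power2_eq_square)
  then show "((1 + a) * (5 - 6 * a) / 160 + 75/4 * a\<^sup>2) * \<Delta>
      \<le> (1 - (1 - a)) * (((1 + a) * (5 - 6 * a) / (160 * a) + 75/4 * a) * \<Delta>)"
    unfolding mult.assoc[symmetric] by simp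
  have "a * (1 - 29/8 * a - 7/8 * a\<^sup>2 - 5/4 * a ^ 3) \<le> a * 1" "a * (3 - 7 * a - 10 * a\<^sup>2) \<le> a * 3"
  proof -
    have "1 - 29/8 * a - 7/8 * a\<^sup>2 - 5/4 * a ^ 3 \<le> 1" "3 - 7 * a - 10 * a\<^sup>2 \<le> 3" using a s q by linarith+
    then show "a * (1 - 29/8 * a - 7/8 * a\<^sup>2 - 5/4 * a ^ 3) \<le> a * 1" "a * (3 - 7 * a - 10 * a\<^sup>2) \<le> a * 3"
      using a by (simp_all only: mult_left_mono less_imp_le)
  qed
  moreover have "(1 + a) * (5 - 6 * a) = 5 - a - 6 * a\<^sup>2" by algebra
  ultimately show "48/47 * (33 / 50 * (1 - 29/8 * a - 7/8 * a\<^sup>2 - 5/4 * a ^ 3) + 2 / 5 * (a * (3 - 7 * a - 10 * a\<^sup>2)))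
      + a * (1 - 29/8 * a - 7/8 * a\<^sup>2 - 5/4 * a ^ 3) / 50 + 2 * (a * ((1 + a) * (5 - 6 * a) / (160 * a) + 75/4 * a))
      < 1 - 9/4 * a + 157/4 * a\<^sup>2 - 31/2 * a ^ 3"
    unfolding k using a a' s q by argo
qed (use a a' \<kappa> \<Delta> in auto)

text \<open>\<open>(791/5000)\<^sup>2\<close> is just above \<open>1/40\<close>, the coefficient of \<open>a * \<Delta>\<close> in the noise at \<open>r = 1/2\<close>.\<close>

definition u :: real where "u = 791/5000 * sqrt \<Delta>"

lemma noise_large:
  assumes "3 / 10 \<le> a"
  shows "m (1/2) s \<le> u" "m 1 s \<le> u / 2"
proof -
  have u2: "u\<^sup>2 = 625681/25000000 * \<Delta>"
    using \<Delta> by (simp add: u_def power_mult_distrib power_divide)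
  then have u2': "(u / 2)\<^sup>2 = 625681/100000000 * \<Delta>" by (simp add: power_divide)
  have a\<Delta>: "a * \<Delta> \<le> 1 * \<Delta>" using a \<Delta> by (intro mult_right_mono) auto
  have "(m (1/2) s)\<^sup>2 \<le> a * \<Delta> / 40" "(m 1 s)\<^sup>2 \<le> a * \<Delta> / 160"
    using noise[of "1/2" s] noise[of 1 s] large_P[OF assms] by (auto simp: power2_eq_square field_simps)
  then have *: "(m (1/2) s)\<^sup>2 \<le> u\<^sup>2" "(m 1 s)\<^sup>2 \<le> (u / 2)\<^sup>2"
    using a\<Delta> \<Delta> unfolding u2 u2' by linarith+
  have "0 \<le> u" using \<Delta> by (simp add: u_def)
  then show "m (1/2) s \<le> u" "m 1 s \<le> u / 2"
    using power2_le_imp_le[OF *(1)] power2_le_imp_le[OF *(2)] by auto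
qed

lemma N_le_large: "3 / 10 \<le> a \<Longrightarrow> N s \<le> 1 + u / 2"
  using z(2,3)[of 1 s] noise_large(2)[of s] by simp

text \<open>Here \<open>4 * a\<close> exceeds 1, so \<open>b = 1\<close> is allowed and the previous
  distance disappears: with \<open>r = 1/2\<close> the new distance is controlled by nuclear norms
  alone.\<close>

lemma linear_step_large:
  assumes "3 / 10 \<le> a"
  shows "3/2 * f (Suc s) + 6 * z (1/2) (Suc s) - (N (Suc s))\<^sup>2 \<le> (N s + N (Suc s))\<^sup>2"
    and "3/2 * f (Suc s) + 6 * N (Suc s) - 6 * u - (N (Suc s))\<^sup>2 \<le> (N s + N (Suc s))\<^sup>2"
proof -
  show "3/2 * f (Suc s) + 6 * z (1/2) (Suc s) - (N (Suc s))\<^sup>2 \<le> (N s + N (Suc s))\<^sup>2"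
    using linear_step[of "1/2" 1 s] assms by (simp add: z_def)
  then show "3/2 * f (Suc s) + 6 * N (Suc s) - 6 * u - (N (Suc s))\<^sup>2 \<le> (N s + N (Suc s))\<^sup>2"
    using z(3)[of "1/2" "Suc s"] noise_large(1)[OF assms, of "Suc s"] by simp
qed

text \<open>What a violated bound entails, through \<open>a \<le> 1\<close> and the rank one
  curvature test: the distance is large, and so is the nuclear norm. The last claim uses
  \<open>a - 1/4 \<ge> a / 6\<close>; \<open>51/125\<close> is just below
  \<open>1 / sqrt 6\<close>.\<close>

lemma large_deviation:
  assumes a': "3 / 10 \<le> a" and f: "\<Delta> < 2 * a * f s"
  shows "\<Delta> \<le> 2 * f s" "2 * (\<Delta> - (N s)\<^sup>2) \<le> f s" "51/125 * sqrt \<Delta> \<le> N s"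
proof -
  have "a * f s \<le> 1 * f s" using a f_nonneg by (intro mult_right_mono) auto
  then show "\<Delta> \<le> 2 * f s" using f by simp
  have N: "2 * (a - 1 / 4) * f s \<le> (N s)\<^sup>2" by (rule large_N[OF a'])
  then show "2 * (\<Delta> - (N s)\<^sup>2) \<le> f s" using f by (simp add: algebra_simps)
  have "a / 3 * f s \<le> 2 * (a - 1 / 4) * f s" using a' f_nonneg by (intro mult_right_mono) auto
  then have "\<Delta> / 6 \<le> (N s)\<^sup>2" using N f by simp
  then have "(51/125 * sqrt \<Delta>)\<^sup>2 \<le> (N s)\<^sup>2" using \<Delta> by (simp add: power_mult_distrib power_divide)
  then show "51/125 * sqrt \<Delta> \<le> N s" by (rule power2_le_imp_le) (rule N_nonneg)
qed

lemma distance_le_large1: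
  assumes a': "3 / 10 \<le> a" and \<Delta>': "7 / 20 \<le> \<Delta>"
  shows "2 * a * f (Suc t) \<le> \<Delta>"
proof (rule ccontr)
  assume "\<not> ?thesis"
  then have f: "\<Delta> < 2 * a * f (Suc t)" by simp
  define S y Y where "S = sqrt \<Delta>" and "y = N (Suc t)" and "Y = 1 + u / 2"
  have S2: "S\<^sup>2 = \<Delta>" using \<Delta> by (simp add: S_def)
  have S: "1479/2500 \<le> S"
  proof (rule power2_le_imp_le)
    show "(1479/2500)\<^sup>2 \<le> S\<^sup>2" unfolding S2 using \<Delta>' by (simp add: power_divide)
  qed (simp add: S_def \<Delta> less_imp_le)
  have u: "u = 791/5000 * S" by (simp add: u_def S_def)
  note dev = large_deviation[OF a' f, folded y_def S_def, folded S2]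
  have yY: "y \<le> Y" "N t \<le> Y" using N_le_large[OF a'] by (auto simp: y_def Y_def)
  have "(N t + y)\<^sup>2 \<le> (Y + y)\<^sup>2" using yY N_nonneg by (intro power_mono add_mono) (auto simp: y_def)
  then have "3/2 * f (Suc t) + 6 * y - 6 * u - y\<^sup>2 \<le> (Y + y)\<^sup>2"
    using linear_step_large(2)[OF a', of t] by (simp add: y_def)
  then have J: "3/2 * f (Suc t) + (- 1 - 7 * u - u\<^sup>2 / 4) + (4 - u) * y - 2 * y\<^sup>2 \<le> 0"
    by (simp add: Y_def power2_eq_square field_simps)
  have SS: "1479/2500 * S \<le> S\<^sup>2" using S by (simp add: power2_eq_square mult_right_mono)
  have left: "0 < (3 * S\<^sup>2 - 1 - 7 * u - u\<^sup>2 / 4) + (4 - u) * (51/125 * S) - 5 * (51/125 * S)\<^sup>2"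
  proof -
    have "(3 * S\<^sup>2 - 1 - 7 * u - u\<^sup>2 / 4) + (4 - u) * (51/125 * S) - 5 * (51/125 * S)\<^sup>2 = 209687759/100000000 * S\<^sup>2 + 2623/5000 * S - 1"
      by (simp add: u power2_eq_square field_simps)
    then show ?thesis using SS S by linarith
  qed
  have mid: "0 < (3/4 * S\<^sup>2 - 1 - 7 * u - u\<^sup>2 / 4) + (4 - u) * (433/500 * S) - 2 * (433/500 * S)\<^sup>2" if "433/500 * S \<le> Y"
  proof -
    have "S \<le> 1271/1000" using that by (simp add: Y_def u)
    then have "0 \<le> (S - 1479/2500) * (1271/1000 - S)" using S by simp
    then show ?thesis using S by (simp add: u power2_eq_square field_simps)
  qed
  \<comment> \<open>As a function of \<open>S\<close> this is a convex quadratic, with minimizer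
    near \<open>1761/2000\<close>.\<close>
  have right: "0 < (3/4 * S\<^sup>2 - 1 - 7 * u - u\<^sup>2 / 4) + (4 - u) * Y - 2 * Y\<^sup>2"
    using zero_le_power2[of "S - 1761/2000"] S by (simp add: Y_def u power2_eq_square field_simps)
  \<comment> \<open>Two lower bounds for the distance compete, \<open>2 * (\<Delta> - y^2)\<close>
    and \<open>\<Delta> / 2\<close>. They cross at \<open>y = sqrt 3 / 2 * S\<close>, and
    \<open>433/500\<close> is just below \<open>sqrt 3 / 2\<close>. Either one makes
    \<open>J\<close> a concave quadratic in \<open>y\<close>.\<close>
  show False
  proof (cases "y \<le> 433/500 * S")
    case True
    have "0 < (3 * S\<^sup>2 - 1 - 7 * u - u\<^sup>2 / 4) + (4 - u) * y - 5 * y\<^sup>2"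
    proof (cases "433/500 * S \<le> Y")
      case le: True
      have "(433/500 * S)\<^sup>2 \<le> 3/4 * S\<^sup>2" by (simp add: power2_eq_square)
      then show ?thesis using mid[OF le] True dev(3) left by (intro concave_quadratic_pos[of 5 "51/125 * S" y "433/500 * S"]) auto
    next
      case False
      then have "Y\<^sup>2 \<le> (433/500 * S)\<^sup>2" using yY dev(3) S by (intro power_mono) auto
      also have "\<dots> \<le> 3/4 * S\<^sup>2" by (simp add: power2_eq_square)
      finally show ?thesis using right yY dev(3) left by (intro concave_quadratic_pos[of 5 "51/125 * S" y Y]) auto
    qed
    then show False using J dev(2) by argo
  next
    case False
    then have "0 < (3/4 * S\<^sup>2 - 1 - 7 * u - u\<^sup>2 / 4) + (4 - u) * y - 2 * y\<^sup>2"
      using mid yY right by (intro concave_quadratic_pos[of 2 "433/500 * S" y Y]) auto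
    then show False using J dev(1) by argo
  qed
qed

text \<open>
  The hypothesis on \<open>y = z\<^sup>+\<close> is a quadratic inequality \<open>6 y \<le> (y + u)\<^sup>2 + (c + y + u)\<^sup>2\<close>, which fails on a
  whole interval up to \<open>1\<close>; as \<open>y \<le> 1\<close>, it lies below that interval.
\<close>

lemma z_contraction:
  assumes a': "3 / 10 \<le> a" and \<Delta>': "\<Delta> < 7 / 20"
  shows "(z (1/2) (Suc s))\<^sup>2 \<le> 1 / 2 * (z (1/2) s)\<^sup>2 + u\<^sup>2"
proof (rule ccontr)
  define x y where "x = z (1/2) s" and "y = z (1/2) (Suc s)"
  assume "\<not> ?thesis"
  then have less: "1 / 2 * x\<^sup>2 + u\<^sup>2 < y\<^sup>2" by (simp add: x_def y_def)
  have xy: "0 \<le> x" "x \<le> 1" "0 \<le> y" "y \<le> 1" using z[of "1/2"] by (auto simp: x_def y_def)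
  have "sqrt \<Delta> < sqrt ((5917/10000)\<^sup>2)" using \<Delta>' by (intro real_sqrt_less_mono) (simp add: power2_eq_square)
  then have u: "0 < u" "u \<le> 9361/100000" using \<Delta> by (auto simp: u_def)
  have N: "N s \<le> x + u" "N (Suc s) \<le> y + u" "N s \<le> 1 + u / 2"
    using z(3)[of "1/2" s] z(3)[of "1/2" "Suc s"] noise_large(1)[OF a'] N_le_large[OF a', of s]
    by (auto simp: x_def y_def intro: order_trans)
  have J: "6 * y \<le> (y + u)\<^sup>2 + (c + (y + u))\<^sup>2" if "N s \<le> c" for c
  proof -
    have "(N (Suc s))\<^sup>2 \<le> (y + u)\<^sup>2" "(N s + N (Suc s))\<^sup>2 \<le> (c + (y + u))\<^sup>2"
      using N N_nonneg that by (auto intro!: power_mono add_mono)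
    then show ?thesis using linear_step_large(1)[OF a', of s] f_nonneg[of "Suc s"] by (simp add: y_def)
  qed
  \<comment> \<open>For large \<open>x\<close> the a priori bound \<open>1 + u / 2\<close> on
    \<open>N s\<close> is used, otherwise \<open>x + u\<close>. In the second case \<open>y0\<close>
    is the bound being refuted, so \<open>y\<close> lies in the interval from \<open>y0\<close> to 1
    on which the quadratic inequality fails.\<close>
  show False
  proof (cases "19/25 \<le> x")
    case True
    then have "(19/25)\<^sup>2 \<le> x\<^sup>2" by (intro power_mono) auto
    then have "361/625 \<le> x\<^sup>2" by (simp add: power_divide)
    then have "11449/40000 < y\<^sup>2" using less zero_le_power2[of u] by linarith
    then have "(107/200)\<^sup>2 < y\<^sup>2" by (simp add: power_divide)
    then have "107/200 < y" by (rule power2_less_imp_less) (use xy in simp)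
    have "(y + u)\<^sup>2 \<le> (y + 9361/100000)\<^sup>2" "(1 + u / 2 + (y + u))\<^sup>2 \<le> (y + 114042/100000)\<^sup>2"
      using xy u by (auto intro!: power_mono)
    then have "6 * y \<le> (y + 9361/100000)\<^sup>2 + (y + 114042/100000)\<^sup>2" using J[OF N(3)] by linarith
    moreover have "0 < - ((9361/100000)\<^sup>2 + (114042/100000)\<^sup>2) + (6 - 2 * (9361/100000) - 2 * (114042/100000)) * y - 2 * y\<^sup>2"
      using \<open>107/200 < y\<close> xy by (intro concave_quadratic_pos[of 2 "107/200" y 1]) (auto simp: power2_eq_square)
    ultimately show False by (simp add: power2_eq_square field_simps)
  next
    case False
    define y0 where "y0 = sqrt (1 / 2 * x\<^sup>2 + u\<^sup>2)"
    have y02: "y0\<^sup>2 = 1 / 2 * x\<^sup>2 + u\<^sup>2" by (simp add: y0_def)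
    have y0: "0 < y0" using u by (simp add: y0_def add_nonneg_pos)
    have "y0 \<le> y" using less xy y02 by (intro power2_le_imp_le[of y0 y]) auto
    have "u \<le> y0" using y0 y02 by (intro power2_le_imp_le[of u y0]) auto
    have "(3/2 * y0)\<^sup>2 = 9/4 * y0\<^sup>2" by (simp add: power_mult_distrib power_divide)
    then have "x\<^sup>2 \<le> (3/2 * y0)\<^sup>2" using zero_le_power2[of u] zero_le_power2[of x] unfolding y02 by argo
    then have "x \<le> 3/2 * y0" using y0 by (intro power2_le_imp_le[of x]) auto
    have "x\<^sup>2 \<le> (19/25)\<^sup>2" "u\<^sup>2 \<le> (9361/100000)\<^sup>2" using False xy u by (auto intro!: power_mono)
    then have "y0\<^sup>2 \<le> (11/20)\<^sup>2" unfolding y02 by (simp add: power2_eq_square)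
    then have "y0 \<le> 11/20" by (rule power2_le_imp_le) simp
    have "0 < - (u\<^sup>2 + (x + 2 * u)\<^sup>2) + (6 - 2 * u - 2 * (x + 2 * u)) * y - 2 * y\<^sup>2"
    proof (rule concave_quadratic_pos[of 2 y0 y 1])
      have "3 * u * u \<le> 3 * u * y0" "4 * u * x \<le> 4 * u * (3/2 * y0)"
        using \<open>u \<le> y0\<close> \<open>x \<le> 3/2 * y0\<close> u by (auto intro!: mult_left_mono)
      moreover have "u\<^sup>2 + (x + 2 * u)\<^sup>2 + 2 * y0\<^sup>2 = 4 * y0\<^sup>2 + 3 * u * u + 4 * u * x"
        using y02 by algebra
      moreover have "0 < y0 * (6 - 4 * y0 - 15 * u - 2 * x)"
        using y0 \<open>y0 \<le> 11/20\<close> u False by (intro mult_pos_pos) auto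
      ultimately show "0 < - (u\<^sup>2 + (x + 2 * u)\<^sup>2) + (6 - 2 * u - 2 * (x + 2 * u)) * y0 - 2 * y0\<^sup>2"
        by (simp add: algebra_simps power2_eq_square)
      have "(1 + u)\<^sup>2 \<le> (1 + 9361/100000)\<^sup>2" "(x + 2 * u + 1)\<^sup>2 \<le> (19/25 + 2 * (9361/100000) + 1)\<^sup>2"
        using u xy False by (auto intro!: power_mono)
      then have "(1 + u)\<^sup>2 + (x + 2 * u + 1)\<^sup>2 < 6" by (simp add: power2_eq_square[of "_ / _ :: real"])
      then show "0 < - (u\<^sup>2 + (x + 2 * u)\<^sup>2) + (6 - 2 * u - 2 * (x + 2 * u)) * 1 - 2 * 1\<^sup>2"
        by (simp add: power2_eq_square algebra_simps)
    qed (use \<open>y0 \<le> y\<close> xy in auto)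
    then show False using J[OF N(1)] by (simp add: power2_eq_square algebra_simps)
  qed
qed

text \<open>The excess contracts by itself, with factor \<open>1/2 \<le> \<kappa>\<close> and
  stationary level \<open>2 * u^2\<close>. This bounds \<open>N t\<close> by a multiple of
  \<open>sqrt \<Delta>\<close>, sharper than the a priori bound; one more linearized step then
  excludes a large distance.\<close>

lemma distance_le_large2:
  assumes a': "3 / 10 \<le> a" and \<Delta>': "\<Delta> < 7 / 20" and t: "\<kappa> ^ Suc t * G 0 \<le> \<Delta>"
  shows "2 * a * f (Suc t) \<le> \<Delta>"
proof (rule ccontr)
  assume "\<not> ?thesis"
  then have f: "\<Delta> < 2 * a * f (Suc t)" by simp
  define S x y where "S = sqrt \<Delta>" and "x = N t" and "y = N (Suc t)"
  have S2: "S\<^sup>2 = \<Delta>" and S0: "0 < S" using \<Delta> by (simp_all add: S_def)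
  have u: "u = 791/5000 * S" by (simp add: u_def S_def)
  have "sqrt \<Delta> < sqrt ((5917/10000)\<^sup>2)" using \<Delta>' by (intro real_sqrt_less_mono) (simp add: power2_eq_square)
  then have S: "S \<le> 5917/10000" by (simp add: S_def)
  note dev = large_deviation[OF a' f, folded y_def S_def, folded S2]
  have "(z (1/2) t)\<^sup>2 \<le> (1 / 2) ^ t * (z (1/2) 0)\<^sup>2 + 2 * u\<^sup>2"
    using z_contraction[OF a' \<Delta>'] by (intro linear_recursion_bound[of "\<lambda>s. (z (1/2) s)\<^sup>2"]) auto
  moreover have "(1 / 2) ^ t * (z (1/2) 0)\<^sup>2 \<le> 2/5 * \<Delta>"
  proof -
    have k: "1/2 \<le> \<kappa>" using \<kappa> a by linarith
    have "(1 / 2) ^ t * (z (1/2) 0)\<^sup>2 \<le> \<kappa> ^ t * (G 0 / 5)"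
      using k z(5)[of "1/2" 0] by (intro mult_mono power_mono) auto
    moreover have "1/2 * (\<kappa> ^ t * G 0) \<le> \<kappa> * (\<kappa> ^ t * G 0)"
      using k G_nonneg by (intro mult_right_mono) auto
    ultimately show ?thesis using t by simp
  qed
  moreover have "u\<^sup>2 = (791/5000)\<^sup>2 * \<Delta>" unfolding u power_mult_distrib S2 ..
  ultimately have "(z (1/2) t)\<^sup>2 \<le> (671/1000)\<^sup>2 * \<Delta>" using \<Delta> by (simp add: power2_eq_square[of "_ / _ :: real"])
  then have "(z (1/2) t)\<^sup>2 \<le> (671/1000 * S)\<^sup>2" by (simp only: power_mult_distrib S2)
  then have "z (1/2) t \<le> 671/1000 * S" by (rule power2_le_imp_le) (use S0 in simp)
  then have x: "0 \<le> x" "x \<le> 83/100 * S"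
    using z(3)[of "1/2" t] noise_large(1)[OF a', of t] N_nonneg[of t] S0 by (simp_all add: x_def u)
  then have "x\<^sup>2 \<le> (83/100 * S)\<^sup>2" by (intro power_mono)
  also have "\<dots> = 6889/10000 * S\<^sup>2" by (simp add: power_divide power_mult_distrib)
  finally have x2: "x\<^sup>2 \<le> 69/100 * S\<^sup>2" using zero_le_power2[of S] by linarith
  have "y \<le> 1047/1000" using N_le_large[OF a', of "Suc t"] S by (simp add: y_def u)
  then have "51/125 * S * (73/25) \<le> y * (6 - 2 * x - 2 * y)"
    using x S dev(3) S0 by (intro mult_mono) auto
  moreover have "3/2 * f (Suc t) + 6 * y - 6 * u - y\<^sup>2 \<le> (x + y)\<^sup>2"
    using linear_step_large(2)[OF a', of t] by (simp add: x_def y_def)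
  moreover have "(x + y)\<^sup>2 + y\<^sup>2 - 6 * y = x\<^sup>2 - y * (6 - 2 * x - 2 * y)" by algebra
  ultimately show False
    using dev(1) x2 S0 zero_le_power2[of S] unfolding u by linarith
qed

end

section \<open>From matrices to the scaled recursion\<close>

context low_rank_problem begin

lemma curvature_le: "D \<le> v + 4 * \<tau>"
proof -
  obtain X :: "real^'n^'m" where X: "norm X = 1" "nuc_norm X \<le> 1"
  proof -
    let ?X = "outer (axis undefined 1) (axis undefined 1) :: real^'n^'m"
    have "nuc_norm ?X \<le> 1" using nuc_norm_outer_le[of "axis undefined 1 :: real^'m" "axis undefined 1 :: real^'n"] by simp
    moreover have "(norm ?X)\<^sup>2 = 1"
      unfolding power2_norm_eq_inner inner_outer by (simp add: outer_mult_vec inner_axis_axis)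
    then have "norm ?X = 1" by (metis norm_ge_zero power2_eq_1_iff abs_of_nonneg abs_numeral abs_one abs_power2 power2_eq_iff_nonneg zero_le_one one_power2)
    ultimately show thesis using that by blast
  qed
  have "(nuc_norm X)\<^sup>2 \<le> 1" using X nuc_norm_nonneg[of X] by (simp add: power_le_one)
  then have "\<tau> * (nuc_norm X)\<^sup>2 \<le> \<tau>" using pos by simp
  then have "\<alpha>\<^sub>2 - \<alpha>\<^sub>3 \<le> 2 * \<tau>" using rsc[of X 0] rsm[of X 0] X(1) by simp
  then show ?thesis using step mu by linarith
qed

text \<open>The linearized gap is bounded below through the gap at
  \<open>That + r *\<^sub>R (Z - That)\<close>. After division by \<open>r\<close> the payment
  \<open>6 * \<omega> * w\<close> is intact, while its quadratic loss and the smoothness error keep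
  a factor \<open>r\<close>.\<close>

lemma prox_step_linear:
  assumes prox: "is_arg_min (prox_objective L lam p v Y) (\<lambda>X. X \<in> feasible \<omega>) Z"
    and r: "0 < r" "r \<le> 1" and b: "b \<le> 1" "v * b \<le> D"
  shows "v / 2 * (1 + b - r) * (norm (Z - That))\<^sup>2
      + \<tau> * (6 * \<omega> * max 0 (nuc_norm (Z - That) - noise r Z) - 2 * r * (nuc_norm (Z - That))\<^sup>2)
    \<le> v / 2 * (1 - b) * (norm (Y - That))\<^sup>2 + \<tau> * (nuc_norm (Y - That) + nuc_norm (Z - That))\<^sup>2"
proof -
  have Z: "Z \<in> feasible \<omega>" using prox by (simp add: is_arg_min_def)
  let ?X = "That + r *\<^sub>R (Z - That)"
  define w where "w = max 0 (nuc_norm (Z - That) - noise r Z)"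
  have noise: "0 \<le> noise r Z" "noise 1 ?X = r * noise r Z" "nuc_norm (?X - That) = r * nuc_norm (Z - That)"
    using r eps_pos by (simp_all add: noise_def nuc_norm_scaleR distrib_left)
  have w: "0 \<le> w" "w \<le> nuc_norm (Z - That)"
    using noise(1) nuc_norm_nonneg by (auto simp: w_def)
  have "r * (\<tau> * (6 * \<omega> * w - r * w\<^sup>2)) \<le> gap ?X"
  proof (cases "w = 0")
    case True
    then show ?thesis using gap_nonneg[OF feasible_convex(1)[OF That_feasible Z]] r by simp
  next
    case False
    then have "r * w \<le> nuc_norm (?X - That) - noise 1 ?X"
      unfolding noise using r by (simp add: w_def max_def right_diff_distrib split: if_splits)
    then have "\<tau> * (6 * \<omega> * (r * w) - (r * w)\<^sup>2) \<le> gap ?X"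
      using feasible_convex(1)[OF That_feasible Z] r w by (intro gap_ge_away_from_minimizer(2)) auto
    then show ?thesis by (simp add: power2_eq_square algebra_simps)
  qed
  also have "gap ?X \<le> r * (linearized_gap Z + r * (v / 2 * (norm (Z - That))\<^sup>2 + \<tau> * (nuc_norm (Z - That))\<^sup>2))"
    using gap_le_linearized_gap[OF Z r] by (simp add: distrib_left power2_eq_square)
  finally have "\<tau> * (6 * \<omega> * w - r * w\<^sup>2) \<le> linearized_gap Z + r * (v / 2 * (norm (Z - That))\<^sup>2 + \<tau> * (nuc_norm (Z - That))\<^sup>2)"
    using r by simp
  moreover have "\<tau> * (6 * \<omega> * w - r * (nuc_norm (Z - That))\<^sup>2) \<le> \<tau> * (6 * \<omega> * w - r * w\<^sup>2)"
    using w r pos by (intro mult_left_mono diff_mono power_mono) auto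
  ultimately show ?thesis
    using prox_step_linearized_gap[OF prox b] unfolding w_def[symmetric] by (auto simp: field_simps)
qed

end

locale tolerance_problem = low_rank_problem L p That \<omega> lam \<mu> \<alpha>\<^sub>2 \<alpha>\<^sub>3 \<tau> v T q R
  for L :: "real^'n^'m \<Rightarrow> real" and p That \<omega> lam \<mu> \<alpha>\<^sub>2 \<alpha>\<^sub>3 \<tau> v T q R +
  fixes \<kappa> \<delta> a \<Delta> P :: real and Theta :: "nat \<Rightarrow> real^'n^'m"
  assumes step': "D \<le> 4 * v"
    and kappa: "\<kappa> = contraction_factor q R lam \<alpha>\<^sub>2 \<mu> \<tau> v" "0 < \<kappa>" "\<kappa> < 1"
    and tolerance: "8 * xi_factor q R lam \<alpha>\<^sub>2 \<mu> \<tau> v / (1 - \<kappa>) * eps\<^sup>2 \<le> \<delta>"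
    and initial: "Theta 0 \<in> feasible \<omega>"
    and iterates: "\<And>s. is_arg_min (prox_objective L lam p v (Theta s)) (\<lambda>X. X \<in> feasible \<omega>) (Theta (Suc s))"
  defines "a \<equiv> D / (4 * v)" and "\<Delta> \<equiv> \<delta> / (\<tau> * \<omega>\<^sup>2)"
    and "P \<equiv> (if large_part_rank = 0 then 0 else a\<^sup>2 / 8)"
begin

text \<open>The perturbation of the ideal rate \<open>1 - a / 2\<close> inside \<kappa>; the
  assumption \<open>\<kappa> < 1\<close> amounts to \<open>4 * e < a\<close>.\<close>

definition e :: real where "e = 512 * \<tau> * rho / D"

lemma constants_eq: "512 * \<tau> * lam powr (- q) * R / D = e" "1024 * \<tau> * lam powr (- q) * R / D = 2 * e"
    "D / (8 * v) = a / 2"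
  by (simp_all add: e_def rho_def a_def)

lemma kappa_eq: "\<kappa> = (1 - a / 2 + e) / (1 - e)"
  unfolding kappa(1) contraction_factor_def constants_eq by (rule divide_inverse[symmetric])

lemma a: "0 < a" "a \<le> 1" and D_eq: "D = 4 * a * v"
  using curvature pos step' by (simp_all add: a_def)

lemma e: "0 < e" "e < 1" "4 * e < a"
proof -
  show "0 < e" using pos rho_pos curvature by (simp add: e_def)
  then have "0 < 1 - a / 2 + e" using a by linarith
  then show "e < 1" using kappa(2) unfolding kappa_eq by (simp add: zero_less_divide_iff)
  then have "1 - a / 2 + e < 1 - e" using kappa(3) unfolding kappa_eq by simp
  then show "4 * e < a" by linarith
qed

lemma kappa_ge: "1 - a / 2 \<le> \<kappa>"
proof -
  have "(1 - a / 2) * (1 - e) \<le> 1 - a / 2 + e" using a e by (simp add: algebra_simps)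
  then show ?thesis using e by (simp add: kappa_eq pos_le_divide_eq)
qed

text \<open>Of \<xi> only the summand 5 is kept, giving \<open>10 * \<tau> / (1 - e)\<close>. Since
  \<open>1 - \<kappa>\<close> is \<open>(a - 4 * e) / (2 * (1 - e))\<close>, the denominators cancel
  and \<open>8 * 10 * 2 = 160\<close> remains.\<close>

lemma eps_le: "160 * \<tau> * eps\<^sup>2 \<le> (a - 4 * e) * \<delta>"
proof -
  have "xi_factor q R lam \<alpha>\<^sub>2 \<mu> \<tau> v = 2 * \<tau> * (a / 2 + 2 * e + 5) / (1 - e)"
    unfolding xi_factor_def constants_eq by (rule divide_inverse[symmetric])
  also have "\<dots> \<ge> 2 * \<tau> * 5 / (1 - e)" using pos a e by (intro divide_right_mono mult_left_mono) auto
  finally have *: "10 * \<tau> / (1 - e) \<le> xi_factor q R lam \<alpha>\<^sub>2 \<mu> \<tau> v" by simp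
  have k: "1 - \<kappa> = (a - 4 * e) / 2 / (1 - e)" using e by (simp add: kappa_eq field_simps)
  have "8 * (10 * \<tau> / (1 - e)) / (1 - \<kappa>) * eps\<^sup>2 \<le> 8 * xi_factor q R lam \<alpha>\<^sub>2 \<mu> \<tau> v / (1 - \<kappa>) * eps\<^sup>2"
    using * kappa by (intro mult_right_mono divide_right_mono mult_left_mono) auto
  also have "8 * (10 * \<tau> / (1 - e)) / (1 - \<kappa>) = 160 * \<tau> / (a - 4 * e)"
  proof -
    have "8 * (10 * \<tau> / B) / (A / 2 / B) = 160 * \<tau> / A" if "A \<noteq> 0" "B \<noteq> 0" for A B
      using that by (simp add: field_simps)
    from this[of "a - 4 * e" "1 - e"] show ?thesis unfolding k using e by simp
  qed
  finally have "160 * \<tau> / (a - 4 * e) * eps\<^sup>2 \<le> \<delta>" using tolerance by linarith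
  then show ?thesis using e by (simp add: pos_divide_le_eq mult.commute)
qed

lemma \<delta>_pos: "0 < \<delta>"
proof -
  have "0 < (a - 4 * e) * \<delta>" using eps_le eps_pos pos by (smt (verit) mult_pos_pos zero_less_power)
  then show ?thesis using e by (simp add: zero_less_mult_iff)
qed

lemma noise_scaled:
  assumes r: "0 < r"
  shows "(noise r X / \<omega>)\<^sup>2 \<le> P * (v / (2 * \<tau> * \<omega>\<^sup>2) * (norm (X - That))\<^sup>2) + a * \<Delta> / 160 / r\<^sup>2"
proof -
  define k where "k = real large_part_rank"
  define F where "F = (norm (X - That))\<^sup>2"
  define u where "u = 4 * sqrt (2 * k) * norm (X - That)"
  have k: "0 \<le> k" by (simp add: k_def)
  have u2: "u\<^sup>2 = 32 * k * F" using k by (simp add: u_def F_def power_mult_distrib)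
  have "k \<le> rho" using large_part_rank_le by (simp add: k_def)
  have tk: "512 * \<tau> * k \<le> e * (4 * a * v)"
    using \<open>k \<le> rho\<close> pos curvature by (simp add: e_def D_eq[symmetric])
  have main: "(noise r X)\<^sup>2 \<le> \<omega>\<^sup>2 * (P * (v / (2 * \<tau> * \<omega>\<^sup>2) * F) + a * \<Delta> / 160 / r\<^sup>2)"
  proof (cases "large_part_rank = 0")
    case True
    then have "(noise r X)\<^sup>2 = eps\<^sup>2 / r\<^sup>2" by (simp add: noise_def power_divide)
    also have "160 * \<tau> * eps\<^sup>2 \<le> a * \<delta>" using eps_le e \<delta>_pos by (smt (verit) mult_right_mono)
    then have "eps\<^sup>2 / r\<^sup>2 \<le> (a * \<delta> / (160 * \<tau>)) / r\<^sup>2"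
      using pos by (intro divide_right_mono) (simp_all add: field_simps)
    finally show ?thesis using True pos by (simp add: P_def \<Delta>_def field_simps)
  next
    case False
    \<comment> \<open>The weight that suits both parts of the noise: in the rank part
      \<open>e\<close> cancels and the coefficient \<open>a^2 / 8\<close> of \<open>P\<close>
      remains, while \<open>1 - \<phi>\<close> is \<open>(a - 4 * e) / a\<close>, the factor by
      which \<open>eps_le\<close> falls short of the full budget.\<close>
    define \<phi> where "\<phi> = 4 * e / a"
    have \<phi>: "0 < \<phi>" "\<phi> < 1" "\<phi> * a = 4 * e" using e a by (auto simp: \<phi>_def field_simps)
    have "0 \<le> ((1 - \<phi>) * u - \<phi> * (eps / r))\<^sup>2 / (\<phi> * (1 - \<phi>))" using \<phi> by (intro divide_nonneg_pos mult_pos_pos) auto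
    also have "\<dots> = u\<^sup>2 / \<phi> + (eps / r)\<^sup>2 / (1 - \<phi>) - (u + eps / r)\<^sup>2"
      using \<phi> by (simp add: divide_simps) (simp add: power2_eq_square algebra_simps)
    finally have "(noise r X)\<^sup>2 \<le> u\<^sup>2 / \<phi> + (eps / r)\<^sup>2 / (1 - \<phi>)" by (simp add: noise_def u_def k_def)
    moreover have "u\<^sup>2 / \<phi> \<le> \<omega>\<^sup>2 * (P * (v / (2 * \<tau> * \<omega>\<^sup>2) * F))"
    proof -
      have "512 * \<tau> * k * F \<le> e * (4 * a * v) * F" using tk by (intro mult_right_mono) (auto simp: F_def)
      also have "\<dots> = \<phi> * a * a * v * F" unfolding \<phi>(3) by simp
      finally have "512 * \<tau> * k * F / (16 * \<tau> * \<phi>) \<le> \<phi> * a * a * v * F / (16 * \<tau> * \<phi>)"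
        using \<phi> pos by (intro divide_right_mono) auto
      moreover have "512 * \<tau> * k * F / (16 * \<tau> * \<phi>) = u\<^sup>2 / \<phi>" using pos by (simp add: u2)
      moreover have "\<phi> * a * a * v * F / (16 * \<tau> * \<phi>) = \<omega>\<^sup>2 * (P * (v / (2 * \<tau> * \<omega>\<^sup>2) * F))"
        using \<phi>(1) pos False unfolding P_def by (simp add: power2_eq_square mult_ac)
      ultimately show ?thesis by linarith
    qed
    moreover have "(eps / r)\<^sup>2 / (1 - \<phi>) \<le> \<omega>\<^sup>2 * (a * \<Delta> / 160 / r\<^sup>2)"
    proof -
      have "a - 4 * e = a * (1 - \<phi>)" using \<phi>(3) by (simp add: algebra_simps)
      then have "160 * \<tau> * eps\<^sup>2 \<le> a * (1 - \<phi>) * \<delta>" using eps_le by simp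
      then have "160 * \<tau> * eps\<^sup>2 / (160 * \<tau> * (1 - \<phi>)) \<le> a * (1 - \<phi>) * \<delta> / (160 * \<tau> * (1 - \<phi>))"
        using pos \<phi> by (intro divide_right_mono) auto
      then have "eps\<^sup>2 / (1 - \<phi>) \<le> a * \<delta> / (160 * \<tau>)" using pos \<phi> by simp
      then have "eps\<^sup>2 / (1 - \<phi>) / r\<^sup>2 \<le> a * \<delta> / (160 * \<tau>) / r\<^sup>2" by (rule divide_right_mono) simp
      then show ?thesis using pos by (simp add: \<Delta>_def power_divide mult_ac)
    qed
    ultimately show ?thesis unfolding distrib_left by linarith
  qed
  have "(noise r X / \<omega>)\<^sup>2 = (noise r X)\<^sup>2 / \<omega>\<^sup>2" by (rule power_divide)
  also have "\<dots> \<le> \<omega>\<^sup>2 * (P * (v / (2 * \<tau> * \<omega>\<^sup>2) * F) + a * \<Delta> / 160 / r\<^sup>2) / \<omega>\<^sup>2"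
    using main by (rule divide_right_mono) simp
  finally show ?thesis using pos by (simp add: F_def)
qed

lemma Theta_feasible: "Theta s \<in> feasible \<omega>"
  using initial iterates[of "s - 1"] by (cases s) (auto simp: is_arg_min_def)

text \<open>The curvature test bounds \<open>v\<close> by a multiple of \<tau>, and
  \<open>e < 1\<close> bounds \<open>\<tau> * rho\<close> by a multiple of \<open>v\<close>.
  Together the effective rank falls below 1, and the actual rank is an integer.\<close>

lemma large_part_rank_eq_0: "large_part_rank = 0" if "3 / 10 \<le> a"
proof -
  have "(4 * a - 1) * v \<le> 4 * \<tau>" using curvature_le unfolding D_eq by (simp add: algebra_simps)
  then have "(4 * a - 1) * v * rho \<le> 4 * \<tau> * rho" using rho_pos by (intro mult_right_mono) auto
  also have "\<tau> * rho = e * (4 * a * v) / 512" using curvature by (simp add: e_def flip: D_eq)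
  then have "4 * \<tau> * rho = v * (e * a / 32)" by (simp add: mult_ac)
  also have "\<dots> < v * (4 * a - 1)"
  proof (intro mult_strict_left_mono)
    have "e * a \<le> 1 * 1" using e a by (intro mult_mono) auto
    then show "e * a / 32 < 4 * a - 1" using that by linarith
  qed (use pos in auto)
  finally have "((4 * a - 1) * v) * rho < ((4 * a - 1) * v) * 1" by (simp add: mult_ac)
  then have "rho < 1" using that pos by (subst (asm) mult_less_cancel_left_pos) auto
  then show ?thesis using large_part_rank_le by simp
qed

definition c :: real where "c = 1 / (\<tau> * \<omega>\<^sup>2)"

sublocale scaled_recursion "\<lambda>s. c * (v / 2 * (norm (Theta s - That))\<^sup>2)" "\<lambda>s. nuc_norm (Theta s - That) / \<omega>"
  "\<lambda>s. c * gap (Theta s)" "\<lambda>r s. noise r (Theta s) / \<omega>" a \<Delta> \<kappa> P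
proof
  have c: "0 < c" using pos by (simp add: c_def)
  have cN: "(x / \<omega>)\<^sup>2 = c * (\<tau> * x\<^sup>2)" for x using pos by (simp add: c_def power_divide)
  have cF: "v / (2 * \<tau> * \<omega>\<^sup>2) * F = c * (v / 2 * F)" for F by (simp add: c_def)
  show "0 < a" "a \<le> 1" using a by auto
  show "0 < \<Delta>" using \<delta>_pos pos by (simp add: \<Delta>_def)
  show "1 - a / 2 \<le> \<kappa>" "\<kappa> < 1" using kappa_ge kappa by auto
  fix s
  let ?x = "Theta s - That" and ?y = "Theta (Suc s) - That"
  show "0 \<le> c * (v / 2 * (norm ?x)\<^sup>2)" using c pos by simp
  show "0 \<le> nuc_norm ?x / \<omega>" using pos by (intro divide_nonneg_pos nuc_norm_nonneg) auto
  show "0 \<le> c * gap (Theta s)" using c gap_nonneg[OF Theta_feasible] by simp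
  show "0 \<le> noise r (Theta s) / \<omega>" if "0 < r" for r
    using that pos eps_pos by (simp add: noise_def)
  have "c * (gap (Theta (Suc s)) + v / 2 * (norm ?y)\<^sup>2)
   \<le> c * (v / 2 * (norm ?x)\<^sup>2 - D / 2 * (norm ?x)\<^sup>2 + \<tau> * (nuc_norm ?x)\<^sup>2 + \<tau> * (nuc_norm ?x + nuc_norm ?y)\<^sup>2)"
    using c by (intro mult_left_mono prox_step_gap iterates) auto
  then show "c * (v / 2 * (norm ?y)\<^sup>2) + c * gap (Theta (Suc s))
     \<le> (1 - 4 * a) * (c * (v / 2 * (norm ?x)\<^sup>2)) + (nuc_norm ?x / \<omega>)\<^sup>2 + (nuc_norm ?x / \<omega> + nuc_norm ?y / \<omega>)\<^sup>2"
    unfolding cN add_divide_distrib[symmetric] D_eq by (auto simp: field_simps)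
  have "c * (D / 2 * (norm ?x)\<^sup>2 - \<tau> * (nuc_norm ?x)\<^sup>2) \<le> c * gap (Theta s)"
    using c by (intro mult_left_mono gap_quadratic_growth Theta_feasible) auto
  then show "4 * a * (c * (v / 2 * (norm ?x)\<^sup>2)) \<le> c * gap (Theta s) + (nuc_norm ?x / \<omega>)\<^sup>2"
    unfolding cN D_eq by (simp add: algebra_simps)
  show "(1 + b - r) * (c * (v / 2 * (norm ?y)\<^sup>2)) + 6 * max 0 (nuc_norm ?y / \<omega> - noise r (Theta (Suc s)) / \<omega>) - 2 * r * (nuc_norm ?y / \<omega>)\<^sup>2
        \<le> (1 - b) * (c * (v / 2 * (norm ?x)\<^sup>2)) + (nuc_norm ?x / \<omega> + nuc_norm ?y / \<omega>)\<^sup>2"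
    if r: "0 < r" "r \<le> 1" and b: "b \<le> 1" "b \<le> 4 * a" for r b
  proof -
    have "v * b \<le> D" unfolding D_eq using b pos by (simp add: mult.commute)
    from prox_step_linear[OF iterates r b(1) this, of s]
    have "c * (v / 2 * (1 + b - r) * (norm ?y)\<^sup>2 + \<tau> * (6 * \<omega> * max 0 (nuc_norm ?y - noise r (Theta (Suc s))) - 2 * r * (nuc_norm ?y)\<^sup>2))
      \<le> c * (v / 2 * (1 - b) * (norm ?x)\<^sup>2 + \<tau> * (nuc_norm ?x + nuc_norm ?y)\<^sup>2)"
      using c by (intro mult_left_mono) auto
    moreover have "6 * max 0 (nuc_norm ?y / \<omega> - noise r (Theta (Suc s)) / \<omega>)
        = c * (\<tau> * (6 * \<omega> * max 0 (nuc_norm ?y - noise r (Theta (Suc s)))))"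
    proof -
      have "max 0 (x / \<omega>) = max 0 x / \<omega>" for x using pos by (simp add: max_def zero_le_divide_iff)
      then show ?thesis using pos unfolding diff_divide_distrib[symmetric] by (simp add: c_def power2_eq_square)
    qed
    ultimately show ?thesis
      unfolding cN add_divide_distrib[symmetric] by (simp add: algebra_simps)
  qed
  show "(noise r (Theta s) / \<omega>)\<^sup>2 \<le> P * (c * (v / 2 * (norm ?x)\<^sup>2)) + a * \<Delta> / 160 / r\<^sup>2" if "0 < r" "r \<le> 1" for r
    using noise_scaled[OF that(1), of "Theta s"] unfolding cF .
  show "z \<le> 1 \<and> 6 * z - z\<^sup>2 \<le> c * gap (Theta s)"
    if r: "0 < r" "r \<le> 1" and z: "0 \<le> z" "z \<le> nuc_norm ?x / \<omega> - noise r (Theta s) / \<omega>" for r z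
  proof -
    have "eps \<le> eps / r" using r eps_pos by (simp add: pos_le_divide_eq)
    then have "noise 1 (Theta s) \<le> noise r (Theta s)" by (simp add: noise_def)
    moreover have "z * \<omega> \<le> nuc_norm ?x - noise r (Theta s)"
      using z pos by (simp add: diff_divide_distrib[symmetric] pos_le_divide_eq)
    ultimately have "z * \<omega> \<le> nuc_norm ?x - noise 1 (Theta s)" by linarith
    from gap_ge_away_from_minimizer[OF Theta_feasible _ this] z pos
    have *: "z * \<omega> \<le> \<omega>" "\<tau> * (6 * \<omega> * (z * \<omega>) - (z * \<omega>)\<^sup>2) \<le> gap (Theta s)" by auto
    have "c * (\<tau> * (6 * \<omega> * (z * \<omega>) - (z * \<omega>)\<^sup>2)) \<le> c * gap (Theta s)" using * c by (intro mult_left_mono) auto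
    moreover have "c * (\<tau> * (6 * \<omega> * (z * \<omega>) - (z * \<omega>)\<^sup>2)) = 6 * z - z\<^sup>2"
      using pos by (simp add: c_def power2_eq_square field_simps)
    ultimately show ?thesis using *(1) pos by simp
  qed
  show "0 \<le> P" "P \<le> a\<^sup>2 / 8" by (auto simp: P_def)
  show "P = 0" if "3 / 10 \<le> a" using large_part_rank_eq_0[OF that] by (simp add: P_def)
  show "2 * (a - 1 / 4) * (c * (v / 2 * (norm ?x)\<^sup>2)) \<le> (nuc_norm ?x / \<omega>)\<^sup>2" if "3 / 10 \<le> a"
  proof -
    have "(4 * a - 1) * v \<le> 4 * \<tau>" using curvature_le unfolding D_eq by (simp add: algebra_simps)
    then have "(4 * a - 1) * v * (norm ?x)\<^sup>2 \<le> 4 * \<tau> * (norm ?x)\<^sup>2" by (intro mult_right_mono) auto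
    also have "\<dots> \<le> 4 * \<tau> * (nuc_norm ?x)\<^sup>2" using pos norm_le_nuc_norm by (intro mult_left_mono power_mono) auto
    finally have "c * ((4 * a - 1) * v * (norm ?x)\<^sup>2) \<le> c * (4 * \<tau> * (nuc_norm ?x)\<^sup>2)" using c by (intro mult_left_mono) auto
    then show ?thesis unfolding cN by (simp add: algebra_simps)
  qed
qed

end

section \<open>Conclusion\<close>

lemma (in scaled_recursion) distance_le:
  assumes "\<kappa> ^ t * G 0 \<le> \<Delta>"
  shows "2 * a * f t \<le> \<Delta>"
proof (cases t)
  case 0
  then show ?thesis using initial_distance(2) assms by simp
next
  case (Suc s)
  consider "a \<le> 1/24" | "1/24 \<le> a" "a \<le> 1/8" | "1/8 \<le> a" "a \<le> 3/10" | "3/10 \<le> a" "7/20 \<le> \<Delta>" | "3/10 \<le> a" "\<Delta> < 7/20"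
    by linarith
  then show ?thesis
    using assms distance_le_small distance_le_medium1 distance_le_medium2 distance_le_large1 distance_le_large2
    unfolding Suc by cases blast+
qed

lemma (in tolerance_problem) iterate_distance_le:
  assumes "\<kappa> ^ t * gap (Theta 0) \<le> \<delta>"
  shows "(norm (Theta t - That))\<^sup>2 \<le> 4 / D * \<delta>"
proof -
  have c: "0 < c" using pos by (simp add: c_def)
  have \<Delta>_eq: "\<Delta> = c * \<delta>" by (simp add: \<Delta>_def c_def)
  have "c * (\<kappa> ^ t * gap (Theta 0)) \<le> c * \<delta>" using assms c by (intro mult_left_mono) auto
  then have "2 * a * (c * (v / 2 * (norm (Theta t - That))\<^sup>2)) \<le> c * \<delta>"
    using distance_le[of t] unfolding \<Delta>_eq by (simp add: mult.left_commute)
  then have "c * (a * v * (norm (Theta t - That))\<^sup>2) \<le> c * \<delta>" by (simp add: mult_ac)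
  then have "a * v * (norm (Theta t - That))\<^sup>2 \<le> \<delta>" using c by simp
  moreover have "a * v = D / 4" unfolding D_eq by simp
  ultimately have "D / 4 * (norm (Theta t - That))\<^sup>2 \<le> \<delta>" by simp
  then show ?thesis using curvature by (simp add: field_simps)
qed

text \<open>The iterated-logarithm summand is nonnegative, so \<open>t\<close> is at least the
  number of steps in which a factor \<kappa> per step brings \<open>g\<close> down to
  \<open>\<delta>\<close>.\<close>

lemma iteration_bound_gap_le:
  assumes \<kappa>: "0 < \<kappa>" "\<kappa> < 1" and \<delta>: "0 < \<delta>" and g: "0 \<le> g"
    and t: "iteration_bound \<omega> lam \<kappa> g \<delta> \<le> ereal (real t)"
  shows "\<kappa> ^ t * g \<le> \<delta>"
proof (cases "g = 0")
  case True
  then show ?thesis using \<delta> by simp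
next
  case False
  have l: "0 < ln (1 / \<kappa>)" using \<kappa> by simp
  have "0 \<le> loglog2 (\<omega> * lam / \<delta>)" by (simp add: loglog2_def)
  then have "0 \<le> loglog2 (\<omega> * lam / \<delta>) * (1 + ln 2 / ln (1 / \<kappa>))" using l by (intro mult_nonneg_nonneg) auto
  then have "ln (g / \<delta>) / ln (1 / \<kappa>) \<le> real t" using t False by (simp add: iteration_bound_def)
  then have "ln (g / \<delta>) \<le> real t * ln (1 / \<kappa>)" using l by (simp add: pos_divide_le_eq)
  also have "\<dots> = ln ((1 / \<kappa>) ^ t)" using \<kappa> by (simp add: ln_realpow)
  finally have "g / \<delta> \<le> (1 / \<kappa>) ^ t" using False g \<delta> \<kappa> by (subst (asm) ln_le_cancel_iff) auto
  then show ?thesis using \<delta> \<kappa> by (simp add: power_one_over field_simps)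
qed

theorem theorem2:
  fixes L :: "real^'n^'m \<Rightarrow> real"
    and p :: "real \<Rightarrow> real"
    and Theta_star Theta_hat :: "real^'n^'m"
    and Theta :: "nat \<Rightarrow> real^'n^'m"
    and q R \<omega> lam \<mu> \<alpha>\<^sub>2 \<tau>\<^sub>2 \<alpha>\<^sub>3 \<tau>\<^sub>3 \<tau> v \<epsilon> \<kappa> \<xi> \<delta> :: real
    and t :: nat
  assumes loss_nonneg: "\<forall>X. L X \<ge> 0"
    and loss_differentiable: "\<forall>X. L differentiable (at X)"
    and q: "0 \<le> q" "q \<le> 1"
    and positive: "R > 0" "\<omega> > 0" "lam > 0"
    and true_parameter: "Theta_star \<in> schatten_ball q R \<inter> feasible \<omega>"
    and global_solution: "is_arg_min (objective L p) (\<lambda>X. X \<in> feasible \<omega>) Theta_hat"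
    and mu: "\<mu> \<ge> 0"
    and regularizer: "admissible_regularizer lam \<mu> p"
    and constants: "\<alpha>\<^sub>2 > 0" "\<tau>\<^sub>2 > 0" "\<alpha>\<^sub>3 > 0" "\<tau>\<^sub>3 > 0" "\<alpha>\<^sub>2 > \<mu> / 2"
    and RSC: "\<forall>X Y. taylor_error L X Y \<ge>
                \<alpha>\<^sub>2 * (frob_norm (X - Y))\<^sup>2 - \<tau>\<^sub>2 * (nuc_norm (X - Y))\<^sup>2"
    and RSM: "\<forall>X Y. taylor_error L X Y \<le>
                \<alpha>\<^sub>3 * (frob_norm (X - Y))\<^sup>2 + \<tau>\<^sub>3 * (nuc_norm (X - Y))\<^sup>2"
    and tau: "\<tau> = max \<tau>\<^sub>2 \<tau>\<^sub>3"
    and lambda: "lam \<ge> max (4 * op_norm (grad L Theta_star)) (8 * \<omega> * \<tau>)"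
                "if q = 0 then 256 * \<tau> * R / (2*\<alpha>\<^sub>2 - \<mu>) \<le> 1
                 else lam \<ge> (256 * \<tau> * R / (2*\<alpha>\<^sub>2 - \<mu>)) powr (1 / q)"
    and step_size: "v \<ge> max ((2*\<alpha>\<^sub>2 - \<mu>) / 4) (2 * \<alpha>\<^sub>3)"
    and initial: "Theta 0 \<in> feasible \<omega>"
    and iterates: "\<forall>s. is_arg_min (prox_objective L lam p v (Theta s))
                         (\<lambda>X. X \<in> feasible \<omega>) (Theta (Suc s))"
    and eps: "\<epsilon> = stat_error q R lam Theta_hat Theta_star"
    and kappa: "\<kappa> = contraction_factor q R lam \<alpha>\<^sub>2 \<mu> \<tau> v" "0 < \<kappa>" "\<kappa> < 1"
    and xi: "\<xi> = xi_factor q R lam \<alpha>\<^sub>2 \<mu> \<tau> v"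
    and tolerance: "\<delta> \<ge> 8 * \<xi> / (1 - \<kappa>) * \<epsilon>\<^sup>2"
    and iteration: "ereal (real t) \<ge>
          iteration_bound \<omega> lam \<kappa> (objective L p (Theta 0) - objective L p Theta_hat) \<delta>"
  shows "(frob_norm (Theta t - Theta_hat))\<^sup>2 \<le>
           4 / (2*\<alpha>\<^sub>2 - \<mu>) * (\<delta> + \<delta>\<^sup>2 / (8 * \<tau> * \<omega>\<^sup>2) + 4 * \<tau> * \<epsilon>\<^sup>2)"
proof -
  have tau': "\<tau>\<^sub>2 \<le> \<tau>" "\<tau>\<^sub>3 \<le> \<tau>" "0 < \<tau>" using tau constants by auto
  have rsc: "\<alpha>\<^sub>2 * (norm (X - Y))\<^sup>2 - \<tau> * (nuc_norm (X - Y))\<^sup>2 \<le> taylor_error L X Y"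
    and rsm: "taylor_error L X Y \<le> \<alpha>\<^sub>3 * (norm (X - Y))\<^sup>2 + \<tau> * (nuc_norm (X - Y))\<^sup>2" for X Y
    using RSC[rule_format, where X = X and Y = Y] RSM[rule_format, where X = X and Y = Y]
      mult_right_mono[OF tau'(1) zero_le_power2[of "nuc_norm (X - Y)"]]
      mult_right_mono[OF tau'(2) zero_le_power2[of "nuc_norm (X - Y)"]]
    unfolding frob_norm_eq_norm by linarith+
  interpret composite_problem L p Theta_hat \<omega> lam \<mu> \<alpha>\<^sub>2 \<alpha>\<^sub>3 \<tau> v
    using loss_differentiable regularizer positive tau' constants step_size rsc rsm global_solution
    by unfold_locales (auto simp: is_arg_min_linorder)
  interpret low_rank_problem L p Theta_hat \<omega> lam \<mu> \<alpha>\<^sub>2 \<alpha>\<^sub>3 \<tau> v Theta_star q R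
    using true_parameter q positive mu constants lambda by unfold_locales auto
  define a \<Delta> P where "a = (2*\<alpha>\<^sub>2 - \<mu>) / (4 * v)" and "\<Delta> = \<delta> / (\<tau> * \<omega>\<^sup>2)"
    and "P = (if large_part_rank = 0 then 0 else a\<^sup>2 / 8)"
  interpret tolerance_problem L p Theta_hat \<omega> lam \<mu> \<alpha>\<^sub>2 \<alpha>\<^sub>3 \<tau> v Theta_star q R \<kappa> \<delta> a \<Delta> P Theta
  proof unfold_locales
    show "2 * \<alpha>\<^sub>2 - \<mu> \<le> 4 * v" using step_size by simp
    show "8 * xi_factor q R lam \<alpha>\<^sub>2 \<mu> \<tau> v / (1 - \<kappa>) * eps\<^sup>2 \<le> \<delta>"
      using tolerance by (simp add: xi eps eps_def)
  qed (use kappa initial iterates in \<open>auto simp: a_def \<Delta>_def P_def\<close>)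
  have "\<kappa> ^ t * gap (Theta 0) \<le> \<delta>"
    using iteration kappa \<delta>_pos gap_nonneg[OF initial] by (intro iteration_bound_gap_le) (auto simp: gap_def)
  then have "(frob_norm (Theta t - Theta_hat))\<^sup>2 \<le> 4 / (2*\<alpha>\<^sub>2 - \<mu>) * \<delta>"
    unfolding frob_norm_eq_norm by (rule iterate_distance_le)
  \<comment> \<open>The distance is already bounded with \<open>\<delta>\<close> alone in the
    parentheses; the two summands added here are nonnegative.\<close>
  also have "\<dots> \<le> 4 / (2*\<alpha>\<^sub>2 - \<mu>) * (\<delta> + \<delta>\<^sup>2 / (8 * \<tau> * \<omega>\<^sup>2) + 4 * \<tau> * \<epsilon>\<^sup>2)"
    using constants tau' by (intro mult_left_mono) auto
  finally show ?thesis .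
qed

end
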